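(* Let $\mu$ be a finite measure on a countably generated measurable space $(\mathbb{X},\mathcal{X})$, and let $\mathrm{NPD}$ be the probability measure on $(\mathbb{X}^{\mathbb{Z}},\mathcal{X}^{\mathbb{Z}})$ whose $n$-dimensional densities with respect to $\mu^n$ are $\mathrm{NPD}_\mu(x_{1:n})$. Then $\mathrm{NPD}$ is universal with respect to $\mu$: for every $P\in\mathbb{E}(\mu)$, $\lim_n[-\log\mathrm{NPD}_\mu(X_{1:n})]/n=h_\mu$ $P$-a.s., $\lim_n\mathbb{E}[-\log\mathrm{NPD}_\mu(X_{1:n})]/n=h_\mu$, and $[-\log\mathrm{NPD}_\mu(X_{1:n})]/n\to h_\mu$ in $P$-probability.
   Context: On $(\mathbb{X}^{\mathbb{Z}},\mathcal{X}^{\mathbb{Z}})$, $X_k$ are coordinate maps, $x_{j:k}=(x_j,\dots,x_k)$; for a probability measure $P$, $P_n(A)=P(X_{1:n}\in A)$ and $P_\mu=dP_n/d\mu^n$ if $P_n\ll\mu^n$. $\mathbb{E}$: shift-stationary ergodic probability measures. For $P\in\mathbb{E}$ with $P_n\ll\mu^n$: $h_\mu(n)=\mathbb{E}[-\log P_\mu(X_{1:n})]$, $h_\mu=\lim_n h_\mu(n)/n$; $\mathbb{E}(\mu)=\{P\in\mathbb{E}:P_n\ll\mu^n\ \forall n,\ |h_\mu|<\infty\}$; expectations and "a.s." refer to $P$. NPD density: fix finite $\sigma$-fields $\mathcal{X}_0\subset\mathcal{X}_1\subset\cdots\subset\mathcal{X}$ with $\mathcal{X}_0=\{\emptyset,\mathbb{X}\}$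 and $\sigma(\bigcup_l\mathcal{X}_l)=\mathcal{X}$; let $\chi_l$ be the finite partition generating $\mathcal{X}_l$. For $x\in\mathbb{X}$ let $x^l$ be the cell $A\in\chi_l$ with $x\in A$, $x^l_{1:n}=(x^l_1,\dots,x^l_n)$. Treat $\chi_l$ as a finite alphabet and let $R^l$ be a probability measure on $\chi_l^{\mathbb{Z}}$ universal with respect to the alphabet $\chi_l$ (for every stationary ergodic process $(Y_i)$ over $\chi_l$ with Shannon entropy rate $H$, $-\frac1n\log R^l(Y_{1:n})\to H$ a.s., in expectation and in probability), $R^l(a_{1:n})$ the cylinder probability. $\mathrm{NPD}^l_\mu(x_{1:n})=R^l(x^l_{1:n})/\prod_{i=1}^n\mu(x_i^l)$, $\mathrm{NPD}_\mu(x_{1:n})=\sum_{l\ge0}w_l\mathrm{NPD}^l_\mu(x_{1:n})$, $w_l=\frac1{l+1}-\frac1{l+2}$. (These densities are consistent and define a probability measure $\mathrm{NPD}$.) *)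

theory Defs
  imports "HOL-Probability.Probability"
begin

definition shift :: "(int \<Rightarrow> 'a) \<Rightarrow> int \<Rightarrow> 'a" where
  "shift \<omega> = (\<lambda>i. \<omega> (i + 1))"

definition seq_space :: "'a measure \<Rightarrow> (int \<Rightarrow> 'a) measure" where
  "seq_space M = (\<Pi>\<^sub>M i\<in>UNIV. M)"

definition stationary_ergodic :: "'a measure \<Rightarrow> (int \<Rightarrow> 'a) measure \<Rightarrow> bool" where
  "stationary_ergodic M P \<longleftrightarrow> prob_space P \<and> sets P = sets (seq_space M) \<and>
     (\<forall>A\<in>sets P. emeasure P (shift -` A \<inter> space P) = emeasure P A) \<and>
     (\<forall>A\<in>sets P. shift -` A \<inter> space P = A \<longrightarrow> emeasure P A = 0 \<or> emeasure P A = 1)"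

definition block :: "nat \<Rightarrow> (int \<Rightarrow> 'a) \<Rightarrow> int \<Rightarrow> 'a" where
  "block n \<omega> = restrict \<omega> {1..int n}"

definition prodM :: "'a measure \<Rightarrow> nat \<Rightarrow> (int \<Rightarrow> 'a) measure" where
  "prodM \<mu> n = (\<Pi>\<^sub>M i\<in>{1..int n}. \<mu>)"

definition marg :: "'a measure \<Rightarrow> (int \<Rightarrow> 'a) measure \<Rightarrow> nat \<Rightarrow> (int \<Rightarrow> 'a) measure" where
  "marg \<mu> P n = distr P (prodM \<mu> n) (block n)"

definition neglog :: "ennreal \<Rightarrow> ereal" where
  "neglog p = (if p = 0 then \<infinity> else if p = \<top> then - \<infinity> else ereal (- ln (enn2real p)))"

definition ereal_expect :: "'b measure \<Rightarrow> ('b \<Rightarrow> ereal) \<Rightarrow> ereal" where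
  "ereal_expect P f = enn2ereal (\<integral>\<^sup>+x. e2ennreal (f x) \<partial>P) - enn2ereal (\<integral>\<^sup>+x. e2ennreal (- f x) \<partial>P)"

definition dens :: "'a measure \<Rightarrow> (int \<Rightarrow> 'a) measure \<Rightarrow> nat \<Rightarrow> (int \<Rightarrow> 'a) \<Rightarrow> ennreal" where
  "dens \<mu> P n \<omega> = RN_deriv (prodM \<mu> n) (marg \<mu> P n) (block n \<omega>)"

definition hmu :: "'a measure \<Rightarrow> (int \<Rightarrow> 'a) measure \<Rightarrow> nat \<Rightarrow> ereal" where
  "hmu \<mu> P n = ereal_expect P (\<lambda>\<omega>. neglog (dens \<mu> P n \<omega>))"

text \<open>Stationary ergodic P with P_n << mu^n for all n (finiteness of h_mu is imposed separately)\<close>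

definition in_E_base :: "'a measure \<Rightarrow> (int \<Rightarrow> 'a) measure \<Rightarrow> bool" where
  "in_E_base \<mu> P \<longleftrightarrow> stationary_ergodic \<mu> P \<and>
     (\<forall>n. absolutely_continuous (prodM \<mu> n) (marg \<mu> P n))"

definition universal_conv :: "'b measure \<Rightarrow> (nat \<Rightarrow> 'b \<Rightarrow> ereal) \<Rightarrow> real \<Rightarrow> bool" where
  "universal_conv P L h \<longleftrightarrow>
     (AE \<omega> in P. (\<lambda>n. L n \<omega> / ereal (real n)) \<longlonglongrightarrow> ereal h) \<and>
     ((\<lambda>n. ereal_expect P (L n) / ereal (real n)) \<longlonglongrightarrow> ereal h) \<and>
     (\<forall>\<epsilon>>0. (\<lambda>n. measure P {\<omega> \<in> space P. \<bar>L n \<omega> / ereal (real n) - ereal h\<bar> > ereal \<epsilon>})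
        \<longlonglongrightarrow> 0)"

text \<open>A density family q (q n omega = density of the n-dim. marginal at X_{1:n}(omega))
  is universal w.r.t. mu: for every P in E(mu), i.e. in_E_base with h_mu(n)/n -> h finite.\<close>

definition universal_wrt :: "'a measure \<Rightarrow> (nat \<Rightarrow> (int \<Rightarrow> 'a) \<Rightarrow> ennreal) \<Rightarrow> bool" where
  "universal_wrt \<mu> q \<longleftrightarrow>
     (\<forall>P h. in_E_base \<mu> P \<and> ((\<lambda>n. hmu \<mu> P n / ereal (real n)) \<longlonglongrightarrow> ereal h) \<longrightarrow>
        universal_conv P (\<lambda>n \<omega>. neglog (q n \<omega>)) h)"

definition cyl_prob :: "(int \<Rightarrow> 'b) measure \<Rightarrow> nat \<Rightarrow> (int \<Rightarrow> 'b) \<Rightarrow> ennreal" where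
  "cyl_prob R n a = emeasure R {\<omega> \<in> space R. \<forall>i\<in>{1..int n}. \<omega> i = a i}"

definition shannon_rate :: "'b set \<Rightarrow> (int \<Rightarrow> 'b) measure \<Rightarrow> real" where
  "shannon_rate A Q = lim (\<lambda>n.
     (- (\<Sum>a\<in>PiE {1..int n} (\<lambda>_. A).
          measure Q {\<omega> \<in> space Q. \<forall>i\<in>{1..int n}. \<omega> i = a i}
          * ln (measure Q {\<omega> \<in> space Q. \<forall>i\<in>{1..int n}. \<omega> i = a i}))) / real n)"

definition universal_alphabet :: "'b set \<Rightarrow> (int \<Rightarrow> 'b) measure \<Rightarrow> bool" where
  "universal_alphabet A R \<longleftrightarrow> prob_space R \<and> sets R = sets (seq_space (count_space A)) \<and>
     (\<forall>Q. stationary_ergodic (count_space A) Q \<longrightarrow>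
        universal_conv Q (\<lambda>n \<omega>. neglog (cyl_prob R n \<omega>)) (shannon_rate A Q))"

definition partition_filtration :: "'a measure \<Rightarrow> (nat \<Rightarrow> 'a set set) \<Rightarrow> bool" where
  "partition_filtration \<mu> Ch \<longleftrightarrow>
     (\<forall>l. finite (Ch l) \<and> Ch l \<subseteq> sets \<mu> \<and> \<Union>(Ch l) = space \<mu> \<and> disjoint (Ch l)) \<and>
     Ch 0 = {space \<mu>} \<and>
     (\<forall>l. \<forall>B\<in>Ch (Suc l). \<exists>A\<in>Ch l. B \<subseteq> A) \<and>
     sets \<mu> = sigma_sets (space \<mu>) (\<Union>l. Ch l)"

definition cell :: "(nat \<Rightarrow> 'a set set) \<Rightarrow> nat \<Rightarrow> 'a \<Rightarrow> 'a set" where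
  "cell Ch l x = (THE A. A \<in> Ch l \<and> x \<in> A)"

definition npd_l :: "'a measure \<Rightarrow> (nat \<Rightarrow> 'a set set) \<Rightarrow> (nat \<Rightarrow> (int \<Rightarrow> 'a set) measure)
     \<Rightarrow> nat \<Rightarrow> nat \<Rightarrow> (int \<Rightarrow> 'a) \<Rightarrow> ennreal" where
  "npd_l \<mu> Ch R l n \<omega> =
     cyl_prob (R l) n (\<lambda>i. cell Ch l (\<omega> i)) / (\<Prod>i\<in>{1..int n}. emeasure \<mu> (cell Ch l (\<omega> i)))"

definition npd :: "'a measure \<Rightarrow> (nat \<Rightarrow> 'a set set) \<Rightarrow> (nat \<Rightarrow> (int \<Rightarrow> 'a set) measure)
     \<Rightarrow> nat \<Rightarrow> (int \<Rightarrow> 'a) \<Rightarrow> ennreal" where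
  "npd \<mu> Ch R n \<omega> =
     (\<Sum>l. ennreal (1 / (real l + 1) - 1 / (real l + 2)) * npd_l \<mu> Ch R l n \<omega>)"

end

theory Submission
  imports Defs
begin

text \<open>
  Upper bound: \<open>NPD \<ge> w\<^sub>l NPD\<^sup>l\<close>, so universality of \<open>R\<^sup>l\<close> and Birkhoff's theorem for
  \<open>ln \<mu>(x\<^sup>l)\<close> bound the limit superior by the entropy rate of the level-\<open>l\<close> quantization relative to
  \<open>\<mu>\<close>. By subadditivity that rate is at most the \<open>n\<close>-block quantized entropy divided by \<open>n\<close>, and for
  fixed \<open>n\<close> the latter comes arbitrarily close to \<open>h\<^sub>\<mu>(n)\<close> as \<open>l\<close> grows, since functions of the
  cells are dense in \<open>L\<^sup>1\<close>.

  Lower bound, without the Shannon--McMillan--Breiman theorem: NPD is dominated, up to subexponential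
  factors, by a subprobability density \<open>r\<close> satisfying
  \<open>r(x\<^sub>1\<^sub>:\<^sub>m\<^sub>+\<^sub>k) \<ge> wt(m) r(x\<^sub>1\<^sub>:\<^sub>m) r(x\<^sub>m\<^sub>+\<^sub>1\<^sub>:\<^sub>m\<^sub>+\<^sub>k)\<close>. If \<open>- ln r\<close> grew more slowly than \<open>h\<^sub>\<mu> n\<close>
  along a subsequence, cutting orbits greedily into cheap blocks would make its mean smaller than
  \<open>h\<^sub>\<mu>(n)\<close>, contradicting Gibbs' inequality.
\<close>

subsection \<open>Almost subadditive sequences over an ergodic transformation\<close>

text \<open>In the lower bound the obstacle is that \<open>- ln NPD\<close> has no reason to be
  subadditive along orbits. \<open>envelope\<close> forces it: for every cut of a word into two
  pieces, the product of the two shorter envelopes is added. The weights \<open>wt m\<close> have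
  sum at most 1, so the total mass stays at most 1, and \<open>- ln (wt m)\<close> is o(m), so the
  rate does not change. The last summand is half \<open>q\<close> and half the uniform density
  \<open>1 / u ^ n\<close>, with u the total mass of \<mu>. The uniform half bounds
  \<open>- ln r\<close> from above; this gives both the price of a single letter in the greedy cut
  and the integrability in Gibbs' inequality. In the upper bound the limits conflict: universality
  of \<open>R l\<close> needs l fixed and n growing, quantization needs n fixed and l growing.
  Subadditivity resolves this: a block length n is fixed first, then a level l, and the n-block
  value bounds the whole rate at level l. The bounds on means are proved separately from the almost
  sure ones. The entropies \<open>hmu \<mu> P n\<close> may be infinite for small n, so every
  statement about them is eventual.\<close>

lemma Fekete_real:
  fixes a :: "nat \<Rightarrow> real"
  assumes nn: "\<And>n. 0 \<le> a n" and sub: "\<And>m n. a (m + n) \<le> a m + a n"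
  shows "convergent (\<lambda>n. a n / real n)" and "\<And>n. n \<ge> 1 \<Longrightarrow> lim (\<lambda>n. a n / real n) \<le> a n / real n"
proof -
  define I where "I = (INF n\<in>{1..}. a n / real n)"
  have bdd: "bdd_below ((\<lambda>n. a n / real n) ` {1..})"
    by (rule bdd_belowI[of _ 0]) (auto simp: nn)
  have low: "I \<le> a n / real n" if "n \<ge> 1" for n
    unfolding I_def using that by (intro cINF_lower bdd) auto
  have mul: "a (q * m + r) \<le> real q * a m + a r" for q m r
  proof (induction q)
    case (Suc q)
    have "a (Suc q * m + r) \<le> a m + a (q * m + r)"
      using sub[of m "q * m + r"] by (simp add: add.assoc)
    then show ?case using Suc by (simp add: algebra_simps)
  qed simp
  have "(\<lambda>n. a n / real n) \<longlonglongrightarrow> I"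
  proof (rule LIMSEQ_I)
    fix e :: real assume e: "e > 0"
    then obtain m where m: "m \<ge> 1" "a m / real m < I + e / 2"
      using cINF_less_iff[of "{1..}" "\<lambda>n. a n / real n" "I + e/2"] bdd unfolding I_def[symmetric] by auto
    \<comment> \<open>A bound for \<open>a\<close> at all remainders modulo m; after division by n
      it vanishes.\<close>
    define B where "B = (\<Sum>r<m. a r)"
    have B: "a r \<le> B" if "r < m" for r
      unfolding B_def using that by (intro member_le_sum) (auto simp: nn)
    have "(\<lambda>n. B / real n) \<longlonglongrightarrow> 0" by (rule lim_const_over_n)
    then obtain N where N: "\<And>n. n \<ge> N \<Longrightarrow> \<bar>B / real n\<bar> < e / 2"
      using LIMSEQ_D[of "\<lambda>n. B / real n" 0 "e/2"] e by auto
    show "\<exists>N. \<forall>n\<ge>N. norm (a n / real n - I) < e"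
    proof (intro exI[of _ "max 1 N"] allI impI)
      fix n assume n: "max 1 N \<le> n"
      have "a n \<le> real (n div m) * a m + a (n mod m)"
        using mul[of "n div m" m "n mod m"] by simp
      also have "\<dots> \<le> (real n / real m) * a m + B"
        using m B[of "n mod m"] nn[of m]
        by (intro add_mono mult_right_mono) (auto simp: of_nat_div_le_of_nat)
      finally have "a n / real n \<le> a m / real m + B / real n"
        using n m by (simp add: field_simps)
      moreover have "\<bar>B / real n\<bar> < e / 2" using N[of n] n by simp
      ultimately show "norm (a n / real n - I) < e"
        using low[of n] n m by (simp only: real_norm_def) linarith
    qed
  qed
  then show "convergent (\<lambda>n. a n / real n)" and "\<And>n. n \<ge> 1 \<Longrightarrow> lim (\<lambda>n. a n / real n) \<le> a n / real n"
    using low by (auto simp: convergentI limI)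
qed

text \<open>Cut the orbit from the left: at a point of \<open>E\<close> remove a block of length at
  most K and slope at most d, elsewhere remove one letter. A single letter costs at most C \<le> d +
  D, so each visit outside \<open>E\<close> adds at most D to the slope d. The fewer than K letters
  left at the end are paid for by D K.\<close>

lemma greedy_block_bound:
  fixes L :: "nat \<Rightarrow> 'b \<Rightarrow> real" and T :: "'b \<Rightarrow> 'b" and b :: "nat \<Rightarrow> real"
  assumes L0: "\<And>x. L 0 x = 0"
    and sub: "\<And>m k x. m \<ge> 1 \<Longrightarrow> L (m + k) x \<le> L m x + L k ((T ^^ m) x) + b m"
    and single: "\<And>x. L 1 x + b 1 \<le> C"
    and E: "\<And>x. x \<in> E \<Longrightarrow> \<exists>m\<ge>1. m \<le> K \<and> L m x + b m \<le> d * real m"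
    and D: "D \<ge> 0" "D \<ge> C - d"
  shows "L N x \<le> d * real N + D * ((\<Sum>i<N. indicator (- E) ((T ^^ i) x)) + real K)"
proof (induction N arbitrary: x rule: less_induct)
  case (less N)
  consider "N = 0" | "N > 0" "x \<in> E" "K \<le> N" | "N > 0" "x \<in> E" "N < K" | "N > 0" "x \<notin> E" by linarith
  then show ?case
  proof cases
    case 1
    then show ?thesis using D by (simp add: L0)
  next
    case 2
    then obtain m where m: "m \<ge> 1" "m \<le> K" "L m x + b m \<le> d * real m" using E by blast
    define k where "k = N - m"
    have k: "N = m + k" "k < N" using m 2 unfolding k_def by auto
    \<comment> \<open>Visits outside \<open>E\<close> after the removed block are among those
      counted from x; visits inside the block are counted without being charged.\<close>
    have "(\<Sum>i<k. indicator (- E) ((T ^^ i) ((T ^^ m) x))) = (\<Sum>i\<in>{m..<N}. indicator (- E) ((T ^^ i) x) :: real)"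
      by (rule sum.reindex_bij_witness[of _ "\<lambda>i. i - m" "\<lambda>i. i + m"])
         (use k in \<open>auto simp: funpow_add\<close>)
    also have "\<dots> \<le> (\<Sum>i<N. indicator (- E) ((T ^^ i) x))"
      by (intro sum_mono2) auto
    finally have s: "D * ((\<Sum>i<k. indicator (- E) ((T ^^ i) ((T ^^ m) x))) + real K)
        \<le> D * ((\<Sum>i<N. indicator (- E) ((T ^^ i) x)) + real K)"
      using D by (intro mult_left_mono) auto
    have "L N x \<le> L m x + L k ((T ^^ m) x) + b m" using sub[OF m(1)] k by simp
    then show ?thesis using less[OF k(2), of "(T ^^ m) x"] m(3) s k by (simp add: algebra_simps)
  next
    case 3
    \<comment> \<open>Fewer than K letters remain, so a cheap block may not fit; the rest is split
      into single letters.\<close>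
    have "L n y \<le> C * real n" for n y
    proof (induction n arbitrary: y)
      case (Suc n)
      show ?case using sub[of 1 n y] single[of y] Suc[of "T y"] by (simp add: algebra_simps)
    qed (simp add: L0)
    then have "L N x \<le> C * real N" .
    also have "\<dots> \<le> (d + D) * real N" using D by (intro mult_right_mono) auto
    also have "\<dots> \<le> d * real N + D * ((\<Sum>i<N. indicator (- E) ((T ^^ i) x)) + real K)"
    proof -
      have "real N \<le> (\<Sum>i<N. indicator (- E) ((T ^^ i) x)) + real K"
        using 3 by (intro order_trans[OF _ add_mono[OF sum_nonneg order_refl]]) auto
      from mult_left_mono[OF this D(1)] show ?thesis by (simp add: algebra_simps)
    qed
    finally show ?thesis .
  next
    case 4
    then obtain k where k: "N = Suc k" by (cases N) auto
    have s: "(\<Sum>i<N. indicator (- E) ((T ^^ i) x)) = 1 + (\<Sum>i<k. indicator (- E) ((T ^^ i) (T x)) :: real)"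
      unfolding k by (subst sum.lessThan_Suc_shift) (use 4 in \<open>simp add: funpow_swap1\<close>)
    have "L N x \<le> L 1 x + L k (T x) + b 1" using sub[of 1 k x] k by simp
    then show ?thesis unfolding s using less[of k "T x"] k single[of x] D(2) by (simp add: algebra_simps)
  qed
qed

text \<open>Ergodicity is stated for sets equal to their preimage only. The iterated preimages of B
  decrease and all have the measure of B, so their intersection is strictly invariant and has that
  measure too.\<close>

lemma AE_subinvariant_zero_one:
  assumes "prob_space P" and T: "T \<in> measurable P P"
    and pres: "\<And>A. A \<in> sets P \<Longrightarrow> emeasure P (T -` A \<inter> space P) = emeasure P A"
    and erg: "\<And>A. A \<in> sets P \<Longrightarrow> T -` A \<inter> space P = A \<Longrightarrow> emeasure P A = 0 \<or> emeasure P A = 1"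
    and B: "B \<in> sets P" and sub: "T -` B \<inter> space P \<subseteq> B"
  shows "emeasure P B = 0 \<or> emeasure P B = 1"
proof -
  interpret prob_space P by fact
  define S where "S n = ((\<lambda>A. T -` A \<inter> space P) ^^ n) B" for n
  have S0: "S 0 = B" and SS: "S (Suc n) = T -` S n \<inter> space P" for n unfolding S_def by auto
  have S_sets: "S n \<in> sets P" for n
    by (induction n) (auto simp: S0 SS B measurable_sets[OF T])
  have S_eq: "emeasure P (S n) = emeasure P B" for n
    by (induction n) (auto simp: S0 SS pres[OF S_sets])
  have S_dec: "S (Suc n) \<subseteq> S n" for n
  proof (induction n)
    case (Suc n)
    then show ?case unfolding SS[of "Suc n"] SS[of n] by blast
  qed (use sub in \<open>simp add: S0 SS\<close>)
  have dec: "decseq S" by (rule decseq_SucI) (rule S_dec)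
  have "T -` (\<Inter>n. S n) \<inter> space P = (\<Inter>n. S (Suc n))" unfolding SS by blast
  also have "\<dots> = (\<Inter>n. S n)" using S_dec by (auto; blast)
  finally have "emeasure P (\<Inter>n. S n) = 0 \<or> emeasure P (\<Inter>n. S n) = 1"
    by (intro erg) (use S_sets in auto)
  moreover have "emeasure P (\<Inter>n. S n) = emeasure P B"
  proof -
    have "(\<lambda>n. emeasure P (S n)) \<longlonglongrightarrow> emeasure P (\<Inter>n. S n)"
      using S_sets dec by (intro Lim_emeasure_decseq) auto
    then show ?thesis unfolding S_eq by (simp add: LIMSEQ_const_iff)
  qed
  ultimately show ?thesis by simp
qed

text \<open>If L n / n dips below c infinitely often with positive probability, then by the zero-one
  law almost every orbit has cheap blocks starting almost everywhere along it. The greedy cut then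
  makes the mean of L n smaller than \<open>mean\<close> allows.\<close>

lemma ergodic_liminf_bound:
  fixes L :: "nat \<Rightarrow> 'b \<Rightarrow> real" and T :: "'b \<Rightarrow> 'b" and b :: "nat \<Rightarrow> real"
  assumes "prob_space P" and T: "T \<in> measurable P P"
    and pres: "\<And>A. A \<in> sets P \<Longrightarrow> emeasure P (T -` A \<inter> space P) = emeasure P A"
    and erg: "\<And>A. A \<in> sets P \<Longrightarrow> T -` A \<inter> space P = A \<Longrightarrow> emeasure P A = 0 \<or> emeasure P A = 1"
    and meas [measurable]: "\<And>n. L n \<in> borel_measurable P"
    and L0: "\<And>x. L 0 x = 0"
    and sub: "\<And>m k x. m \<ge> 1 \<Longrightarrow> L (m + k) x \<le> L m x + L k ((T ^^ m) x) + b m"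
    and single: "\<And>x. L 1 x + b 1 \<le> C"
    and b: "(\<lambda>n. b n / real n) \<longlonglongrightarrow> 0"
    and mean: "\<And>\<delta>. \<delta> > 0 \<Longrightarrow> \<forall>\<^sub>F n in sequentially. integrable P (L n) \<and> real n * (h - \<delta>) \<le> (\<integral>x. L n x \<partial>P)"
    and "c < h"
  shows "AE x in P. \<forall>\<^sub>F n in sequentially. c * real n \<le> L n x"
proof -
  interpret prob_space P by fact
  define e where "e = (h - c) / 4"
  have e: "e > 0" using \<open>c < h\<close> by (simp add: e_def)
  \<comment> \<open>Slopes that increase strictly from c = a 0 towards c + e. Passing from T x to x
    costs the constant C, which the gap between a j and a (Suc j) absorbs for large n; hence the
    union over j in \<open>B\<close> is sub-invariant.\<close>
  define a where "a j = c + e - e / real (Suc j)" for j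
  define B where "B = {x \<in> space P. \<exists>j. \<exists>\<^sub>F n in sequentially. L n x < a j * real n}"
  have B [measurable]: "B \<in> sets P"
    unfolding B_def frequently_sequentially by measurable
  have step: "T -` B \<inter> space P \<subseteq> B"
  proof
    fix x assume "x \<in> T -` B \<inter> space P"
    then obtain j where x: "x \<in> space P" and j: "\<exists>\<^sub>F n in sequentially. L n (T x) < a j * real n"
      unfolding B_def by auto
    have lt: "a j < a (Suc j)" unfolding a_def using e by (simp add: frac_less2)
    have "((\<lambda>n. (C - a j) / real n) \<longlonglongrightarrow> 0)" by (rule lim_const_over_n)
    then have "\<forall>\<^sub>F n in sequentially. (C - a j) / real n < a (Suc j) - a j"
      using lt by (intro order_tendstoD) auto
    then have "\<forall>\<^sub>F n in sequentially. (C - a j) / real (Suc n) < a (Suc j) - a j"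
      by (rule eventually_sequentially_Suc[THEN iffD2])
    with j have "\<exists>\<^sub>F n in sequentially. L (Suc n) x < a (Suc j) * real (Suc n)"
    proof (rule frequently_eventually_frequently[THEN frequently_elim1], safe)
      fix n assume *: "L n (T x) < a j * real n" "(C - a j) / real (Suc n) < a (Suc j) - a j"
      have "L (Suc n) x \<le> C + L n (T x)" using sub[of 1 n x] single[of x] by simp
      also have "\<dots> < C + a j * real n" using * by simp
      also have "\<dots> < a (Suc j) * real (Suc n)" using *(2) by (simp add: field_simps)
      finally show "L (Suc n) x < a (Suc j) * real (Suc n)" .
    qed
    then have "\<exists>\<^sub>F n in sequentially. L n x < a (Suc j) * real n"
      unfolding frequently_sequentially by (meson Suc_n_not_le_n le_SucI nat_le_linear)
    then show "x \<in> B" using x unfolding B_def by blast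
  qed
  have zo: "emeasure P B = 0 \<or> emeasure P B = 1"
    by (rule AE_subinvariant_zero_one[OF prob_space_axioms T pres erg B step])
  have cB: "x \<in> B" if "x \<in> space P" "\<not> (\<forall>\<^sub>F n in sequentially. c * real n \<le> L n x)" for x
  proof -
    have "\<exists>\<^sub>F n in sequentially. L n x < a 0 * real n"
      using that(2) by (simp add: not_eventually a_def not_le)
    then show ?thesis using that(1) unfolding B_def by blast
  qed
  show ?thesis
  proof (cases "emeasure P B = 0")
    case True
    then have "AE x in P. x \<notin> B" by (intro AE_not_in null_setsI B)
    then show ?thesis by (rule AE_mp) (use cB in \<open>auto intro!: AE_I2\<close>)
  next
    case False
    then have "prob B = 1" using zo by (simp add: emeasure_eq_measure)
    then have aeB: "AE x in P. x \<in> B" by (simp add: prob_eq_1)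
    have "\<forall>\<^sub>F n in sequentially. b n / real n < e" using b e by (intro order_tendstoD)
    then obtain M where M: "\<And>n. n \<ge> M \<Longrightarrow> b n / real n < e" unfolding eventually_sequentially by blast
    \<comment> \<open>A dip has slope below c + e, and its overhead b m is at most e m once m \<ge>
      M. The contradiction below is between h - e = c + 3 e and d = c + 2 e.\<close>
    define d where "d = c + 2 * e"
    define E where "E K = {x \<in> space P. \<exists>m\<in>{max 1 M..K}. L m x + b m \<le> d * real m}" for K
    have E [measurable]: "E K \<in> sets P" for K unfolding E_def by measurable
    define D where "D = max 0 (C - d)"
    have "incseq E" unfolding E_def by (intro monoI) fastforce
    then have limE: "(\<lambda>K. prob (E K)) \<longlonglongrightarrow> prob (\<Union>K. E K)"
      by (intro finite_Lim_measure_incseq) auto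
    have "AE x in P. x \<in> (\<Union>K. E K)"
      using aeB
    proof (eventually_elim)
      case (elim x)
      then obtain j where x: "x \<in> space P" and j: "\<exists>\<^sub>F n in sequentially. L n x < a j * real n"
        unfolding B_def by auto
      then obtain n where n: "n \<ge> max 1 M" "L n x < a j * real n"
        unfolding frequently_sequentially by blast
      have "a j \<le> c + e" unfolding a_def using e by simp
      then have "a j * real n \<le> (c + e) * real n" by (intro mult_right_mono) auto
      moreover have "b n \<le> e * real n" using M[of n] n(1) by (simp add: field_simps)
      ultimately have "L n x + b n \<le> d * real n" using n(2) by (simp add: d_def algebra_simps)
      then show ?case using x n(1) unfolding E_def by (auto intro!: exI[of _ n] bexI[of _ n])
    qed
    then have "prob (\<Union>K. E K) = 1" by (subst prob_eq_1) auto
    then have limE: "(\<lambda>K. prob (E K)) \<longlonglongrightarrow> 1" using limE by simp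
    have Tn: "(T ^^ i) \<in> measurable P P" for i
      by (rule measurable_compose_n[OF T])
    have presn: "emeasure P ((T ^^ i) -` A \<inter> space P) = emeasure P A" if "A \<in> sets P" for A i
    proof (induction i)
      case 0
      then show ?case using sets.sets_into_space[OF that] by (simp add: Int_absorb2)
    next
      case (Suc i)
      have "(T ^^ Suc i) -` A \<inter> space P = T -` ((T ^^ i) -` A \<inter> space P) \<inter> space P"
        using measurable_space[OF T] by (auto simp: funpow_swap1)
      then show ?case using Suc pres[OF measurable_sets[OF Tn that, of i]] by (simp only:)
    qed
    \<comment> \<open>With K fixed, N tends to infinity and removes the term D K / N; only
      afterwards does K grow, so that \<open>prob (E K)\<close> tends to 1.\<close>
    have bound: "h - \<delta> \<le> d + D * (1 - prob (E K))" if \<delta>: "\<delta> > 0" for K \<delta>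
    proof -
      have ind: "integrable P (\<lambda>x. indicat_real (- E K) ((T ^^ i) x))"
        "(\<integral>x. indicat_real (- E K) ((T ^^ i) x) \<partial>P) = 1 - prob (E K)" for i
      proof -
        have eq: "indicat_real (- E K) ((T ^^ i) x) = indicat_real ((T ^^ i) -` (space P - E K) \<inter> space P) x"
          if "x \<in> space P" for x
          using that measurable_space[OF Tn that, of i] by (auto simp: indicator_def)
        have s: "(T ^^ i) -` (space P - E K) \<inter> space P \<in> sets P"
          by (rule measurable_sets[OF Tn]) auto
        show "integrable P (\<lambda>x. indicat_real (- E K) ((T ^^ i) x))"
          by (subst Bochner_Integration.integrable_cong[OF refl eq]) (use s in \<open>auto intro: integrable_real_indicator simp: less_top[symmetric]\<close>)
        have "(\<integral>x. indicat_real (- E K) ((T ^^ i) x) \<partial>P) = prob ((T ^^ i) -` (space P - E K) \<inter> space P)"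
          by (subst Bochner_Integration.integral_cong[OF refl eq]) (use s in auto)
        also have "\<dots> = prob (space P - E K)" using presn[of "space P - E K" i] by (simp add: measure_def)
        finally show "(\<integral>x. indicat_real (- E K) ((T ^^ i) x) \<partial>P) = 1 - prob (E K)" by (simp add: prob_compl)
      qed
      have ub: "(\<integral>x. L N x \<partial>P) \<le> d * real N + D * (real N * (1 - prob (E K)) + real K)"
        if "integrable P (L N)" for N
      proof -
        have pw: "L N x \<le> d * real N + D * ((\<Sum>i<N. indicator (- E K) ((T ^^ i) x)) + real K)" for x
          by (rule greedy_block_bound[OF L0 sub single]) (auto simp: E_def D_def)
        have "(\<integral>x. L N x \<partial>P) \<le> (\<integral>x. d * real N + D * ((\<Sum>i<N. indicator (- E K) ((T ^^ i) x)) + real K) \<partial>P)"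
          using that ind by (intro integral_mono pw) auto
        also have "\<dots> = d * real N + D * (real N * (1 - prob (E K)) + real K)"
          using ind by (subst Bochner_Integration.integral_add) (auto simp: prob_space)
        finally show ?thesis .
      qed
      have "\<forall>\<^sub>F N in sequentially. h - \<delta> \<le> d + D * (1 - prob (E K)) + D * real K / real N"
        using mean[OF \<delta>] eventually_gt_at_top[of 0]
      proof eventually_elim
        case (elim N)
        then have "real N * (h - \<delta>) \<le> d * real N + D * (real N * (1 - prob (E K)) + real K)"
          using ub[of N] by linarith
        then show ?case using elim by (simp add: field_simps)
      qed
      moreover have "(\<lambda>N. d + D * (1 - prob (E K)) + D * real K / real N) \<longlonglongrightarrow> d + D * (1 - prob (E K)) + 0"
        by (intro tendsto_intros lim_const_over_n)
      ultimately show ?thesis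
        using tendsto_lowerbound[of _ _ sequentially "h - \<delta>"] by force
    qed
    have "(\<lambda>K. d + D * (1 - prob (E K))) \<longlonglongrightarrow> d + D * (1 - 1)"
      by (intro tendsto_intros limE)
    then have "h - e \<le> d"
      using bound[OF e] tendsto_lowerbound[of _ "d + D * (1 - 1)" sequentially "h - e"] by force
    then have False using \<open>c < h\<close> unfolding d_def e_def by (simp add: field_simps)
    then show ?thesis ..
  qed
qed

text \<open>Birkhoff sums are additive, so the preceding lemma applies with b = 0. Applied to f it
  bounds the limit inferior from below, applied to - f it bounds the limit superior from
  above.\<close>

lemma bounded_Birkhoff:
  fixes f :: "'b \<Rightarrow> real" and T :: "'b \<Rightarrow> 'b"
  assumes "prob_space P" and T: "T \<in> measurable P P"
    and pres: "\<And>A. A \<in> sets P \<Longrightarrow> emeasure P (T -` A \<inter> space P) = emeasure P A"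
    and erg: "\<And>A. A \<in> sets P \<Longrightarrow> T -` A \<inter> space P = A \<Longrightarrow> emeasure P A = 0 \<or> emeasure P A = 1"
    and f [measurable]: "f \<in> borel_measurable P" and bd: "\<And>x. \<bar>f x\<bar> \<le> C"
  shows "AE x in P. (\<lambda>n. (\<Sum>i<n. f ((T ^^ i) x)) / real n) \<longlonglongrightarrow> (\<integral>x. f x \<partial>P)"
proof -
  interpret prob_space P by fact
  have Tn [measurable]: "(T ^^ i) \<in> measurable P P" for i
    by (rule measurable_compose_n[OF T])
  have int: "(\<integral>x. g ((T ^^ i) x) \<partial>P) = (\<integral>x. g x \<partial>P)" if [measurable]: "g \<in> borel_measurable P" for g :: "'b \<Rightarrow> real" and i
  proof (induction i)
    case (Suc i)
    have "distr P P T = P"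
      by (rule measure_eqI) (use T pres in \<open>auto simp: emeasure_distr\<close>)
    then have "(\<integral>x. g ((T ^^ i) x) \<partial>P) = (\<integral>x. g ((T ^^ i) x) \<partial>distr P P T)" by simp
    also have "\<dots> = (\<integral>x. g ((T ^^ i) (T x)) \<partial>P)" by (rule integral_distr[OF T]) measurable
    finally show ?case using Suc by (simp add: funpow_swap1)
  qed simp
  \<comment> \<open>Rational thresholds allow a single null set for all c.\<close>
  have low: "AE x in P. \<forall>c\<in>\<rat>. c < (\<integral>x. g x \<partial>P) \<longrightarrow> (\<forall>\<^sub>F n in sequentially. c * real n \<le> (\<Sum>i<n. g ((T ^^ i) x)))"
    if g [measurable]: "g \<in> borel_measurable P" and bd: "\<And>x. \<bar>g x\<bar> \<le> C" for g :: "'b \<Rightarrow> real"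
  proof -
    have "AE x in P. c < (\<integral>x. g x \<partial>P) \<longrightarrow> (\<forall>\<^sub>F n in sequentially. c * real n \<le> (\<Sum>i<n. g ((T ^^ i) x)))" for c
    proof (cases "c < (\<integral>x. g x \<partial>P)")
      case True
      have intg: "integrable P (\<lambda>x. g ((T ^^ i) x))" for i
        by (rule integrable_const_bound[of _ C]) (use bd in auto)
      have "AE x in P. \<forall>\<^sub>F n in sequentially. c * real n \<le> (\<Sum>i<n. g ((T ^^ i) x))"
      proof (rule ergodic_liminf_bound[OF prob_space_axioms T pres erg, where b = "\<lambda>_. 0" and C = C and h = "\<integral>x. g x \<partial>P"])
        fix m k :: nat and x
        have "(\<Sum>i<m + k. g ((T ^^ i) x)) = (\<Sum>i<m. g ((T ^^ i) x)) + (\<Sum>i\<in>{m..<m+k}. g ((T ^^ i) x))"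
          by (subst sum.union_disjoint[symmetric]) (auto intro: sum.cong)
        also have "(\<Sum>i\<in>{m..<m+k}. g ((T ^^ i) x)) = (\<Sum>i<k. g ((T ^^ i) ((T ^^ m) x)))"
          by (rule sum.reindex_bij_witness[of _ "\<lambda>i. i + m" "\<lambda>i. i - m"]) (auto simp flip: funpow_add[THEN fun_cong, unfolded comp_def])
        finally show "(\<Sum>i<m + k. g ((T ^^ i) x)) \<le> (\<Sum>i<m. g ((T ^^ i) x)) + (\<Sum>i<k. g ((T ^^ i) ((T ^^ m) x))) + 0" by simp
      next
        show "(\<Sum>i<1. g ((T ^^ i) x)) + 0 \<le> C" for x using bd[of x] by simp
      next
        fix \<delta> :: real assume "\<delta> > 0"
        have "(\<integral>x. (\<Sum>i<n. g ((T ^^ i) x)) \<partial>P) = real n * (\<integral>x. g x \<partial>P)" for n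
          using intg by (subst Bochner_Integration.integral_sum) (auto simp: int)
        then show "\<forall>\<^sub>F n in sequentially. integrable P (\<lambda>x. \<Sum>i<n. g ((T ^^ i) x)) \<and>
            real n * ((\<integral>x. g x \<partial>P) - \<delta>) \<le> (\<integral>x. (\<Sum>i<n. g ((T ^^ i) x)) \<partial>P)"
          using \<open>\<delta> > 0\<close> intg by (auto simp: algebra_simps)
      qed (use True in auto)
      then show ?thesis by auto
    qed auto
    then show ?thesis
      by (subst AE_ball_countable) (auto simp: countable_rat)
  qed
  have "AE x in P. \<forall>c\<in>\<rat>. c < (\<integral>x. - f x \<partial>P) \<longrightarrow> (\<forall>\<^sub>F n in sequentially. c * real n \<le> (\<Sum>i<n. - f ((T ^^ i) x)))"
    by (rule low) (use bd in auto)
  with low[OF f bd] show ?thesis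
  proof eventually_elim
    case (elim x)
    show ?case
    proof (rule order_tendstoI)
      fix a assume "a < (\<integral>x. f x \<partial>P)"
      then obtain c where c: "c \<in> \<rat>" "a < c" "c < (\<integral>x. f x \<partial>P)" using Rats_dense_in_real by blast
      then have "\<forall>\<^sub>F n in sequentially. c * real n \<le> (\<Sum>i<n. f ((T ^^ i) x))" using elim by blast
      then show "\<forall>\<^sub>F n in sequentially. a < (\<Sum>i<n. f ((T ^^ i) x)) / real n"
        using eventually_gt_at_top[of 0]
      proof eventually_elim
        case (elim n)
        then have "c \<le> (\<Sum>i<n. f ((T ^^ i) x)) / real n" by (simp add: field_simps)
        then show ?case using c by simp
      qed
    next
      fix a assume "a > (\<integral>x. f x \<partial>P)"
      then have "- a < (\<integral>x. - f x \<partial>P)" by simp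
      then obtain c where c: "c \<in> \<rat>" "- a < c" "c < (\<integral>x. - f x \<partial>P)" using Rats_dense_in_real by blast
      then have "\<forall>\<^sub>F n in sequentially. c * real n \<le> (\<Sum>i<n. - f ((T ^^ i) x))" using elim by blast
      then show "\<forall>\<^sub>F n in sequentially. (\<Sum>i<n. f ((T ^^ i) x)) / real n < a"
        using eventually_gt_at_top[of 0]
      proof eventually_elim
        case (elim n)
        then have "(\<Sum>i<n. f ((T ^^ i) x)) / real n \<le> - c" by (simp add: field_simps sum_negf)
        then show ?case using c by simp
      qed
    qed
  qed
qed

subsection \<open>Extended expectations\<close>

text \<open>This holds for every f and g because subtraction on \<open>ereal\<close> is monotone in
  its first and antitone in its second argument, even at
  \<open>\<infinity> - \<infinity>\<close>.\<close>

lemma ereal_expect_mono_AE: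
  assumes "AE x in P. f x \<le> g x"
  shows "ereal_expect P f \<le> ereal_expect P g"
  unfolding ereal_expect_def
  by (intro ereal_minus_mono) (use assms in \<open>auto simp: less_eq_ennreal.rep_eq[symmetric] intro!: nn_integral_mono_AE e2ennreal_mono\<close>)

lemma ereal_expect_cong_AE:
  assumes "AE x in P. f x = g x"
  shows "ereal_expect P f = ereal_expect P g"
  by (intro antisym ereal_expect_mono_AE) (use assms in auto)

lemma ereal_expect_real:
  assumes "integrable P f"
  shows "ereal_expect P (\<lambda>x. ereal (f x)) = ereal (\<integral>x. f x \<partial>P)"
proof -
  have 1: "(\<integral>\<^sup>+x. ennreal (f x) \<partial>P) < \<infinity>" "(\<integral>\<^sup>+x. ennreal (- f x) \<partial>P) < \<infinity>"
    using assms by (auto simp: real_integrable_def less_top)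
  show ?thesis
    unfolding ereal_expect_def real_lebesgue_integral_def[OF assms]
    using 1 by (cases "\<integral>\<^sup>+x. ennreal (f x) \<partial>P"; cases "\<integral>\<^sup>+x. ennreal (- f x) \<partial>P") (auto simp: ennreal.rep_eq[symmetric] e2ennreal_ereal)
qed

text \<open>A finite difference on \<open>ereal\<close> forces both the positive and the negative
  part to have finite integral, so f is almost everywhere finite and its expectation is a Bochner
  integral.\<close>

lemma ereal_expect_finite:
  assumes f [measurable]: "f \<in> borel_measurable P" and fin: "\<bar>ereal_expect P f\<bar> \<noteq> \<infinity>"
  shows "integrable P (\<lambda>x. real_of_ereal (f x))" "AE x in P. f x = ereal (real_of_ereal (f x))"
    "ereal_expect P f = ereal (\<integral>x. real_of_ereal (f x) \<partial>P)"
proof -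
  have p: "(\<integral>\<^sup>+x. e2ennreal (f x) \<partial>P) \<noteq> \<infinity>" and n: "(\<integral>\<^sup>+x. e2ennreal (- f x) \<partial>P) \<noteq> \<infinity>"
    using fin unfolding ereal_expect_def
    by (cases "\<integral>\<^sup>+x. e2ennreal (f x) \<partial>P"; cases "\<integral>\<^sup>+x. e2ennreal (- f x) \<partial>P"; simp add: enn2ereal_top)+
  have "AE x in P. e2ennreal (f x) \<noteq> \<infinity>" "AE x in P. e2ennreal (- f x) \<noteq> \<infinity>"
    using nn_integral_PInf_AE[OF _ p] nn_integral_PInf_AE[OF _ n] by auto
  then show ae: "AE x in P. f x = ereal (real_of_ereal (f x))"
  proof eventually_elim
    case (elim x)
    then show ?case by (cases "f x") (auto simp: e2ennreal_infty)
  qed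
  have "(\<integral>\<^sup>+x. ennreal (real_of_ereal (f x)) \<partial>P) = (\<integral>\<^sup>+x. e2ennreal (f x) \<partial>P)"
    by (rule nn_integral_cong_AE, use ae in eventually_elim) (metis e2ennreal_ereal)
  moreover have "(\<integral>\<^sup>+x. ennreal (- real_of_ereal (f x)) \<partial>P) = (\<integral>\<^sup>+x. e2ennreal (- f x) \<partial>P)"
    by (rule nn_integral_cong_AE, use ae in eventually_elim) (metis e2ennreal_ereal uminus_ereal.simps(1))
  ultimately show int: "integrable P (\<lambda>x. real_of_ereal (f x))"
    using p n by (auto simp: real_integrable_def)
  show "ereal_expect P f = ereal (\<integral>x. real_of_ereal (f x) \<partial>P)"
    using ereal_expect_cong_AE[OF ae] ereal_expect_real[OF int] by simp
qed

lemma ereal_expect_distr: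
  assumes "T \<in> measurable M N" "f \<in> borel_measurable N"
  shows "ereal_expect (distr M N T) f = ereal_expect M (\<lambda>x. f (T x))"
  unfolding ereal_expect_def using assms by (subst (1 2) nn_integral_distr) auto

text \<open>Convergence in probability follows from almost sure convergence: the indicators of the
  exceptional sets tend to 0 pointwise almost everywhere and are bounded by 1.\<close>

lemma universal_convI:
  assumes "prob_space P" and L [measurable]: "\<And>n. L n \<in> borel_measurable P"
    and ae: "AE \<omega> in P. (\<lambda>n. L n \<omega> / ereal (real n)) \<longlonglongrightarrow> ereal h"
    and ex: "(\<lambda>n. ereal_expect P (L n) / ereal (real n)) \<longlonglongrightarrow> ereal h"
  shows "universal_conv P L h"
proof -
  interpret prob_space P by fact
  have "(\<lambda>n. measure P {\<omega> \<in> space P. \<bar>L n \<omega> / ereal (real n) - ereal h\<bar> > ereal \<epsilon>}) \<longlonglongrightarrow> 0" if "\<epsilon> > 0" for \<epsilon>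
  proof -
    define S where "S n = {\<omega> \<in> space P. \<bar>L n \<omega> / ereal (real n) - ereal h\<bar> > ereal \<epsilon>}" for n
    have S [measurable]: "S n \<in> sets P" for n unfolding S_def by measurable
    have "AE \<omega> in P. (\<lambda>n. indicat_real (S n) \<omega>) \<longlonglongrightarrow> 0"
      using ae
    proof eventually_elim
      case (elim \<omega>)
      have "\<forall>\<^sub>F n in sequentially. L n \<omega> / ereal (real n) > ereal (h - \<epsilon>)" "\<forall>\<^sub>F n in sequentially. L n \<omega> / ereal (real n) < ereal (h + \<epsilon>)"
        using order_tendstoD[OF elim] that by auto
      then have "\<forall>\<^sub>F n in sequentially. indicat_real (S n) \<omega> = 0"
      proof eventually_elim
        case (elim n)
        then have "\<omega> \<notin> S n" unfolding S_def by (cases "L n \<omega> / ereal (real n)") auto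
        then show ?case by simp
      qed
      then show ?case by (rule tendsto_eventually)
    qed
    then have "(\<lambda>n. \<integral>\<omega>. indicat_real (S n) \<omega> \<partial>P) \<longlonglongrightarrow> (\<integral>\<omega>. 0 \<partial>P)"
      by (intro integral_dominated_convergence[where w = "\<lambda>_. 1"]) (auto simp: indicator_def)
    then show ?thesis unfolding S_def[symmetric] by simp
  qed
  then show ?thesis unfolding universal_conv_def using ae ex by auto
qed

subsection \<open>Blocks and finite products\<close>

lemma funpow_shift: "(shift ^^ m) \<omega> = (\<lambda>i. \<omega> (i + int m))"
  by (induction m arbitrary: \<omega>) (auto simp: shift_def fun_eq_iff algebra_simps)

lemma shift_measurable [measurable]: "shift \<in> measurable (seq_space M) (seq_space M)"
  unfolding shift_def seq_space_def by (intro measurable_PiM_single') (auto simp: space_PiM)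

lemma block_measurable [measurable]: "block n \<in> measurable (seq_space M) (prodM M n)"
  unfolding block_def[abs_def] seq_space_def prodM_def by (rule measurable_restrict_subset) auto

lemma block_block: "m \<le> n \<Longrightarrow> block m (block n \<omega>) = block m \<omega>"
  by (auto simp: block_def fun_eq_iff restrict_def)

lemma block_shift_block: "m + k \<le> n \<Longrightarrow> block k ((shift ^^ m) (block n \<omega>)) = block k ((shift ^^ m) \<omega>)"
  by (auto simp: block_def funpow_shift fun_eq_iff restrict_def)

lemma block_measurable_prodM: "m \<le> n \<Longrightarrow> block m \<in> measurable (prodM M n) (prodM M m)"
  unfolding block_def[abs_def] prodM_def by (rule measurable_restrict_subset) auto

lemma block_shift_measurable_prodM:
  "m + k \<le> n \<Longrightarrow> (\<lambda>\<omega>. block k ((shift ^^ m) \<omega>)) \<in> measurable (prodM M n) (prodM M k)"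
  unfolding block_def[abs_def] prodM_def funpow_shift
  by (intro measurable_restrict measurable_component_singleton) auto

lemma block_id: "x \<in> space (prodM M n) \<Longrightarrow> block n x = x"
  by (auto simp: prodM_def space_PiM block_def PiE_def extensional_restrict)

lemma product_sigma_finite_const: "finite_measure M \<Longrightarrow> product_sigma_finite (\<lambda>_. M)"
  by (intro product_sigma_finite.intro finite_measure.axioms)

lemma sigma_finite_prodM: "finite_measure M \<Longrightarrow> sigma_finite_measure (prodM M n)"
  unfolding prodM_def by (intro product_sigma_finite.sigma_finite product_sigma_finite_const) auto

lemma finite_measure_prodM:
  assumes "finite_measure M"
  shows "finite_measure (prodM M n)"
proof
  interpret product_sigma_finite "\<lambda>_. M" by (rule product_sigma_finite_const[OF assms])
  show "emeasure (prodM M n) (space (prodM M n)) \<noteq> \<infinity>"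
    unfolding prodM_def space_PiM by (subst emeasure_PiM) (auto simp: power_eq_top_ennreal finite_measure.emeasure_finite[OF assms])
qed

lemma emeasure_space_prodM:
  assumes "finite_measure M"
  shows "emeasure (prodM M n) (space (prodM M n)) = emeasure M (space M) ^ n"
proof -
  interpret product_sigma_finite "\<lambda>_. M" by (rule product_sigma_finite_const[OF assms])
  show ?thesis
    unfolding prodM_def space_PiM by (subst emeasure_PiM) auto
qed

text \<open>Fubini's theorem for concatenated words. It evaluates the mass of the product terms in
  \<open>envelope\<close>.\<close>

lemma nn_integral_prodM_split:
  assumes "finite_measure M"
    and f [measurable]: "f \<in> borel_measurable (prodM M m)" and g [measurable]: "g \<in> borel_measurable (prodM M k)"
  shows "(\<integral>\<^sup>+x. f (block m x) * g (block k ((shift ^^ m) x)) \<partial>prodM M (m + k))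
     = (\<integral>\<^sup>+x. f x \<partial>prodM M m) * (\<integral>\<^sup>+x. g x \<partial>prodM M k)"
proof -
  interpret product_sigma_finite "\<lambda>_. M" by (rule product_sigma_finite_const[OF assms(1)])
  interpret sk: sigma_finite_measure "prodM M k" by (rule sigma_finite_prodM[OF assms(1)])
  \<comment> \<open>Concatenation: the second word is reindexed to occupy the places m + 1 to m + k.
    The preimage of a box under \<open>J\<close> is a product of two boxes, hence \<open>J\<close>
    carries the product measure to \<open>prodM\<close>.\<close>
  define J where "J = (\<lambda>(x, y). \<lambda>i\<in>{1..int (m + k)}. if i \<le> int m then x i else y (i - int m) :: 'a)"
  have J [measurable]: "J \<in> measurable (prodM M m \<Otimes>\<^sub>M prodM M k) (prodM M (m + k))"
    unfolding J_def prodM_def case_prod_beta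
  proof (rule measurable_restrict)
    fix i assume i: "i \<in> {1..int (m + k)}"
    show "(\<lambda>x. if i \<le> int m then fst x i else snd x (i - int m)) \<in>
      measurable (Pi\<^sub>M {1..int m} (\<lambda>i. M) \<Otimes>\<^sub>M Pi\<^sub>M {1..int k} (\<lambda>i. M)) M"
      using i by (cases "i \<le> int m") (auto intro!: measurable_compose[OF measurable_fst] measurable_compose[OF measurable_snd] measurable_component_singleton)
  qed
  have "distr (prodM M m \<Otimes>\<^sub>M prodM M k) (prodM M (m + k)) J = prodM M (m + k)"
    unfolding prodM_def[of M "m + k"]
  proof (rule PiM_eqI)
    fix A :: "int \<Rightarrow> 'a set" assume A: "\<And>i. i \<in> {1..int (m + k)} \<Longrightarrow> A i \<in> sets M"
    have A1: "PiE {1..int m} A \<in> sets (prodM M m)" unfolding prodM_def by (intro sets_PiM_I_finite A) auto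
    have A2: "PiE {1..int k} (\<lambda>i. A (i + int m)) \<in> sets (prodM M k)" unfolding prodM_def by (intro sets_PiM_I_finite A) auto
    have "J -` PiE {1..int (m + k)} A \<inter> space (prodM M m \<Otimes>\<^sub>M prodM M k)
        = PiE {1..int m} A \<times> PiE {1..int k} (\<lambda>i. A (i + int m))" (is "?L = ?R")
    proof (intro set_eqI iffI)
      fix z assume "z \<in> ?L"
      then obtain x y where z: "z = (x, y)" "x \<in> space (prodM M m)" "y \<in> space (prodM M k)"
        and J: "J (x, y) \<in> PiE {1..int (m + k)} A" by (auto simp: space_pair_measure)
      have J: "\<And>i. i \<in> {1..int (m + k)} \<Longrightarrow> J (x, y) i \<in> A i" using J by auto
      have "x i \<in> A i" if "i \<in> {1..int m}" for i
        using J[of i] that by (auto simp: J_def)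
      moreover have "y i \<in> A (i + int m)" if "i \<in> {1..int k}" for i
        using J[of "i + int m"] that by (auto simp: J_def)
      ultimately show "z \<in> ?R" using z by (auto simp: prodM_def space_PiM PiE_def)
    next
      fix z assume "z \<in> ?R"
      then obtain x y where z: "z = (x, y)" "x \<in> PiE {1..int m} A" "y \<in> PiE {1..int k} (\<lambda>i. A (i + int m))" by blast
      have "J z i \<in> A i" if i: "i \<in> {1..int (m + k)}" for i
      proof (cases "i \<le> int m")
        case True
        then show ?thesis using z i by (simp add: J_def PiE_mem)
      next
        case False
        then have "i - int m \<in> {1..int k}" using i by simp
        from PiE_mem[OF z(3) this] have "y (i - int m) \<in> A i" by simp
        then show ?thesis using i False by (simp add: J_def z(1))
      qed
      moreover have "J z \<in> extensional {1..int (m + k)}" unfolding z J_def by simp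
      ultimately have "J z \<in> PiE {1..int (m + k)} A" by (simp add: PiE_def Pi_def)
      moreover have "z \<in> space (prodM M m \<Otimes>\<^sub>M prodM M k)"
        unfolding space_pair_measure z(1) using z sets.sets_into_space[OF A1] sets.sets_into_space[OF A2] by blast
      ultimately show "z \<in> ?L" by blast
    qed
    then have "emeasure (distr (prodM M m \<Otimes>\<^sub>M prodM M k) (PiM {1..int (m + k)} (\<lambda>_. M)) J) (PiE {1..int (m + k)} A)
       = emeasure (prodM M m \<Otimes>\<^sub>M prodM M k) (PiE {1..int m} A \<times> PiE {1..int k} (\<lambda>i. A (i + int m)))"
      using sets_PiM_I_finite[of "{1..int (m + k)}" A "\<lambda>_. M"] A J[unfolded prodM_def[of M "m + k"]] by (simp only: emeasure_distr finite_atLeastAtMost_int)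
    also have "\<dots> = emeasure (prodM M m) (PiE {1..int m} A) * emeasure (prodM M k) (PiE {1..int k} (\<lambda>i. A (i + int m)))"
      by (rule sk.emeasure_pair_measure_Times[OF A1 A2])
    also have "\<dots> = (\<Prod>i\<in>{1..int m}. emeasure M (A i)) * (\<Prod>i\<in>{1..int k}. emeasure M (A (i + int m)))"
    proof -
      have "emeasure (prodM M m) (PiE {1..int m} A) = (\<Prod>i\<in>{1..int m}. emeasure M (A i))"
        unfolding prodM_def by (rule emeasure_PiM) (auto intro: A)
      moreover have "emeasure (prodM M k) (PiE {1..int k} (\<lambda>i. A (i + int m))) = (\<Prod>i\<in>{1..int k}. emeasure M (A (i + int m)))"
        unfolding prodM_def by (rule emeasure_PiM) (auto intro: A)
      ultimately show ?thesis by simp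
    qed
    also have "(\<Prod>i\<in>{1..int k}. emeasure M (A (i + int m))) = (\<Prod>i\<in>{int m + 1..int (m + k)}. emeasure M (A i))"
      by (rule prod.reindex_bij_witness[of _ "\<lambda>i. i - int m" "\<lambda>i. i + int m"]) auto
    also have "(\<Prod>i\<in>{1..int m}. emeasure M (A i)) * \<dots> = (\<Prod>i\<in>{1..int (m + k)}. emeasure M (A i))"
      by (subst prod.union_disjoint[symmetric]) (auto intro!: prod.cong)
    finally show "emeasure (distr (prodM M m \<Otimes>\<^sub>M prodM M k) (PiM {1..int (m + k)} (\<lambda>_. M)) J) (PiE {1..int (m + k)} A)
       = (\<Prod>i\<in>{1..int (m + k)}. emeasure M (A i))" .
  qed auto
  then have "(\<integral>\<^sup>+x. f (block m x) * g (block k ((shift ^^ m) x)) \<partial>prodM M (m + k))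
     = (\<integral>\<^sup>+x. f (block m x) * g (block k ((shift ^^ m) x)) \<partial>distr (prodM M m \<Otimes>\<^sub>M prodM M k) (prodM M (m + k)) J)"
    by simp
  also have "\<dots> = (\<integral>\<^sup>+z. f (block m (J z)) * g (block k ((shift ^^ m) (J z))) \<partial>(prodM M m \<Otimes>\<^sub>M prodM M k))"
    by (rule nn_integral_distr[OF J])
      (auto intro!: borel_measurable_times_ennreal measurable_compose[OF block_measurable_prodM f] measurable_compose[OF block_shift_measurable_prodM g])
  also have "\<dots> = (\<integral>\<^sup>+z. f (fst z) * g (snd z) \<partial>(prodM M m \<Otimes>\<^sub>M prodM M k))"
  proof (rule nn_integral_cong)
    fix z assume "z \<in> space (prodM M m \<Otimes>\<^sub>M prodM M k)"
    then obtain x y where z: "z = (x, y)" "x \<in> space (prodM M m)" "y \<in> space (prodM M k)"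
      by (auto simp: space_pair_measure)
    have "block m (J z) = block m x" "block k ((shift ^^ m) (J z)) = block k y"
      by (auto simp: block_def J_def z funpow_shift fun_eq_iff)
    then show "f (block m (J z)) * g (block k ((shift ^^ m) (J z))) = f (fst z) * g (snd z)"
      using z by (simp add: block_id)
  qed
  also have "\<dots> = (\<integral>\<^sup>+x. \<integral>\<^sup>+y. f x * g y \<partial>prodM M k \<partial>prodM M m)"
    by (subst sk.nn_integral_fst[symmetric]) auto
  also have "\<dots> = (\<integral>\<^sup>+x. f x \<partial>prodM M m) * (\<integral>\<^sup>+x. g x \<partial>prodM M k)"
    by (simp add: nn_integral_cmult nn_integral_multc)
  finally show ?thesis .
qed

lemma nn_integral_finite_range:
  assumes K: "K \<in> measurable N (count_space S)" and S: "finite S"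
  shows "(\<integral>\<^sup>+x. G (K x) \<partial>N) = (\<Sum>c\<in>S. G c * emeasure N (K -` {c} \<inter> space N))"
proof -
  have "(\<integral>\<^sup>+x. G (K x) \<partial>N) = (\<integral>\<^sup>+c. G c \<partial>distr N (count_space S) K)"
    using K by (subst nn_integral_distr) auto
  also have "\<dots> = (\<integral>\<^sup>+c. (\<Sum>d\<in>S. G d * indicator {d} c) \<partial>distr N (count_space S) K)"
    by (rule nn_integral_cong) (simp add: S sum.delta' indicator_def if_distrib cong: if_cong)
  also have "\<dots> = (\<Sum>d\<in>S. G d * emeasure (distr N (count_space S) K) {d})"
    by (subst nn_integral_sum) (auto simp: nn_integral_cmult_indicator)
  also have "\<dots> = (\<Sum>c\<in>S. G c * emeasure N (K -` {c} \<inter> space N))"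
    using K by (intro sum.cong refl) (simp add: emeasure_distr)
  finally show ?thesis .
qed

lemma integral_finite_range:
  assumes "finite_measure N" and K: "K \<in> measurable N (count_space S)" and S: "finite S"
  shows "integrable N (\<lambda>x. G (K x) :: real)"
    and "(\<integral>x. G (K x) \<partial>N) = (\<Sum>c\<in>S. G c * measure N (K -` {c} \<inter> space N))"
proof -
  interpret finite_measure N by fact
  have ind: "G (K x) = (\<Sum>c\<in>S. G c * indicator (K -` {c} \<inter> space N) x)" if "x \<in> space N" for x
  proof -
    have "K x \<in> S" using measurable_space[OF K that] by simp
    have "(\<Sum>c\<in>S. G c * indicator (K -` {c} \<inter> space N) x) = (\<Sum>c\<in>S. if c = K x then G c else 0)"
      using that by (intro sum.cong) (auto simp: indicator_def)
    then show ?thesis using S \<open>K x \<in> S\<close> by simp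
  qed
  have s: "c \<in> S \<Longrightarrow> K -` {c} \<inter> space N \<in> sets N" for c using measurable_sets[OF K, of "{c}"] by simp
  have i: "c \<in> S \<Longrightarrow> integrable N (\<lambda>x. G c * indicator (K -` {c} \<inter> space N) x)" for c
    using s by (auto intro!: integrable_mult_right integrable_real_indicator simp: less_top[symmetric])
  show "integrable N (\<lambda>x. G (K x))"
    by (subst Bochner_Integration.integrable_cong[OF refl ind]) (use i in auto)
  show "(\<integral>x. G (K x) \<partial>N) = (\<Sum>c\<in>S. G c * measure N (K -` {c} \<inter> space N))"
    by (subst Bochner_Integration.integral_cong[OF refl ind], assumption, subst Bochner_Integration.integral_sum)
      (use i s in \<open>auto intro!: sum.cong simp: less_top[symmetric]\<close>)
qed

subsection \<open>Approximation by functions of the cells\<close>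

locale partitioned_space =
  fixes \<mu> :: "'a measure" and Ch :: "nat \<Rightarrow> 'a set set"
  assumes fin: "finite_measure \<mu>" and part: "partition_filtration \<mu> Ch"
begin

lemma Ch_finite: "finite (Ch l)" and Ch_sets: "A \<in> Ch l \<Longrightarrow> A \<in> sets \<mu>" and Ch_Union: "\<Union>(Ch l) = space \<mu>"
  using part unfolding partition_filtration_def by auto

lemma Ch_disjoint: "A \<in> Ch l \<Longrightarrow> B \<in> Ch l \<Longrightarrow> x \<in> A \<Longrightarrow> x \<in> B \<Longrightarrow> A = B"
proof -
  have "disjoint (Ch l)" using part unfolding partition_filtration_def by auto
  then show "A \<in> Ch l \<Longrightarrow> B \<in> Ch l \<Longrightarrow> x \<in> A \<Longrightarrow> x \<in> B \<Longrightarrow> A = B" by (auto dest: disjointD)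
qed

lemma Ch_sigma: "sets \<mu> = sigma_sets (space \<mu>) (\<Union>l. Ch l)"
  using part unfolding partition_filtration_def by simp

lemma cell_eq: "A \<in> Ch l \<Longrightarrow> x \<in> A \<Longrightarrow> cell Ch l x = A"
  unfolding cell_def by (rule the_equality) (simp, metis Ch_disjoint)

lemma cell_in: "x \<in> space \<mu> \<Longrightarrow> cell Ch l x \<in> Ch l" and cell_mem: "x \<in> space \<mu> \<Longrightarrow> x \<in> cell Ch l x"
  using Ch_Union[of l] cell_eq by (metis UnionE)+

lemma cell_vimage:
  assumes "A \<in> Ch l"
  shows "cell Ch l -` {A} \<inter> space \<mu> = A"
  using cell_eq[OF assms] cell_mem[of _ l] sets.sets_into_space[OF Ch_sets[OF assms]] by auto

lemma cell_measurable [measurable]: "cell Ch l \<in> measurable \<mu> (count_space (Ch l))"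
  by (rule measurable_count_space_eq2[THEN iffD2]) (auto simp: Ch_finite cell_in cell_vimage Ch_sets)

lemma cell_refine: "k \<le> l \<Longrightarrow> \<exists>\<phi>. \<forall>x\<in>space \<mu>. cell Ch k x = \<phi> (cell Ch l x)"
proof (induction l rule: dec_induct)
  case (step l)
  then obtain \<phi> where \<phi>: "\<forall>x\<in>space \<mu>. cell Ch k x = \<phi> (cell Ch l x)" by blast
  have "\<forall>B\<in>Ch (Suc l). \<exists>A\<in>Ch l. B \<subseteq> A" using part unfolding partition_filtration_def by blast
  then obtain \<psi> where \<psi>: "\<And>B. B \<in> Ch (Suc l) \<Longrightarrow> \<psi> B \<in> Ch l \<and> B \<subseteq> \<psi> B" by metis
  have "cell Ch l x = \<psi> (cell Ch (Suc l) x)" if "x \<in> space \<mu>" for x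
    using \<psi>[OF cell_in[OF that]] cell_mem[OF that, of "Suc l"] by (intro cell_eq) auto
  then show ?case using \<phi> by (intro exI[of _ "\<phi> \<circ> \<psi>"]) auto
qed (auto intro: exI[of _ id])

text \<open>Words are extensional functions on 1..n, as are the points of \<open>prodM\<close>, so
  two words are equal as soon as their n letters agree.\<close>

definition words :: "nat \<Rightarrow> nat \<Rightarrow> (int \<Rightarrow> 'a set) set" where
  "words l n = PiE {1..int n} (\<lambda>_. Ch l)"

definition cells :: "nat \<Rightarrow> nat \<Rightarrow> (int \<Rightarrow> 'a) \<Rightarrow> int \<Rightarrow> 'a set" where
  "cells l n \<omega> = (\<lambda>i\<in>{1..int n}. cell Ch l (\<omega> i))"

lemma finite_words: "finite (words l n)"
  unfolding words_def by (intro finite_PiE) (auto simp: Ch_finite)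

lemma space_prodM_D: "x \<in> space (prodM \<mu> n) \<Longrightarrow> i \<in> {1..int n} \<Longrightarrow> x i \<in> space \<mu>"
  unfolding prodM_def space_PiM by (rule PiE_mem)

lemma cells_block [simp]: "cells l n (block n \<omega>) = cells l n \<omega>"
  by (auto simp: cells_def block_def fun_eq_iff)

lemma cells_measurable [measurable]: "cells l n \<in> measurable (prodM \<mu> n) (count_space (words l n))"
proof -
  have "cells l n \<in> measurable (prodM \<mu> n) (PiM {1..int n} (\<lambda>_. count_space (Ch l)))"
    unfolding cells_def[abs_def] prodM_def
    by (intro measurable_restrict measurable_compose[OF _ cell_measurable] measurable_component_singleton)
  also have "PiM {1..int n} (\<lambda>_. count_space (Ch l)) = count_space (words l n)"
    unfolding words_def by (rule count_space_PiM_finite) (auto intro: countable_finite Ch_finite)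
  finally show ?thesis .
qed

lemma cells_measurable_seq [measurable]: "cells l n \<in> measurable (seq_space \<mu>) (count_space (words l n))"
  using measurable_compose[OF block_measurable cells_measurable] by simp

lemma cells_eq_iff:
  assumes c: "c \<in> words l n" and x: "x \<in> space (prodM \<mu> n)"
  shows "cells l n x = c \<longleftrightarrow> (\<forall>i\<in>{1..int n}. x i \<in> c i)"
proof -
  have ext: "c \<in> extensional {1..int n}" using c by (simp add: words_def PiE_def)
  have "cell Ch l (x i) = c i \<longleftrightarrow> x i \<in> c i" if i: "i \<in> {1..int n}" for i
  proof -
    have "c i \<in> Ch l" using PiE_mem[OF c[unfolded words_def] i] .
    moreover have "x i \<in> space \<mu>" using x i PiE_mem[of x "{1..int n}" "\<lambda>_. space \<mu>" i] by (simp add: prodM_def space_PiM)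
    ultimately show ?thesis using cell_eq[of "c i" l "x i"] cell_mem[of "x i" l] by auto
  qed
  then have "(\<forall>i\<in>{1..int n}. cells l n x i = c i) \<longleftrightarrow> (\<forall>i\<in>{1..int n}. x i \<in> c i)"
    by (simp add: cells_def)
  moreover have "cells l n x = c \<longleftrightarrow> (\<forall>i\<in>{1..int n}. cells l n x i = c i)"
    using ext extensionalityI[of "cells l n x" "{1..int n}" c] unfolding cells_def by auto
  ultimately show ?thesis by simp
qed

lemma cells_vimage:
  assumes c: "c \<in> words l n"
  shows "cells l n -` {c} \<inter> space (prodM \<mu> n) = PiE {1..int n} c"
proof -
  have "c i \<subseteq> space \<mu>" if "i \<in> {1..int n}" for i
    using PiE_mem[OF c[unfolded words_def] that] Ch_Union[of l] by blast
  then have sub: "PiE {1..int n} c \<subseteq> space (prodM \<mu> n)"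
    unfolding prodM_def space_PiM by (intro PiE_mono)
  show ?thesis
  proof (intro set_eqI iffI)
    fix x assume "x \<in> cells l n -` {c} \<inter> space (prodM \<mu> n)"
    then have x: "x \<in> space (prodM \<mu> n)" "\<forall>i\<in>{1..int n}. x i \<in> c i" using cells_eq_iff[OF c, of x] by simp_all
    then have "x \<in> extensional {1..int n}" by (simp add: prodM_def space_PiM PiE_iff)
    with x(2) show "x \<in> PiE {1..int n} c" unfolding PiE_iff by blast
  next
    fix x assume x: "x \<in> PiE {1..int n} c"
    then have "x \<in> space (prodM \<mu> n)" using sub by (rule rev_subsetD)
    moreover have "\<forall>i\<in>{1..int n}. x i \<in> c i" using x unfolding PiE_iff by blast
    ultimately show "x \<in> cells l n -` {c} \<inter> space (prodM \<mu> n)" using cells_eq_iff[OF c, of x] by simp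
  qed
qed

lemma emeasure_cells:
  assumes c: "c \<in> words l n"
  shows "emeasure (prodM \<mu> n) (cells l n -` {c} \<inter> space (prodM \<mu> n)) = (\<Prod>i\<in>{1..int n}. emeasure \<mu> (c i))"
proof -
  interpret product_sigma_finite "\<lambda>_. \<mu>" by (rule product_sigma_finite_const[OF fin])
  have "c i \<in> sets \<mu>" if "i \<in> {1..int n}" for i
    using PiE_mem[OF c[unfolded words_def] that] by (rule Ch_sets)
  then show ?thesis
    unfolding cells_vimage[OF c] unfolding prodM_def by (intro emeasure_PiM) simp_all
qed

text \<open>Functions of coarse cells are also functions of finer cells, so finitely many
  approximants of different levels can be brought to a common level.\<close>

lemma cells_refine:
  assumes "k \<le> l"
  shows "\<exists>\<Phi>. \<forall>x\<in>space (prodM \<mu> n). cells k n x = \<Phi> (cells l n x)"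
proof -
  obtain \<phi> where \<phi>: "\<And>x. x \<in> space \<mu> \<Longrightarrow> cell Ch k x = \<phi> (cell Ch l x)" using cell_refine[OF assms] by blast
  have "cells k n x = (\<lambda>i\<in>{1..int n}. \<phi> (cells l n x i))" if "x \<in> space (prodM \<mu> n)" for x
    unfolding cells_def using \<phi>[OF space_prodM_D[OF that]] by (intro restrict_ext) simp
  then show ?thesis by (intro exI[of _ "\<lambda>c. \<lambda>i\<in>{1..int n}. \<phi> (c i)"]) simp
qed

text \<open>The sets that can be approximated by unions of cell words form a sigma-algebra.
  Preimages of single cells under a coordinate belong to it exactly, and cells generate the sets of
  \<mu>; one induction covers a single coordinate, a second one the product.\<close>

lemma cells_approx_set:
  assumes "finite_measure N" and sets: "sets N = sets (prodM \<mu> n)" and A: "A \<in> sets N" and e: "e > 0"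
  shows "\<exists>l D. measure N {x \<in> space N. x \<in> A \<longleftrightarrow> cells l n x \<notin> D} < e"
proof -
  interpret finite_measure N by fact
  have space: "space N = space (prodM \<mu> n)" by (rule sets_eq_imp_space_eq[OF sets])
  have cells [measurable]: "cells l n \<in> measurable N (count_space (words l n))" for l
    using cells_measurable by (simp add: measurable_cong_sets[OF sets refl])
  have lift: "\<exists>D'. \<forall>x\<in>space N. cells k n x \<in> D \<longleftrightarrow> cells l n x \<in> D'" if kl: "k \<le> l" for k l D
  proof -
    obtain \<Phi> where "\<And>x. x \<in> space (prodM \<mu> n) \<Longrightarrow> cells k n x = \<Phi> (cells l n x)" using cells_refine[OF kl] by blast
    then show ?thesis by (intro exI[of _ "\<Phi> -` D"]) (simp add: space)
  qed
  \<comment> \<open>The symmetric difference of A with the set of points whose cell word lies in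
    D.\<close>
  define err where "err A l D = {x \<in> space N. x \<in> A \<longleftrightarrow> cells l n x \<notin> D}" for A l D
  define good where "good A \<longleftrightarrow> A \<in> sets N \<and> (\<forall>e>0. \<exists>l D. measure N (err A l D) < e)" for A
  have pre: "{x \<in> space N. cells l n x \<in> D} \<in> sets N" for l D
  proof -
    have "{x \<in> space N. cells l n x \<in> D} = cells l n -` (D \<inter> words l n) \<inter> space N"
      using measurable_space[OF cells] by auto
    then show ?thesis using measurable_sets[OF cells, of "D \<inter> words l n"] by simp
  qed
  have err_sets [measurable]: "err A l D \<in> sets N" if [measurable]: "A \<in> sets N" for A l D
  proof -
    have "err A l D = (A - {x \<in> space N. cells l n x \<in> D}) \<union> ({x \<in> space N. cells l n x \<in> D} - A)"
      using sets.sets_into_space[OF that] unfolding err_def by auto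
    then show ?thesis using that pre by auto
  qed
  have good_compl: "good (space N - A)" if gA: "good A" for A
  proof -
    have err: "err (space N - A) l (- D) = err A l D" for l D unfolding err_def by auto
    show ?thesis
      unfolding good_def
    proof (intro conjI allI impI)
      show "space N - A \<in> sets N" using gA unfolding good_def by auto
      fix e :: real assume "e > 0"
      then obtain l D where "measure N (err A l D) < e" using gA unfolding good_def by auto
      then show "\<exists>l D. measure N (err (space N - A) l D) < e"
        using err by (intro exI[of _ l] exI[of _ "- D"]) simp
    qed
  qed
  have good_Un: "good (\<Union>i. A i)" if A: "\<And>i. good (A i)" for A :: "nat \<Rightarrow> (int \<Rightarrow> 'a) set"
    unfolding good_def
  proof (intro conjI allI impI)
    have As [measurable]: "A i \<in> sets N" for i using A unfolding good_def by blast
    show "(\<Union>i. A i) \<in> sets N" by measurable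
    fix e :: real assume e: "e > 0"
    have "(\<lambda>m. measure N ((\<Union>i. A i) - (\<Union>i<m. A i))) \<longlonglongrightarrow> measure N (\<Inter>m. (\<Union>i. A i) - (\<Union>i<m. A i))"
      by (rule finite_Lim_measure_decseq) (auto simp: decseq_def)
    also have "(\<Inter>m. (\<Union>i. A i) - (\<Union>i<m. A i)) = {}" by blast
    finally have "\<forall>\<^sub>F m in sequentially. measure N ((\<Union>i. A i) - (\<Union>i<m. A i)) < e / 2"
      using e by (intro order_tendstoD(2)[where y = 0]) auto
    then obtain m where m: "measure N ((\<Union>i. A i) - (\<Union>i<m. A i)) < e / 2"
      unfolding eventually_sequentially by blast
    \<comment> \<open>Half of e is spent on the tail of the union, the other half on the m remaining
      sets; the summand 1 keeps the denominator positive for m = 0.\<close>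
    define e' where "e' = e / (2 * (real m + 1))"
    have "e' > 0" using e by (simp add: e'_def)
    then have "\<exists>l D. measure N (err (A i) l D) < e'" for i using A[of i] unfolding good_def by auto
    then obtain l D where lD: "\<And>i. measure N (err (A i) (l i) (D i)) < e'" by metis
    \<comment> \<open>A common level for the first m approximants; \<open>Suc m\<close> keeps the
      set nonempty when m = 0.\<close>
    define L where "L = Max (l ` {..<Suc m})"
    have "\<forall>i. \<exists>D'. i < m \<longrightarrow> (\<forall>x\<in>space N. cells (l i) n x \<in> D i \<longleftrightarrow> cells L n x \<in> D')"
    proof
      fix i
      have "l i \<le> L" if "i < m" using that by (auto simp: L_def)
      then show "\<exists>D'. i < m \<longrightarrow> (\<forall>x\<in>space N. cells (l i) n x \<in> D i \<longleftrightarrow> cells L n x \<in> D')" using lift[of "l i" L "D i"] by auto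
    qed
    from choice[OF this] obtain D' where D': "\<forall>i. i < m \<longrightarrow> (\<forall>x\<in>space N. cells (l i) n x \<in> D i \<longleftrightarrow> cells L n x \<in> D' i)"
      by (elim exE)
    have "err (\<Union>i. A i) L (\<Union>i<m. D' i) \<subseteq> ((\<Union>i. A i) - (\<Union>i<m. A i)) \<union> (\<Union>i<m. err (A i) (l i) (D i))"
    proof
      fix x assume x: "x \<in> err (\<Union>i. A i) L (\<Union>i<m. D' i)"
      then have xN: "x \<in> space N" unfolding err_def by simp
      show "x \<in> ((\<Union>i. A i) - (\<Union>i<m. A i)) \<union> (\<Union>i<m. err (A i) (l i) (D i))"
      proof (cases "\<exists>i<m. (x \<in> A i) \<longleftrightarrow> cells L n x \<notin> D' i")
        case True
        then obtain i where "i < m" "(x \<in> A i) \<longleftrightarrow> cells L n x \<notin> D' i" by (elim exE conjE)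
        then have "x \<in> err (A i) (l i) (D i)" using D' xN unfolding err_def by simp
        then show ?thesis using \<open>i < m\<close> by auto
      next
        case False
        then have "\<forall>i<m. (x \<in> A i) \<longleftrightarrow> cells L n x \<in> D' i" by simp
        then show ?thesis using x unfolding err_def by auto
      qed
    qed
    then have "measure N (err (\<Union>i. A i) L (\<Union>i<m. D' i))
        \<le> measure N (((\<Union>i. A i) - (\<Union>i<m. A i)) \<union> (\<Union>i<m. err (A i) (l i) (D i)))"
      by (rule finite_measure_mono) (auto intro!: sets.finite_UN err_sets)
    also have "\<dots> \<le> measure N ((\<Union>i. A i) - (\<Union>i<m. A i)) + measure N (\<Union>i<m. err (A i) (l i) (D i))"
      by (rule measure_Un_le) (auto intro!: sets.finite_UN err_sets)
    also have "measure N (\<Union>i<m. err (A i) (l i) (D i)) \<le> (\<Sum>i<m. measure N (err (A i) (l i) (D i)))"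
      by (rule finite_measure_subadditive_finite) auto
    also have "\<dots> \<le> (\<Sum>i<m. e')" by (intro sum_mono less_imp_le lD)
    also have "\<dots> \<le> e / 2" using e by (simp add: e'_def field_simps)
    finally show "\<exists>l D. measure N (err (\<Union>i. A i) l D) < e" using m by (intro exI[of _ L] exI[of _ "\<Union>i<m. D' i"]) simp
  qed
  have good_empty: "good {}"
    unfolding good_def by (auto simp: err_def intro!: exI[of _ 0] exI[of _ "{}"])
  have coord: "good {f \<in> space N. f i \<in> B}" if i: "i \<in> {1..int n}" and B: "B \<in> sets \<mu>" for i B
    using B[unfolded Ch_sigma]
  proof (induction rule: sigma_sets.induct)
    case (Basic B)
    then obtain l where l: "B \<in> Ch l" by blast
    have xi: "x i \<in> space \<mu>" if "x \<in> space N" for x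
      using that i PiE_mem[of x "{1..int n}" "\<lambda>_. space \<mu>" i] unfolding space prodM_def space_PiM by simp
    have eq: "x i \<in> B \<longleftrightarrow> cells l n x \<in> {c. c i = B}" if "x \<in> space N" for x
      using cell_eq[OF l, of "x i"] cell_mem[OF xi[OF that], of l] i by (auto simp: cells_def)
    then have "{f \<in> space N. f i \<in> B} = {x \<in> space N. cells l n x \<in> {c. c i = B}}" by blast
    then have "{f \<in> space N. f i \<in> B} \<in> sets N" using pre[of l "{c. c i = B}"] by simp
    moreover have "err {f \<in> space N. f i \<in> B} l {c. c i = B} = {}"
      using eq unfolding err_def by simp
    ultimately show ?case unfolding good_def by (auto intro!: exI[of _ l] exI[of _ "{c. c i = B}"])
  next
    case Empty
    then show ?case using good_empty by simp
  next
    case (Compl B)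
    have "{f \<in> space N. f i \<in> space \<mu> - B} = space N - {f \<in> space N. f i \<in> B}"
      using i by (auto simp: space prodM_def space_PiM PiE_mem)
    then show ?case using good_compl[OF Compl.IH] by simp
  next
    case (Union B)
    have "{f \<in> space N. f i \<in> \<Union> (range B)} = (\<Union>j. {f \<in> space N. f i \<in> B j})" by blast
    then show ?case using good_Un[OF Union.IH] by simp
  qed
  have "A \<in> sigma_sets (\<Pi>\<^sub>E i\<in>{1..int n}. space \<mu>) {{f\<in>\<Pi>\<^sub>E i\<in>{1..int n}. space \<mu>. f i \<in> A} | i A. i \<in> {1..int n} \<and> A \<in> sets \<mu>}"
    using A unfolding sets prodM_def sets_PiM_single by simp
  then have "good A"
  proof (induction rule: sigma_sets.induct)
    case (Basic a)
    then show ?case using coord by (auto simp: space prodM_def space_PiM)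
  next
    case (Compl a)
    then show ?case using good_compl by (auto simp: space prodM_def space_PiM)
  next
    case (Union a)
    show ?case by (rule good_Un[OF Union.IH])
  qed (rule good_empty)
  then obtain l D where "measure N (err A l D) < e" using e unfolding good_def by auto
  then show ?thesis unfolding err_def by (intro exI)
qed

text \<open>Density in L1 passes from indicators to all integrable functions. The measure N is left
  general because \<open>quantization\<close> needs one approximant that is good for two measures at
  once.\<close>

lemma cells_approx_integrable:
  fixes f :: "(int \<Rightarrow> 'a) \<Rightarrow> real"
  assumes "finite_measure N" and sets: "sets N = sets (prodM \<mu> n)" and f: "integrable N f" and e: "e > 0"
  shows "\<exists>l G. (\<integral>x. \<bar>f x - G (cells l n x)\<bar> \<partial>N) < e"
proof -
  interpret finite_measure N by fact
  have space: "space N = space (prodM \<mu> n)" by (rule sets_eq_imp_space_eq[OF sets])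
  have cells [measurable]: "cells l n \<in> measurable N (count_space (words l n))" for l
    using cells_measurable by (simp add: measurable_cong_sets[OF sets refl])
  have intG: "integrable N (\<lambda>x. G (cells l n x) :: real)" for G l
    by (rule integral_finite_range[OF finite_measure_axioms cells finite_words])
  have lift: "\<exists>G'. \<forall>x\<in>space N. G (cells k n x) = (G' (cells l n x) :: real)" if kl: "k \<le> l" for k l G
  proof -
    obtain \<Phi> where "\<And>x. x \<in> space (prodM \<mu> n) \<Longrightarrow> cells k n x = \<Phi> (cells l n x)" using cells_refine[OF kl] by blast
    then show ?thesis by (intro exI[of _ "G \<circ> \<Phi>"]) (simp add: space)
  qed
  show ?thesis using f e
  proof (induction f arbitrary: e rule: integrable_induct)
    case (base A c)
    \<comment> \<open>The summand 1 covers c = 0.\<close>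
    have "e / (\<bar>c\<bar> + 1) > 0" using base by (simp add: add_nonneg_pos)
    from cells_approx_set[OF finite_measure_axioms sets base(1) this]
    obtain l D where lD: "measure N {x \<in> space N. x \<in> A \<longleftrightarrow> cells l n x \<notin> D} < e / (\<bar>c\<bar> + 1)" (is "measure N ?E < _") by blast
    have eq: "\<bar>indicator A x *\<^sub>R c - (if cells l n x \<in> D then c else 0)\<bar> = \<bar>c\<bar> * indicator ?E x" if "x \<in> space N" for x
      using that by (auto simp: indicator_def)
    have "(\<integral>x. \<bar>indicator A x *\<^sub>R c - (if cells l n x \<in> D then c else 0)\<bar> \<partial>N) = (\<integral>x. \<bar>c\<bar> * indicator ?E x \<partial>N)"
      by (rule Bochner_Integration.integral_cong[OF refl eq])
    also have "\<dots> = \<bar>c\<bar> * measure N ?E"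
      by (simp add: Int_absorb2 Collect_conj_eq)
    also have "\<dots> \<le> (\<bar>c\<bar> + 1) * measure N ?E" by (intro mult_right_mono) auto
    also have "\<dots> < e" using lD by (simp add: field_simps)
    finally show ?case by (intro exI[of _ l] exI[of _ "\<lambda>w. if w \<in> D then c else 0"]) simp
  next
    case (add f g)
    obtain k F where k: "(\<integral>x. \<bar>f x - F (cells k n x)\<bar> \<partial>N) < e / 2" using add.IH(1)[OF half_gt_zero[OF add.prems]] by (elim exE)
    obtain l G where l: "(\<integral>x. \<bar>g x - G (cells l n x)\<bar> \<partial>N) < e / 2" using add.IH(2)[OF half_gt_zero[OF add.prems]] by (elim exE)
    define m where "m = max k l"
    obtain F' where F': "\<And>x. x \<in> space N \<Longrightarrow> F (cells k n x) = F' (cells m n x)" using lift[of k m F] by (auto simp: m_def)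
    obtain G' where G': "\<And>x. x \<in> space N \<Longrightarrow> G (cells l n x) = G' (cells m n x)" using lift[of l m G] by (auto simp: m_def)
    have "(\<integral>x. \<bar>f x + g x - (F' (cells m n x) + G' (cells m n x))\<bar> \<partial>N)
      \<le> (\<integral>x. \<bar>f x - F (cells k n x)\<bar> + \<bar>g x - G (cells l n x)\<bar> \<partial>N)"
      using add.hyps
      by (intro integral_mono integrable_abs Bochner_Integration.integrable_add Bochner_Integration.integrable_diff intG)
        (auto simp: F' G')
    also have "\<dots> = (\<integral>x. \<bar>f x - F (cells k n x)\<bar> \<partial>N) + (\<integral>x. \<bar>g x - G (cells l n x)\<bar> \<partial>N)"
      using add.hyps by (intro Bochner_Integration.integral_add integrable_abs Bochner_Integration.integrable_diff intG)
    finally show ?case using k l by (intro exI[of _ m] exI[of _ "\<lambda>w. F' w + G' w"]) simp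
  next
    case (lim f s)
    have "(\<lambda>i. \<integral>x. \<bar>f x - s i x\<bar> \<partial>N) \<longlonglongrightarrow> (\<integral>x. 0 \<partial>N)"
    \<comment> \<open>The induction rule supplies |s i| \<le> 2 |f|, hence |f - s i| \<le> 3
      |f|.\<close>
    proof (rule integral_dominated_convergence[where w = "\<lambda>x. 3 * \<bar>f x\<bar>"])
      show "AE x in N. (\<lambda>i. \<bar>f x - s i x\<bar>) \<longlonglongrightarrow> 0"
      proof (rule AE_I2)
        fix x assume "x \<in> space N"
        then have "(\<lambda>i. \<bar>f x - s i x\<bar>) \<longlonglongrightarrow> \<bar>f x - f x\<bar>" by (intro tendsto_intros lim.hyps(2))
        then show "(\<lambda>i. \<bar>f x - s i x\<bar>) \<longlonglongrightarrow> 0" by simp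
      qed
      show "AE x in N. norm \<bar>f x - s i x\<bar> \<le> 3 * \<bar>f x\<bar>" for i
      proof (rule AE_I2)
        fix x assume "x \<in> space N"
        then have "\<bar>s i x\<bar> \<le> 2 * \<bar>f x\<bar>" using lim.hyps(3)[of x i] by simp
        then show "norm \<bar>f x - s i x\<bar> \<le> 3 * \<bar>f x\<bar>" by simp
      qed
    qed (use lim.hyps(1,4) in \<open>auto intro!: borel_measurable_diff borel_measurable_abs\<close>)
    then have "\<forall>\<^sub>F i in sequentially. (\<integral>x. \<bar>f x - s i x\<bar> \<partial>N) < e / 2"
      using lim.prems by (intro order_tendstoD(2)[where y = "\<integral>x. 0 \<partial>N"]) auto
    then obtain i where i: "(\<integral>x. \<bar>f x - s i x\<bar> \<partial>N) < e / 2" unfolding eventually_sequentially by blast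
    have "\<exists>l G. (\<integral>x. \<bar>s i x - G (cells l n x)\<bar> \<partial>N) < e / 2" by (rule lim.IH) (use lim.prems in simp)
    then obtain l G where l: "(\<integral>x. \<bar>s i x - G (cells l n x)\<bar> \<partial>N) < e / 2" by (elim exE)
    have "(\<integral>x. \<bar>f x - G (cells l n x)\<bar> \<partial>N) \<le> (\<integral>x. \<bar>f x - s i x\<bar> + \<bar>s i x - G (cells l n x)\<bar> \<partial>N)"
      using lim.hyps(1,4) by (intro integral_mono integrable_abs Bochner_Integration.integrable_add Bochner_Integration.integrable_diff intG) auto
    also have "\<dots> = (\<integral>x. \<bar>f x - s i x\<bar> \<partial>N) + (\<integral>x. \<bar>s i x - G (cells l n x)\<bar> \<partial>N)"
      using lim.hyps(1,4) by (intro Bochner_Integration.integral_add integrable_abs Bochner_Integration.integrable_diff intG)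
    finally show ?case using i l by (intro exI[of _ l] exI[of _ G]) simp
  qed
qed

end

subsection \<open>Gibbs' inequality and quantized entropies\<close>

text \<open>The inequality ln t \<le> t - 1 at t = \<open>\<tau> c / \<pi> c\<close>, averaged over
  \<pi>. The weights \<tau> are unnormalized and their total appears on the right, which serves both
  subprobabilities and the variational inequality.\<close>

lemma finite_Gibbs:
  fixes \<pi> \<tau> :: "'b \<Rightarrow> real"
  assumes S: "finite S" and \<pi>: "\<And>c. c \<in> S \<Longrightarrow> 0 \<le> \<pi> c" "(\<Sum>c\<in>S. \<pi> c) = 1"
    and \<tau>: "\<And>c. c \<in> S \<Longrightarrow> 0 \<le> \<tau> c" and pos: "\<And>c. c \<in> S \<Longrightarrow> 0 < \<pi> c \<Longrightarrow> 0 < \<tau> c"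
  shows "(\<Sum>c\<in>S. \<pi> c * ln (\<tau> c)) - (\<Sum>c\<in>S. \<pi> c * ln (\<pi> c)) \<le> (\<Sum>c\<in>S. \<tau> c) - 1"
proof -
  have "\<pi> c * ln (\<tau> c) - \<pi> c * ln (\<pi> c) \<le> \<tau> c - \<pi> c" if c: "c \<in> S" for c
  proof (cases "\<pi> c = 0")
    case False
    then have p: "\<pi> c > 0" "\<tau> c > 0" using \<pi>(1)[OF c] pos[OF c] by auto
    have "\<pi> c * ln (\<tau> c) - \<pi> c * ln (\<pi> c) = \<pi> c * ln (\<tau> c / \<pi> c)"
      using p by (simp add: ln_div right_diff_distrib)
    also have "\<dots> \<le> \<pi> c * (\<tau> c / \<pi> c - 1)"
      using p by (intro mult_left_mono ln_le_minus_one) auto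
    also have "\<dots> = \<tau> c - \<pi> c" using p by (simp add: field_simps)
    finally show ?thesis .
  qed (use \<tau>[OF c] in simp)
  then have "(\<Sum>c\<in>S. \<pi> c * ln (\<tau> c) - \<pi> c * ln (\<pi> c)) \<le> (\<Sum>c\<in>S. \<tau> c - \<pi> c)"
    by (rule sum_mono)
  then show ?thesis by (simp add: sum_subtractf \<pi>(2))
qed

text \<open>For b = 0 and b = \<open>\<top>\<close> the left side is 0, so integrals against a
  density can be estimated without separating the places where it degenerates.\<close>

lemma ennreal_mult_divide_le: "b * (a / b) \<le> a" for a b :: ennreal
  by (cases "b = 0"; cases "b = \<top>")
    (auto simp: ennreal_times_divide mult.commute[of b] ennreal_mult_divide_eq)

section \<open>Block densities of a stationary ergodic process and Gibbs' inequality for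
  them\<close>

locale process =
  fixes \<mu> :: "'a measure" and P :: "(int \<Rightarrow> 'a) measure"
  assumes fin: "finite_measure \<mu>" and base: "in_E_base \<mu> P"
begin

lemma stat_erg: "stationary_ergodic \<mu> P"
  using base unfolding in_E_base_def by simp

sublocale prob_space P
  using stat_erg unfolding stationary_ergodic_def by simp

lemma sets_P [measurable_cong]: "sets P = sets (seq_space \<mu>)"
  using stat_erg unfolding stationary_ergodic_def by simp

lemma space_P: "space P = space (seq_space \<mu>)"
  by (rule sets_eq_imp_space_eq[OF sets_P])

lemma coord_in_space: "\<omega> \<in> space P \<Longrightarrow> \<omega> i \<in> space \<mu>"
  unfolding space_P seq_space_def space_PiM by (rule PiE_mem) auto

lemma shift_P [measurable]: "shift \<in> measurable P P"
  using shift_measurable by (simp add: measurable_cong_sets[OF sets_P sets_P])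

lemma shift_pres: "A \<in> sets P \<Longrightarrow> emeasure P (shift -` A \<inter> space P) = emeasure P A"
  using stat_erg unfolding stationary_ergodic_def by simp

lemma shift_erg: "A \<in> sets P \<Longrightarrow> shift -` A \<inter> space P = A \<Longrightarrow> emeasure P A = 0 \<or> emeasure P A = 1"
  using stat_erg unfolding stationary_ergodic_def by simp

lemma distr_shift: "distr P P (shift ^^ m) = P"
proof (induction m)
  case (Suc m)
  have "distr P P shift = P"
    by (rule measure_eqI) (auto simp: emeasure_distr shift_pres)
  moreover have "distr (distr P P (shift ^^ m)) P shift = distr P P (shift ^^ Suc m)"
    unfolding funpow.simps(2) by (rule distr_distr[OF shift_P measurable_compose_n[OF shift_P]])
  ultimately show ?case using Suc by (simp only:)
qed (simp add: id_def distr_id)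

lemma integral_shift:
  fixes f :: "(int \<Rightarrow> 'a) \<Rightarrow> real"
  assumes "f \<in> borel_measurable P"
  shows "(\<integral>\<omega>. f ((shift ^^ m) \<omega>) \<partial>P) = (\<integral>\<omega>. f \<omega> \<partial>P)"
  using integral_distr[of "shift ^^ m" P P f] assms measurable_compose_n[OF shift_P, of m]
  by (simp add: distr_shift)

lemma block_P [measurable]: "block n \<in> measurable P (prodM \<mu> n)"
  using block_measurable by (simp add: measurable_cong_sets[OF sets_P refl])

definition p :: "nat \<Rightarrow> (int \<Rightarrow> 'a) \<Rightarrow> ennreal" where
  "p n = RN_deriv (prodM \<mu> n) (marg \<mu> P n)"

lemma p_measurable [measurable]: "p n \<in> borel_measurable (prodM \<mu> n)"
  unfolding p_def by simp

lemma dens_eq: "dens \<mu> P n \<omega> = p n (block n \<omega>)"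
  unfolding dens_def p_def ..

lemma nn_integral_block:
  assumes f [measurable]: "f \<in> borel_measurable (prodM \<mu> n)"
  shows "(\<integral>\<^sup>+\<omega>. f (block n \<omega>) \<partial>P) = (\<integral>\<^sup>+x. p n x * f x \<partial>prodM \<mu> n)"
proof -
  interpret sigma_finite_measure "prodM \<mu> n" by (rule sigma_finite_prodM[OF fin])
  have "absolutely_continuous (prodM \<mu> n) (marg \<mu> P n)" using base unfolding in_E_base_def by simp
  then have d: "density (prodM \<mu> n) (p n) = marg \<mu> P n"
    unfolding p_def by (intro density_RN_deriv) (auto simp: marg_def)
  have "(\<integral>\<^sup>+\<omega>. f (block n \<omega>) \<partial>P) = (\<integral>\<^sup>+x. f x \<partial>marg \<mu> P n)"
    unfolding marg_def by (rule nn_integral_distr[symmetric]) measurable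
  also have "\<dots> = (\<integral>\<^sup>+x. p n x * f x \<partial>prodM \<mu> n)"
    unfolding d[symmetric] by (rule nn_integral_density) measurable
  finally show ?thesis .
qed

lemma AE_block:
  assumes A: "A \<in> sets (prodM \<mu> n)" and "emeasure (prodM \<mu> n) A = 0"
  shows "AE \<omega> in P. block n \<omega> \<notin> A"
proof -
  have "absolutely_continuous (prodM \<mu> n) (marg \<mu> P n)" using base unfolding in_E_base_def by simp
  then have "A \<in> null_sets (marg \<mu> P n)" using assms unfolding absolutely_continuous_def by auto
  then have "AE x in marg \<mu> P n. x \<notin> A" by (rule AE_not_in)
  then show ?thesis unfolding marg_def by (rule AE_distrD[rotated]) measurable
qed

text \<open>Finite expectation of \<open>neglog\<close> excludes the values 0 and
  \<open>\<top>\<close> of the density almost surely, and away from them \<open>neglog\<close> is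
  the real logarithm.\<close>

lemma entropy_finite:
  assumes hfin: "\<bar>hmu \<mu> P n\<bar> \<noteq> \<infinity>"
  shows "integrable P (\<lambda>\<omega>. - ln (enn2real (p n (block n \<omega>))))" (is ?I)
    and "AE \<omega> in P. 0 < p n (block n \<omega>) \<and> p n (block n \<omega>) < \<top>" (is ?A)
    and "hmu \<mu> P n = ereal (\<integral>\<omega>. - ln (enn2real (p n (block n \<omega>))) \<partial>P)" (is ?E)
proof -
  have m [measurable]: "(\<lambda>\<omega>. neglog (dens \<mu> P n \<omega>)) \<in> borel_measurable P"
    unfolding neglog_def dens_eq by measurable
  note f = ereal_expect_finite[OF m hfin[unfolded hmu_def]]
  show A: ?A
    using f(2)
  proof eventually_elim
    case (elim \<omega>)
    then show ?case
      by (cases "p n (block n \<omega>) = 0"; cases "p n (block n \<omega>) = \<top>")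
        (auto simp: neglog_def dens_eq zero_less_iff_neq_zero less_top)
  qed
  have e: "AE \<omega> in P. real_of_ereal (neglog (dens \<mu> P n \<omega>)) = - ln (enn2real (p n (block n \<omega>)))"
    using A by eventually_elim (auto simp: neglog_def dens_eq)
  show ?I using f(1) by (rule integrable_cong_AE_imp) (use e in \<open>auto simp: eq_commute\<close>)
  show ?E unfolding hmu_def f(3) ereal.inject by (rule integral_cong_AE) (use e in auto)
qed

text \<open>The ratio r of g to the density of P has P-mean at most 1, and ln r \<le> r - 1. The
  bound B controls the positive part of \<open>- ln g\<close>; the negative part is controlled by
  the Gibbs estimate itself.\<close>

lemma Gibbs_block:
  assumes hfin: "\<bar>hmu \<mu> P n\<bar> \<noteq> \<infinity>"
    and g [measurable]: "g \<in> borel_measurable (prodM \<mu> n)" and pos: "\<And>x. 0 < g x"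
    and mass: "(\<integral>\<^sup>+x. ennreal (g x) \<partial>prodM \<mu> n) \<le> 1" and low: "\<And>x. - ln (g x) \<le> B"
  shows "integrable P (\<lambda>\<omega>. - ln (g (block n \<omega>)))"
    and "hmu \<mu> P n \<le> ereal (\<integral>\<omega>. - ln (g (block n \<omega>)) \<partial>P)"
proof -
  note f = entropy_finite[OF hfin]
  define q where "q \<omega> = enn2real (p n (block n \<omega>))" for \<omega>
  define r where "r \<omega> = g (block n \<omega>) / q \<omega>" for \<omega>
  have [measurable]: "q \<in> borel_measurable P" "r \<in> borel_measurable P"
    unfolding q_def[abs_def] r_def[abs_def] by measurable
  have qpos: "AE \<omega> in P. 0 < q \<omega> \<and> p n (block n \<omega>) = ennreal (q \<omega>)"
    using f(2) by eventually_elim (auto simp: q_def enn2real_positive_iff)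
  have "(\<integral>\<^sup>+\<omega>. ennreal (r \<omega>) \<partial>P) = (\<integral>\<^sup>+\<omega>. ennreal (g (block n \<omega>)) / p n (block n \<omega>) \<partial>P)"
    by (rule nn_integral_cong_AE, use qpos in eventually_elim) (auto simp: r_def divide_ennreal pos less_imp_le)
  also have "\<dots> = (\<integral>\<^sup>+x. p n x * (ennreal (g x) / p n x) \<partial>prodM \<mu> n)"
    by (rule nn_integral_block) measurable
  also have "\<dots> \<le> (\<integral>\<^sup>+x. ennreal (g x) \<partial>prodM \<mu> n)"
    by (intro nn_integral_mono ennreal_mult_divide_le)
  finally have r1: "(\<integral>\<^sup>+\<omega>. ennreal (r \<omega>) \<partial>P) \<le> 1" using mass by (rule order_trans)
  have r0: "0 \<le> r \<omega>" for \<omega> unfolding r_def q_def using pos by (intro divide_nonneg_nonneg) (auto intro: less_imp_le)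
  have r_int: "integrable P r"
    by (rule integrableI_bounded) (use r1 r0 in \<open>auto intro: order_le_less_trans\<close>)
  have r_le: "(\<integral>\<omega>. r \<omega> \<partial>P) \<le> 1"
    using r1 nn_integral_eq_integral[OF r_int] r0 by (simp add: ennreal_le_1)
  \<comment> \<open>Used twice: as an integrable lower bound in the proof of integrability, and
    integrated as Gibbs' inequality.\<close>
  have key: "AE \<omega> in P. - ln (q \<omega>) + 1 - r \<omega> \<le> - ln (g (block n \<omega>))"
    using qpos
  proof eventually_elim
    case (elim \<omega>)
    have "ln (r \<omega>) \<le> r \<omega> - 1" using elim pos by (intro ln_le_minus_one) (auto simp: r_def)
    moreover have "ln (r \<omega>) = ln (g (block n \<omega>)) - ln (q \<omega>)" using elim pos[of "block n \<omega>"] by (simp add: r_def ln_div)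
    ultimately show ?case by simp
  qed
  have d_int: "integrable P (\<lambda>\<omega>. - ln (q \<omega>))" using f(1) unfolding q_def .
  show int: "integrable P (\<lambda>\<omega>. - ln (g (block n \<omega>)))"
  proof (rule Bochner_Integration.integrable_bound)
    show "integrable P (\<lambda>\<omega>. \<bar>B\<bar> + \<bar>- ln (q \<omega>)\<bar> + 1 + \<bar>r \<omega>\<bar>)"
      by (intro Bochner_Integration.integrable_add integrable_abs d_int r_int) auto
    show "AE \<omega> in P. norm (- ln (g (block n \<omega>))) \<le> norm (\<bar>B\<bar> + \<bar>- ln (q \<omega>)\<bar> + 1 + \<bar>r \<omega>\<bar>)"
      using key
    proof eventually_elim
      case (elim \<omega>)
      have "- ln (g (block n \<omega>)) \<le> B" by (rule low)
      then show ?case using elim by simp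
    qed
  qed measurable
  have "(\<integral>\<omega>. - ln (q \<omega>) \<partial>P) \<le> (\<integral>\<omega>. - ln (q \<omega>) \<partial>P) + 1 - (\<integral>\<omega>. r \<omega> \<partial>P)" using r_le by simp
  also have "\<dots> = (\<integral>\<omega>. - ln (q \<omega>) + 1 - r \<omega> \<partial>P)"
    using d_int r_int by (simp add: prob_space)
  also have "\<dots> \<le> (\<integral>\<omega>. - ln (g (block n \<omega>)) \<partial>P)"
    by (rule integral_mono_AE) (use d_int r_int int key in auto)
  finally show "hmu \<mu> P n \<le> ereal (\<integral>\<omega>. - ln (g (block n \<omega>)) \<partial>P)" unfolding f(3) q_def[symmetric] by simp
qed

end

section \<open>Shannon entropies of quantized blocks\<close>

locale quantized_process = partitioned_space \<mu> Ch + process \<mu> P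
  for \<mu> :: "'a measure" and Ch P
begin

lemma cells_P [measurable]: "cells l n \<in> measurable P (count_space (words l n))"
  using cells_measurable_seq by (simp add: measurable_cong_sets[OF sets_P refl])

lemma cells_in_words: "\<omega> \<in> space P \<Longrightarrow> cells l n \<omega> \<in> words l n"
  using measurable_space[OF cells_P] by simp

definition pr :: "nat \<Rightarrow> nat \<Rightarrow> (int \<Rightarrow> 'a set) \<Rightarrow> real" where
  "pr l n a = measure P {\<omega> \<in> space P. cells l n \<omega> = a}"

definition H :: "nat \<Rightarrow> nat \<Rightarrow> real" where
  "H l n = - (\<Sum>a\<in>words l n. pr l n a * ln (pr l n a))"

lemma pr_nonneg: "0 \<le> pr l n a" and pr_le_1: "pr l n a \<le> 1"
  unfolding pr_def by auto

lemma cells_event [measurable]: "{\<omega> \<in> space P. cells l n \<omega> = a} \<in> sets P"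
proof (cases "a \<in> words l n")
  case True
  have "cells l n -` {a} \<inter> space P \<in> sets P"
    by (rule measurable_sets[OF cells_P]) (simp add: True)
  moreover have "cells l n -` {a} \<inter> space P = {\<omega> \<in> space P. cells l n \<omega> = a}" by auto
  ultimately show ?thesis by simp
next
  case False
  then have "{\<omega> \<in> space P. cells l n \<omega> = a} = {}" using cells_in_words by auto
  then show ?thesis by simp
qed

lemma integrable_cells: "integrable P (\<lambda>\<omega>. G (cells l n \<omega>) :: real)"
  by (rule integral_finite_range(1)[OF finite_measure_axioms cells_P finite_words])

lemma integral_cells:
  fixes G :: "(int \<Rightarrow> 'a set) \<Rightarrow> real"
  shows "(\<integral>\<omega>. G (cells l n \<omega>) \<partial>P) = (\<Sum>a\<in>words l n. pr l n a * G a)"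
proof -
  have "cells l n -` {a} \<inter> space P = {\<omega> \<in> space P. cells l n \<omega> = a}" for a by auto
  then show ?thesis
    unfolding integral_finite_range(2)[OF finite_measure_axioms cells_P finite_words] pr_def
    by (simp add: mult.commute)
qed

lemma sum_pr: "(\<Sum>a\<in>words l n. pr l n a) = 1"
  using integral_cells[of "\<lambda>_. 1" l n] by (simp add: prob_space)

lemma H_eq: "H l n = - (\<integral>\<omega>. ln (pr l n (cells l n \<omega>)) \<partial>P)"
  unfolding H_def integral_cells[of "\<lambda>a. ln (pr l n a)"] ..

lemma H_nonneg: "0 \<le> H l n"
proof -
  have "pr l n a * ln (pr l n a) \<le> 0" for a
    using pr_nonneg[of l n a] pr_le_1[of l n a]
    by (cases "pr l n a = 0") (auto intro!: mult_nonneg_nonpos)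
  then show ?thesis unfolding H_def by (simp add: sum_nonpos)
qed

text \<open>There are finitely many words, so the events of those with probability zero form a null
  set together.\<close>

lemma AE_pr_pos: "AE \<omega> in P. 0 < pr l n (cells l n \<omega>)"
proof -
  have "AE \<omega> in P. \<forall>a\<in>words l n. pr l n a = 0 \<longrightarrow> cells l n \<omega> \<noteq> a"
  proof (rule AE_finite_allI[OF finite_words])
    fix a assume "a \<in> words l n"
    show "AE \<omega> in P. pr l n a = 0 \<longrightarrow> cells l n \<omega> \<noteq> a"
    proof (cases "pr l n a = 0")
      case True
      then have "{\<omega> \<in> space P. cells l n \<omega> = a} \<in> null_sets P"
        by (intro null_setsI) (auto simp: pr_def emeasure_eq_measure)
      from AE_not_in[OF this] show ?thesis by (rule AE_mp) (auto intro!: AE_I2)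
    qed simp
  qed
  then show ?thesis
    by (rule AE_mp) (use cells_in_words pr_nonneg in \<open>auto intro!: AE_I2 simp: less_le\<close>)
qed

lemma cells_prefix: "restrict (cells l (m + k) \<omega>) {1..int m} = cells l m \<omega>"
  unfolding cells_def by (auto simp: restrict_def fun_eq_iff)

lemma cells_suffix: "(\<lambda>i\<in>{1..int k}. cells l (m + k) \<omega> (i + int m)) = cells l k ((shift ^^ m) \<omega>)"
  unfolding cells_def funpow_shift by (auto simp: restrict_def fun_eq_iff)

lemma AE_shift:
  assumes "AE \<omega> in P. Q \<omega>"
  shows "AE \<omega> in P. Q ((shift ^^ m) \<omega>)"
proof -
  have "AE \<omega> in distr P P (shift ^^ m). Q \<omega>" using assms by (simp only: distr_shift)
  then show ?thesis by (rule AE_distrD[OF measurable_compose_n[OF shift_P]])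
qed

text \<open>Gibbs' inequality against the product of the laws of the first m and the last k letters.
  By stationarity the last k letters have the law of the first k.\<close>

lemma H_subadditive: "H l (m + k) \<le> H l m + H l k"
proof -
  define pre where "pre c = restrict c {1..int m}" for c :: "int \<Rightarrow> 'a set"
  define suf where "suf c = (\<lambda>i\<in>{1..int k}. c (i + int m))" for c :: "int \<Rightarrow> 'a set"
  define \<tau> where "\<tau> c = pr l m (pre c) * pr l k (suf c)" for c
  \<comment> \<open>The event of a word with positive probability contains a point outside the null
    sets of \<open>AE_pr_pos\<close>; there both the prefix and the suffix have positive
    probability.\<close>
  have pos: "0 < \<tau> c" if c: "c \<in> words l (m + k)" "0 < pr l (m + k) c" for c
  proof -
    have "AE \<omega> in P. cells l (m + k) \<omega> = c \<longrightarrow> 0 < \<tau> c"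
      using AE_pr_pos[of l m] AE_shift[OF AE_pr_pos[of l k], of m]
    proof eventually_elim
      case (elim \<omega>)
      then show ?case
        using cells_prefix[of l m k \<omega>] cells_suffix[of l m k \<omega>] unfolding \<tau>_def pre_def suf_def by auto
    qed
    moreover have "\<not> (AE \<omega> in P. cells l (m + k) \<omega> \<noteq> c)"
    proof
      assume "AE \<omega> in P. cells l (m + k) \<omega> \<noteq> c"
      then have "pr l (m + k) c = 0" unfolding pr_def by (intro prob_eq_0[THEN iffD2]) auto
      then show False using c by simp
    qed
    ultimately show ?thesis by (cases "0 < \<tau> c") auto
  qed
  \<comment> \<open>Cutting is injective, so the total of \<tau> is at most the product of two
    totals equal to 1.\<close>
  have "inj_on (\<lambda>c. (pre c, suf c)) (words l (m + k))"
  proof (rule inj_onI)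
    fix c d assume c: "c \<in> words l (m + k)" "d \<in> words l (m + k)" "(pre c, suf c) = (pre d, suf d)"
    show "c = d"
    proof (rule extensionalityI[of _ "{1..int (m + k)}"])
      fix i assume i: "i \<in> {1..int (m + k)}"
      show "c i = d i"
      proof (cases "i \<le> int m")
        case True
        have "pre c i = pre d i" using c(3) by simp
        then show ?thesis using True i by (simp add: pre_def)
      next
        case False
        have "suf c (i - int m) = suf d (i - int m)" using c(3) by simp
        then show ?thesis using False i by (simp add: suf_def)
      qed
    qed (use c in \<open>auto simp: words_def PiE_def\<close>)
  qed
  moreover have "(\<lambda>c. (pre c, suf c)) ` words l (m + k) \<subseteq> words l m \<times> words l k"
  proof -
    have mem: "c i \<in> Ch l" if "c \<in> words l (m + k)" "i \<in> {1..int (m + k)}" for c i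
      using that unfolding words_def by (rule PiE_mem)
    have "pre c \<in> words l m" if c: "c \<in> words l (m + k)" for c
      unfolding pre_def words_def by (rule restrict_PiE_iff[THEN iffD2]) (use mem[OF c] in simp)
    moreover have "suf c \<in> words l k" if c: "c \<in> words l (m + k)" for c
      unfolding suf_def words_def by (rule restrict_PiE_iff[THEN iffD2]) (use mem[OF c] in simp)
    ultimately show ?thesis by auto
  qed
  ultimately have "(\<Sum>c\<in>words l (m + k). \<tau> c) \<le> (\<Sum>(a, b)\<in>words l m \<times> words l k. pr l m a * pr l k b)"
    using sum.reindex[of "\<lambda>c. (pre c, suf c)" "words l (m + k)" "\<lambda>(a, b). pr l m a * pr l k b"]
      sum_mono2[of "words l m \<times> words l k" "(\<lambda>c. (pre c, suf c)) ` words l (m + k)" "\<lambda>(a, b). pr l m a * pr l k b"]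
    by (auto simp: finite_words \<tau>_def comp_def pr_nonneg)
  also have "\<dots> = (\<Sum>a\<in>words l m. pr l m a) * (\<Sum>b\<in>words l k. pr l k b)"
    by (simp add: sum_product sum.cartesian_product)
  finally have mass: "(\<Sum>c\<in>words l (m + k). \<tau> c) \<le> 1" by (simp add: sum_pr)
  have "(\<Sum>c\<in>words l (m + k). pr l (m + k) c * ln (\<tau> c)) - (\<Sum>c\<in>words l (m + k). pr l (m + k) c * ln (pr l (m + k) c))
      \<le> (\<Sum>c\<in>words l (m + k). \<tau> c) - 1"
    by (rule finite_Gibbs) (use pos in \<open>auto simp: finite_words pr_nonneg sum_pr \<tau>_def\<close>)
  then have "H l (m + k) \<le> - (\<integral>\<omega>. ln (\<tau> (cells l (m + k) \<omega>)) \<partial>P)"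
    using mass unfolding integral_cells[of "\<lambda>c. ln (\<tau> c)"] H_def by simp
  also have "(\<integral>\<omega>. ln (\<tau> (cells l (m + k) \<omega>)) \<partial>P)
      = (\<integral>\<omega>. ln (pr l m (cells l m \<omega>)) + ln (pr l k (cells l k ((shift ^^ m) \<omega>))) \<partial>P)"
  proof (rule integral_cong_AE)
    show "AE \<omega> in P. ln (\<tau> (cells l (m + k) \<omega>)) = ln (pr l m (cells l m \<omega>)) + ln (pr l k (cells l k ((shift ^^ m) \<omega>)))"
      using AE_pr_pos[of l m] AE_shift[OF AE_pr_pos[of l k], of m]
    proof eventually_elim
      case (elim \<omega>)
      then show ?case
        unfolding \<tau>_def pre_def suf_def cells_prefix cells_suffix by (simp add: ln_mult)
    qed
    have "(\<lambda>\<omega>. ln (pr l k (cells l k \<omega>))) \<in> borel_measurable P" by (rule borel_measurable_integrable[OF integrable_cells])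
    from measurable_compose[OF measurable_compose_n[OF shift_P] this]
    show "(\<lambda>\<omega>. ln (pr l m (cells l m \<omega>)) + ln (pr l k (cells l k ((shift ^^ m) \<omega>)))) \<in> borel_measurable P"
      by (intro borel_measurable_add borel_measurable_integrable[OF integrable_cells])
  qed (rule borel_measurable_integrable[OF integrable_cells])
  also have "\<dots> = (\<integral>\<omega>. ln (pr l m (cells l m \<omega>)) \<partial>P) + (\<integral>\<omega>. ln (pr l k (cells l k ((shift ^^ m) \<omega>))) \<partial>P)"
  proof (rule Bochner_Integration.integral_add[OF integrable_cells])
    have "integrable (distr P P (shift ^^ m)) (\<lambda>\<omega>. ln (pr l k (cells l k \<omega>)))"
      unfolding distr_shift by (rule integrable_cells)
    then show "integrable P (\<lambda>\<omega>. ln (pr l k (cells l k ((shift ^^ m) \<omega>))))"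
      by (rule integrable_distr[OF measurable_compose_n[OF shift_P]])
  qed
  also have "(\<integral>\<omega>. ln (pr l k (cells l k ((shift ^^ m) \<omega>))) \<partial>P) = (\<integral>\<omega>. ln (pr l k (cells l k \<omega>)) \<partial>P)"
    by (rule integral_shift[OF borel_measurable_integrable[OF integrable_cells]])
  finally show ?thesis unfolding H_eq by simp
qed

section \<open>The quantized process as a stationary ergodic process over a finite alphabet\<close>

definition code :: "nat \<Rightarrow> (int \<Rightarrow> 'a) \<Rightarrow> int \<Rightarrow> 'a set" where
  "code l \<omega> = (\<lambda>i. cell Ch l (\<omega> i))"

definition Q :: "nat \<Rightarrow> (int \<Rightarrow> 'a set) measure" where
  "Q l = distr P (seq_space (count_space (Ch l))) (code l)"

lemma code_measurable [measurable]: "code l \<in> measurable P (seq_space (count_space (Ch l)))"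
proof -
  have "(\<lambda>\<omega>. \<omega> i) \<in> measurable P \<mu>" for i
    unfolding measurable_cong_sets[OF sets_P refl] seq_space_def by (rule measurable_component_singleton) simp
  from measurable_compose[OF this cell_measurable] show ?thesis
    unfolding code_def seq_space_def
    by (intro measurable_PiM_single') (auto simp: cell_in coord_in_space space_PiM)
qed

lemma shift_code: "shift (code l \<omega>) = code l (shift \<omega>)"
  unfolding shift_def code_def ..

lemma space_Q: "space (Q l) = space (seq_space (count_space (Ch l)))" and sets_Q: "sets (Q l) = sets (seq_space (count_space (Ch l)))"
  unfolding Q_def by auto

text \<open>A factor of a stationary ergodic system is stationary ergodic: \<open>code l\<close>
  commutes with the shift, so invariant sets pull back to invariant sets. This makes the
  universality of \<open>R l\<close> applicable to \<open>Q l\<close>.\<close>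

lemma stationary_ergodic_Q: "stationary_ergodic (count_space (Ch l)) (Q l)"
  unfolding stationary_ergodic_def
proof (intro conjI ballI impI)
  show "prob_space (Q l)" unfolding Q_def by (rule prob_space_distr) measurable
  show "sets (Q l) = sets (seq_space (count_space (Ch l)))" by (rule sets_Q)
next
  fix A assume A: "A \<in> sets (Q l)"
  have A': "code l -` A \<inter> space P \<in> sets P" using A unfolding sets_Q by (rule measurable_sets[OF code_measurable])
  have code_sp: "\<omega> \<in> space P \<Longrightarrow> code l \<omega> \<in> space (Q l)" for \<omega>
    unfolding space_Q using measurable_space[OF code_measurable] .
  have shift_sp: "\<omega> \<in> space P \<Longrightarrow> shift \<omega> \<in> space P" for \<omega> using measurable_space[OF shift_P] .
  have eqv: "shift -` (code l -` A \<inter> space P) \<inter> space P = code l -` (shift -` A \<inter> space (Q l)) \<inter> space P"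
    using code_sp shift_sp by (auto simp: shift_code)
  have sA: "shift -` A \<inter> space (Q l) \<in> sets (Q l)"
    using A unfolding sets_Q space_Q by (rule measurable_sets[OF shift_measurable])
  have em: "B \<in> sets (Q l) \<Longrightarrow> emeasure (Q l) B = emeasure P (code l -` B \<inter> space P)" for B
    unfolding sets_Q unfolding Q_def by (rule emeasure_distr[OF code_measurable])
  show "emeasure (Q l) (shift -` A \<inter> space (Q l)) = emeasure (Q l) A"
    unfolding em[OF sA] em[OF A] eqv[symmetric] by (rule shift_pres[OF A'])
  assume inv: "shift -` A \<inter> space (Q l) = A"
  show "emeasure (Q l) A = 0 \<or> emeasure (Q l) A = 1"
    unfolding em[OF A] by (rule shift_erg[OF A']) (simp only: eqv inv)
qed

lemma code_cells: "a \<in> words l n \<Longrightarrow> (\<forall>i\<in>{1..int n}. code l \<omega> i = a i) \<longleftrightarrow> cells l n \<omega> = a"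
proof
  assume "a \<in> words l n" "\<forall>i\<in>{1..int n}. code l \<omega> i = a i"
  then show "cells l n \<omega> = a"
    by (intro extensionalityI[of _ "{1..int n}"]) (auto simp: cells_def code_def words_def PiE_def)
qed (auto simp: cells_def code_def)

lemma measure_Q_cylinder:
  assumes a: "a \<in> words l n"
  shows "measure (Q l) {\<omega> \<in> space (Q l). \<forall>i\<in>{1..int n}. \<omega> i = a i} = pr l n a"
proof -
  have s: "{\<omega> \<in> space (seq_space (count_space (Ch l))). \<forall>i\<in>{1..int n}. \<omega> i = a i} \<in> sets (seq_space (count_space (Ch l)))"
    unfolding seq_space_def by measurable
  have "code l -` {\<omega> \<in> space (seq_space (count_space (Ch l))). \<forall>i\<in>{1..int n}. \<omega> i = a i} \<inter> space P = {\<omega> \<in> space P. cells l n \<omega> = a}"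
    using code_cells[OF a] measurable_space[OF code_measurable] by auto
  then show ?thesis
    unfolding space_Q unfolding Q_def pr_def using s by (simp add: measure_distr)
qed

text \<open>The \<open>lim\<close> in \<open>shannon_rate\<close> has meaning because Fekete's lemma
  provides convergence; the same lemma bounds the limit by each term.\<close>

lemma shannon_rate_le: "n \<ge> 1 \<Longrightarrow> shannon_rate (Ch l) (Q l) \<le> H l n / real n"
proof -
  have "shannon_rate (Ch l) (Q l) = lim (\<lambda>n. H l n / real n)"
    unfolding shannon_rate_def H_def words_def[symmetric] by (simp add: measure_Q_cylinder)
  then show "n \<ge> 1 \<Longrightarrow> shannon_rate (Ch l) (Q l) \<le> H l n / real n"
    using Fekete_real(2)[of "H l", OF H_nonneg H_subadditive] by simp
qed

end

subsection \<open>Quantized entropies approximate the block entropy\<close>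

text \<open>For M \<ge> 1 this clamps t to the interval from 1/M to M. There ln is Lipschitz with
  constant M, so L1 closeness of densities passes to their logarithms.\<close>

definition cutoff :: "real \<Rightarrow> real \<Rightarrow> real" where
  "cutoff M t = max (1 / M) (min M t)"

lemma cutoff_bounds: "M \<ge> 1 \<Longrightarrow> 1 / M \<le> cutoff M t" "M \<ge> 1 \<Longrightarrow> cutoff M t \<le> M" "M \<ge> 1 \<Longrightarrow> 0 < cutoff M t"
proof -
  assume M: "M \<ge> 1"
  then have "1 / M \<le> 1" "0 < 1 / M" by auto
  then show "1 / M \<le> cutoff M t" "cutoff M t \<le> M" "0 < cutoff M t" using M unfolding cutoff_def by linarith+
qed

lemma cutoff_le: "M \<ge> 1 \<Longrightarrow> t \<ge> 0 \<Longrightarrow> cutoff M t \<le> t + 1"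
proof -
  assume M: "M \<ge> 1" "t \<ge> 0"
  then have "1 / M \<le> 1" by auto
  then show "cutoff M t \<le> t + 1" using M unfolding cutoff_def by linarith
qed

lemma cutoff_nonexpansive: "\<bar>cutoff M s - cutoff M t\<bar> \<le> \<bar>s - t\<bar>"
  unfolding cutoff_def by linarith

lemma cutoff_id: "M \<ge> 1 \<Longrightarrow> cutoff M (cutoff M t) = cutoff M t"
  using cutoff_bounds[of M t] unfolding cutoff_def[of M "cutoff M t"] by linarith

text \<open>Clamping moves t towards 1, because 1/M \<le> 1 \<le> M. The bound serves as the
  dominating function when M tends to infinity.\<close>

lemma abs_ln_cutoff_le:
  assumes M: "M \<ge> 1" and t: "t > 0"
  shows "\<bar>ln (cutoff M t)\<bar> \<le> \<bar>ln t\<bar>"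
proof (cases "t \<ge> 1")
  case True
  have "1 / M \<le> 1" using M by auto
  then have "1 \<le> cutoff M t" "cutoff M t \<le> t" using M True unfolding cutoff_def by linarith+
  then show ?thesis using True by simp
next
  case False
  have "1 / M \<le> 1" using M by auto
  then have "t \<le> cutoff M t" "cutoff M t \<le> 1" using M False unfolding cutoff_def by linarith+
  moreover have "ln t \<le> ln (cutoff M t)" using t calculation by simp
  moreover have "ln (cutoff M t) \<le> 0" using t calculation by simp
  ultimately show ?thesis by linarith
qed

lemma cutoff_tendsto:
  assumes "t \<ge> 0"
  shows "(\<lambda>k. cutoff (real (Suc k)) t) \<longlonglongrightarrow> t"
proof -
  have "(\<lambda>k. max (1 / real (Suc k)) t) \<longlonglongrightarrow> max 0 t"
    by (intro tendsto_max tendsto_const LIMSEQ_Suc[OF lim_const_over_n])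
  moreover have "\<forall>\<^sub>F k in sequentially. max (1 / real (Suc k)) t = cutoff (real (Suc k)) t"
    using eventually_ge_at_top[of "nat \<lceil>t\<rceil>"]
  proof eventually_elim
    case (elim k)
    then have "t \<le> real (Suc k)" by linarith
    then show ?case unfolding cutoff_def by (simp add: min_absorb2)
  qed
  ultimately show ?thesis using assms by (auto intro: Lim_transform_eventually simp: max_absorb2)
qed

lemma ln_diff_le:
  fixes M s t :: real
  assumes "M \<ge> 1" "s \<ge> 1 / M" "t \<ge> 1 / M"
  shows "ln s - ln t \<le> M * \<bar>s - t\<bar>"
proof -
  have "0 < 1 / M" using assms(1) by (intro divide_pos_pos) auto
  then have p: "s > 0" "t > 0" using assms by linarith+
  have "ln s - ln t = ln (s / t)" using p by (simp add: ln_div)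
  also have "\<dots> \<le> s / t - 1" using p by (intro ln_le_minus_one) auto
  also have "\<dots> = (s - t) / t" using p by (simp add: field_simps)
  also have "\<dots> \<le> \<bar>s - t\<bar> / t" using p by (intro divide_right_mono) auto
  also have "\<dots> \<le> \<bar>s - t\<bar> / (1 / M)" using assms p by (intro divide_left_mono) auto
  finally show ?thesis by (simp add: mult.commute)
qed

lemma cutoff_measurable [measurable]: "cutoff M \<in> borel_measurable borel"
  unfolding cutoff_def[abs_def] by measurable

section \<open>Logarithmic cell masses and relative entropy at a fixed level\<close>

context quantized_process begin

text \<open>As a finite sum over cells this is measurable and bounded at every x, also outside
  \<open>space \<mu>\<close>, where \<open>cell\<close> is unspecified;
  \<open>bounded_Birkhoff\<close> asks for a bound at every point.\<close>

definition logm :: "nat \<Rightarrow> 'a \<Rightarrow> real" where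
  "logm l x = (\<Sum>A\<in>Ch l. indicator A x * ln (measure \<mu> A))"

text \<open>The correction that turns the Shannon rate of level l into a rate relative to
  \<mu>.\<close>

definition \<kappa> :: "nat \<Rightarrow> real" where
  "\<kappa> l = (\<integral>\<omega>. logm l (\<omega> 1) \<partial>P)"

lemma logm_measurable [measurable]: "logm l \<in> borel_measurable \<mu>"
  unfolding logm_def[abs_def] using Ch_sets by (intro borel_measurable_sum) auto

lemma logm_eq:
  assumes "x \<in> space \<mu>"
  shows "logm l x = ln (measure \<mu> (cell Ch l x))"
proof -
  have "logm l x = (\<Sum>A\<in>Ch l. if A = cell Ch l x then ln (measure \<mu> A) else 0)"
    unfolding logm_def
  proof (rule sum.cong[OF refl])
    fix A assume "A \<in> Ch l"
    then show "indicator A x * ln (measure \<mu> A) = (if A = cell Ch l x then ln (measure \<mu> A) else 0)"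
      using cell_eq[of A l x] cell_mem[OF assms, of l] by (cases "x \<in> A") auto
  qed
  then show ?thesis using cell_in[OF assms, of l] Ch_finite[of l] by simp
qed

lemma logm_bound: "\<bar>logm l x\<bar> \<le> (\<Sum>A\<in>Ch l. \<bar>ln (measure \<mu> A)\<bar>)"
  unfolding logm_def by (rule order_trans[OF sum_abs]) (intro sum_mono, simp add: indicator_def)

lemma coord_measurable [measurable]: "(\<lambda>\<omega>. \<omega> i) \<in> measurable P \<mu>"
  unfolding measurable_cong_sets[OF sets_P refl] seq_space_def by (rule measurable_component_singleton) simp

text \<open>Blocks start at coordinate 1, so the letter at place 1 + j is the first letter of the
  j-fold shift and the sum is a Birkhoff sum.\<close>

lemma sum_logm: "(\<Sum>i\<in>{1..int n}. logm l (\<omega> i)) = (\<Sum>j<n. logm l (((shift ^^ j) \<omega>) 1))"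
  unfolding funpow_shift
  by (rule sum.reindex_bij_witness[of _ "\<lambda>j. 1 + int j" "\<lambda>i. nat (i - 1)"]) auto

lemma Birkhoff_logm: "AE \<omega> in P. (\<lambda>n. (\<Sum>i\<in>{1..int n}. logm l (\<omega> i)) / real n) \<longlonglongrightarrow> \<kappa> l"
proof -
  have "(\<lambda>\<omega>. logm l (\<omega> 1)) \<in> borel_measurable P"
    by (rule measurable_compose[OF coord_measurable logm_measurable])
  from bounded_Birkhoff[OF prob_space_axioms shift_P shift_pres shift_erg this logm_bound] show ?thesis
    unfolding sum_logm \<kappa>_def .
qed

lemma integrable_logm: "integrable P (\<lambda>\<omega>. logm l (\<omega> i))"
  by (rule integrable_const_bound[of _ "\<Sum>A\<in>Ch l. \<bar>ln (measure \<mu> A)\<bar>"]) (use logm_bound in auto)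

lemma integral_sum_logm: "(\<integral>\<omega>. (\<Sum>i\<in>{1..int n}. logm l (\<omega> i)) \<partial>P) = real n * \<kappa> l"
proof -
  have "(\<integral>\<omega>. logm l (((shift ^^ j) \<omega>) 1) \<partial>P) = \<kappa> l" for j
    unfolding \<kappa>_def by (rule integral_shift) measurable
  moreover have "integrable P (\<lambda>\<omega>. logm l (((shift ^^ j) \<omega>) 1))" for j
    unfolding funpow_shift by (rule integrable_logm)
  ultimately show ?thesis unfolding sum_logm by (simp add: Bochner_Integration.integral_sum)
qed

text \<open>A word through a \<mu>-null cell is a null set for \<open>prodM\<close>, hence has
  P-probability 0 by absolute continuity; there are finitely many words.\<close>

lemma AE_cell_pos: "AE \<omega> in P. \<forall>i\<in>{1..int n}. 0 < measure \<mu> (cell Ch l (\<omega> i))"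
proof -
  have "AE \<omega> in P. \<forall>a\<in>words l n. (\<Prod>i\<in>{1..int n}. emeasure \<mu> (a i)) = 0 \<longrightarrow> cells l n \<omega> \<noteq> a"
  proof (rule AE_finite_allI[OF finite_words])
    fix a assume a: "a \<in> words l n"
    show "AE \<omega> in P. (\<Prod>i\<in>{1..int n}. emeasure \<mu> (a i)) = 0 \<longrightarrow> cells l n \<omega> \<noteq> a"
    proof (cases "(\<Prod>i\<in>{1..int n}. emeasure \<mu> (a i)) = 0")
      case True
      have "cells l n -` {a} \<inter> space (prodM \<mu> n) \<in> sets (prodM \<mu> n)"
        by (rule measurable_sets[OF cells_measurable]) (simp add: a)
      from AE_block[OF this] have "AE \<omega> in P. block n \<omega> \<notin> cells l n -` {a} \<inter> space (prodM \<mu> n)"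
        using emeasure_cells[OF a] True by simp
      then show ?thesis
      proof (rule AE_mp, intro AE_I2 impI)
        fix \<omega> assume "\<omega> \<in> space P" "block n \<omega> \<notin> cells l n -` {a} \<inter> space (prodM \<mu> n)"
        then show "cells l n \<omega> \<noteq> a" using measurable_space[OF block_P[of n]] by auto
      qed
    qed simp
  qed
  then show ?thesis
  proof (rule AE_mp, intro AE_I2 impI ballI)
    fix \<omega> i assume w: "\<omega> \<in> space P" and i: "i \<in> {1..int n}"
      and *: "\<forall>a\<in>words l n. (\<Prod>i\<in>{1..int n}. emeasure \<mu> (a i)) = 0 \<longrightarrow> cells l n \<omega> \<noteq> a"
    then have "(\<Prod>i\<in>{1..int n}. emeasure \<mu> (cells l n \<omega> i)) \<noteq> 0" using cells_in_words[OF w] by blast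
    then have "emeasure \<mu> (cells l n \<omega> i) \<noteq> 0" using i by (auto simp: prod_zero_iff)
    then show "0 < measure \<mu> (cell Ch l (\<omega> i))"
      using i by (simp add: cells_def finite_measure.emeasure_eq_measure[OF partitioned_space.fin[OF partitioned_space_axioms]] zero_less_measure_iff)
  qed
qed

definition mass :: "nat \<Rightarrow> (int \<Rightarrow> 'a set) \<Rightarrow> real" where
  "mass n c = (\<Prod>i\<in>{1..int n}. measure \<mu> (c i))"

lemma mass_nonneg: "0 \<le> mass n c"
  unfolding mass_def by (intro prod_nonneg) auto

lemma AE_mass: "AE \<omega> in P. 0 < mass n (cells l n \<omega>) \<and> ln (mass n (cells l n \<omega>)) = (\<Sum>i\<in>{1..int n}. logm l (\<omega> i))"
  using AE_cell_pos[of n l]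
proof (rule AE_mp, intro AE_I2 impI)
  fix \<omega> assume w: "\<omega> \<in> space P" and pos: "\<forall>i\<in>{1..int n}. 0 < measure \<mu> (cell Ch l (\<omega> i))"
  have m: "mass n (cells l n \<omega>) = (\<Prod>i\<in>{1..int n}. measure \<mu> (cell Ch l (\<omega> i)))"
    unfolding mass_def cells_def by (intro prod.cong) auto
  have "ln (\<Prod>i\<in>{1..int n}. measure \<mu> (cell Ch l (\<omega> i))) = (\<Sum>i\<in>{1..int n}. ln (measure \<mu> (cell Ch l (\<omega> i))))"
  proof (rule ln_prod)
    show "measure \<mu> (cell Ch l (\<omega> i)) \<noteq> 0" if "i \<in> {1..int n}" for i using bspec[OF pos that] by simp
  qed simp
  also have "\<dots> = (\<Sum>i\<in>{1..int n}. logm l (\<omega> i))"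
    using coord_in_space[OF w] by (intro sum.cong) (auto simp: logm_eq)
  finally show "0 < mass n (cells l n \<omega>) \<and> ln (mass n (cells l n \<omega>)) = (\<Sum>i\<in>{1..int n}. logm l (\<omega> i))"
    unfolding m using pos by (auto intro!: prod_pos)
qed

lemma mass_pos:
  assumes "0 < pr l n c"
  shows "0 < mass n c"
proof (rule ccontr)
  assume "\<not> 0 < mass n c"
  have "AE \<omega> in P. cells l n \<omega> \<noteq> c"
    by (rule eventually_mono[OF AE_mass[of n l]]) (use \<open>\<not> 0 < mass n c\<close> in auto)
  then have "pr l n c = 0" unfolding pr_def by (intro prob_eq_0[THEN iffD2]) auto
  then show False using assms by simp
qed

lemma sum_pr_ln_mass: "(\<Sum>c\<in>words l n. pr l n c * ln (mass n c)) = real n * \<kappa> l"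
proof -
  have "(\<Sum>c\<in>words l n. pr l n c * ln (mass n c)) = (\<integral>\<omega>. ln (mass n (cells l n \<omega>)) \<partial>P)"
    by (rule integral_cells[symmetric])
  also have "\<dots> = (\<integral>\<omega>. (\<Sum>i\<in>{1..int n}. logm l (\<omega> i)) \<partial>P)"
    using AE_mass[of n l] by (intro integral_cong_AE borel_measurable_integrable[OF integrable_cells]) auto
  finally show ?thesis by (simp only: integral_sum_logm)
qed

lemma integral_cells_prodM:
  fixes G :: "(int \<Rightarrow> 'a set) \<Rightarrow> real"
  shows "(\<integral>x. G (cells l n x) \<partial>prodM \<mu> n) = (\<Sum>c\<in>words l n. G c * mass n c)"
proof -
  interpret \<mu>: finite_measure \<mu> by (rule partitioned_space.fin[OF partitioned_space_axioms])
  have "measure (prodM \<mu> n) (cells l n -` {c} \<inter> space (prodM \<mu> n)) = mass n c" if "c \<in> words l n" for c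
    unfolding measure_def emeasure_cells[OF that] mass_def
    by (simp add: \<mu>.emeasure_eq_measure prod_ennreal prod_nonneg)
  then show ?thesis
    unfolding integral_finite_range(2)[OF finite_measure_prodM[OF \<mu>.finite_measure_axioms] cells_measurable finite_words] by simp
qed

text \<open>The Donsker--Varadhan variational inequality for the level-\<open>l\<close> relative entropy.\<close>

lemma quantized_variational:
  fixes G :: "(int \<Rightarrow> 'a set) \<Rightarrow> real"
  assumes pos: "\<And>c. 0 < G c"
  shows "H l n + real n * \<kappa> l \<le> (\<integral>x. G (cells l n x) \<partial>prodM \<mu> n) - 1 - (\<integral>\<omega>. ln (G (cells l n \<omega>)) \<partial>P)"
proof -
  have "(\<Sum>c\<in>words l n. pr l n c * ln (G c * mass n c)) - (\<Sum>c\<in>words l n. pr l n c * ln (pr l n c))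
      \<le> (\<Sum>c\<in>words l n. G c * mass n c) - 1"
    by (rule finite_Gibbs) (use pos mass_pos in \<open>auto simp: finite_words pr_nonneg sum_pr mass_nonneg less_imp_le intro!: mult_nonneg_nonneg\<close>)
  moreover have "(\<Sum>c\<in>words l n. pr l n c * ln (G c * mass n c)) = (\<Sum>c\<in>words l n. pr l n c * ln (G c) + pr l n c * ln (mass n c))"
  proof (rule sum.cong[OF refl])
    fix c
    show "pr l n c * ln (G c * mass n c) = pr l n c * ln (G c) + pr l n c * ln (mass n c)"
    proof (cases "pr l n c = 0")
      case False
      then have "0 < mass n c" using pr_nonneg[of l n c] by (intro mass_pos[of l]) linarith
      then show ?thesis using pos[of c] by (simp add: ln_mult distrib_left)
    qed simp
  qed
  moreover have "(\<integral>\<omega>. ln (G (cells l n \<omega>)) \<partial>P) = (\<Sum>c\<in>words l n. pr l n c * ln (G c))"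
    by (rule integral_cells)
  ultimately show ?thesis
    unfolding integral_cells_prodM H_def by (simp add: sum.distrib sum_pr_ln_mass)
qed

text \<open>The variational inequality becomes tight when G is the density of P itself. That density
  is clamped, then replaced by a function of the cells of some level l, and both errors are kept
  below multiples of \<delta>.\<close>

lemma quantization:
  assumes hfin: "\<bar>hmu \<mu> P n\<bar> \<noteq> \<infinity>" and \<delta>: "\<delta> > 0"
  shows "\<exists>l. H l n + real n * \<kappa> l \<le> real_of_ereal (hmu \<mu> P n) + \<delta>"
proof -
  note f = entropy_finite[OF hfin]
  interpret \<mu>: finite_measure \<mu> by (rule partitioned_space.fin[OF partitioned_space_axioms])
  interpret pm: finite_measure "prodM \<mu> n" by (rule finite_measure_prodM[OF \<mu>.finite_measure_axioms])
  define q where "q x = enn2real (p n x)" for x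
  have q_meas [measurable]: "q \<in> borel_measurable (prodM \<mu> n)" unfolding q_def[abs_def] by measurable
  have q_block [measurable]: "(\<lambda>\<omega>. q (block n \<omega>)) \<in> borel_measurable P"
    by (rule measurable_compose[OF block_P q_meas])
  have q0: "0 \<le> q x" for x unfolding q_def by simp
  have p1: "(\<integral>\<^sup>+x. p n x \<partial>prodM \<mu> n) = 1"
    using nn_integral_block[of "\<lambda>_. 1" n] by (simp add: emeasure_space_1)
  then have "AE x in prodM \<mu> n. p n x \<noteq> \<infinity>" by (intro nn_integral_PInf_AE) auto
  then have q1: "(\<integral>\<^sup>+x. ennreal (q x) \<partial>prodM \<mu> n) = 1"
    unfolding p1[symmetric] by (intro nn_integral_cong_AE) (auto elim!: eventually_mono simp: q_def less_top)
  have q_int: "integrable (prodM \<mu> n) q"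
    by (rule integrableI_bounded) (use q1 q0 in auto)
  have q_int1: "(\<integral>x. q x \<partial>prodM \<mu> n) = 1"
    using nn_integral_eq_integral[OF q_int] q1 q0 by (simp add: ennreal_eq_1)
  \<comment> \<open>The two integrals of the variational inequality are taken against different
    measures, so each needs its own limit as the clamping level grows.\<close>
  have lim1: "(\<lambda>k. \<integral>x. cutoff (real (Suc k)) (q x) \<partial>prodM \<mu> n) \<longlonglongrightarrow> (\<integral>x. q x \<partial>prodM \<mu> n)"
  proof (rule integral_dominated_convergence[where w = "\<lambda>x. q x + 1"])
    show "AE x in prodM \<mu> n. norm (cutoff (real (Suc k)) (q x)) \<le> q x + 1" for k
    proof (rule AE_I2)
      fix x
      have "0 < cutoff (real (Suc k)) (q x)" "cutoff (real (Suc k)) (q x) \<le> q x + 1"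
        using cutoff_bounds(3)[of "real (Suc k)"] cutoff_le[of "real (Suc k)" "q x"] q0 by auto
      then show "norm (cutoff (real (Suc k)) (q x)) \<le> q x + 1" by simp
    qed
    show "AE x in prodM \<mu> n. (\<lambda>k. cutoff (real (Suc k)) (q x)) \<longlonglongrightarrow> q x"
      by (intro AE_I2 cutoff_tendsto q0)
  qed (use q_int in auto)
  have qpos: "AE \<omega> in P. 0 < q (block n \<omega>)"
    using f(2) by eventually_elim (auto simp: q_def enn2real_positive_iff)
  have lnq_int: "integrable P (\<lambda>\<omega>. ln (q (block n \<omega>)))"
    using f(1) unfolding q_def by simp
  have lim2: "(\<lambda>k. \<integral>\<omega>. ln (cutoff (real (Suc k)) (q (block n \<omega>))) \<partial>P) \<longlonglongrightarrow> (\<integral>\<omega>. ln (q (block n \<omega>)) \<partial>P)"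
  proof (rule integral_dominated_convergence[where w = "\<lambda>\<omega>. \<bar>ln (q (block n \<omega>))\<bar>"])
    show "AE \<omega> in P. norm (ln (cutoff (real (Suc k)) (q (block n \<omega>)))) \<le> \<bar>ln (q (block n \<omega>))\<bar>" for k
      using qpos
    proof eventually_elim
      case (elim \<omega>)
      then show ?case using abs_ln_cutoff_le[of "real (Suc k)" "q (block n \<omega>)"] by simp
    qed
    show "AE \<omega> in P. (\<lambda>k. ln (cutoff (real (Suc k)) (q (block n \<omega>)))) \<longlonglongrightarrow> ln (q (block n \<omega>))"
      using qpos by eventually_elim (intro tendsto_ln cutoff_tendsto q0, simp)
    show "(\<lambda>\<omega>. ln (cutoff (real (Suc k)) (q (block n \<omega>)))) \<in> borel_measurable P" for k
      using q_block by measurable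
    show "(\<lambda>\<omega>. ln (q (block n \<omega>))) \<in> borel_measurable P" using q_block by measurable
  qed (use lnq_int in auto)
  have "\<forall>\<^sub>F k in sequentially. (\<integral>x. cutoff (real (Suc k)) (q x) \<partial>prodM \<mu> n) < 1 + \<delta> / 4"
    using order_tendstoD(2)[OF lim1, of "1 + \<delta> / 4"] \<delta> q_int1 by simp
  moreover have "\<forall>\<^sub>F k in sequentially. (\<integral>\<omega>. ln (q (block n \<omega>)) \<partial>P) - \<delta> / 4 < (\<integral>\<omega>. ln (cutoff (real (Suc k)) (q (block n \<omega>))) \<partial>P)"
    using order_tendstoD(1)[OF lim2, of "(\<integral>\<omega>. ln (q (block n \<omega>)) \<partial>P) - \<delta> / 4"] \<delta> by simp
  ultimately have "\<forall>\<^sub>F k in sequentially. (\<integral>x. cutoff (real (Suc k)) (q x) \<partial>prodM \<mu> n) < 1 + \<delta> / 4 \<and>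
      (\<integral>\<omega>. ln (q (block n \<omega>)) \<partial>P) - \<delta> / 4 < (\<integral>\<omega>. ln (cutoff (real (Suc k)) (q (block n \<omega>))) \<partial>P)"
    by (rule eventually_conj)
  then obtain k where k: "(\<integral>x. cutoff (real (Suc k)) (q x) \<partial>prodM \<mu> n) < 1 + \<delta> / 4"
      "(\<integral>\<omega>. ln (q (block n \<omega>)) \<partial>P) - \<delta> / 4 < (\<integral>\<omega>. ln (cutoff (real (Suc k)) (q (block n \<omega>))) \<partial>P)"
    unfolding eventually_sequentially by (auto elim!: exE)
  define M where "M = real (Suc k)"
  have M: "M \<ge> 1" unfolding M_def by simp
  have cq_meas [measurable]: "(\<lambda>x. cutoff M (q x)) \<in> borel_measurable (prodM \<mu> n)" by measurable
  \<comment> \<open>Replacing the density costs \<epsilon> in the integral over \<open>prodM\<close>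
    and M \<epsilon> in the logarithmic one, together \<delta>/4. The two clampings cost \<delta>/4
    each, so 3 \<delta>/4 is spent in all.\<close>
  define \<epsilon> where "\<epsilon> = \<delta> / (4 * (M + 1))"
  have "(M + 1) * \<epsilon> = \<delta> / 4" using M by (simp add: \<epsilon>_def field_simps)
  then have \<epsilon>: "\<epsilon> + M * \<epsilon> = \<delta> / 4" by (simp add: algebra_simps)
  have \<epsilon>_pos: "\<epsilon> > 0" using M \<delta> by (simp add: \<epsilon>_def)
  \<comment> \<open>N is the sum of \<open>prodM \<mu> n\<close> and the block law of P, so one
    approximation in L1 of N is an approximation for both.\<close>
  define N where "N = density (prodM \<mu> n) (\<lambda>x. 1 + p n x)"
  have setsN: "sets N = sets (prodM \<mu> n)" unfolding N_def by simp
  have nnN: "(\<integral>\<^sup>+x. u x \<partial>N) = (\<integral>\<^sup>+x. u x \<partial>prodM \<mu> n) + (\<integral>\<^sup>+\<omega>. u (block n \<omega>) \<partial>P)"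
    if [measurable]: "u \<in> borel_measurable (prodM \<mu> n)" for u
  proof -
    have "(\<integral>\<^sup>+x. u x \<partial>N) = (\<integral>\<^sup>+x. u x + p n x * u x \<partial>prodM \<mu> n)"
      unfolding N_def by (subst nn_integral_density) (auto simp: distrib_right)
    also have "\<dots> = (\<integral>\<^sup>+x. u x \<partial>prodM \<mu> n) + (\<integral>\<^sup>+x. p n x * u x \<partial>prodM \<mu> n)"
      by (rule nn_integral_add) measurable
    finally show ?thesis by (simp add: nn_integral_block)
  qed
  have finN: "finite_measure N"
  proof
    have "emeasure N (space N) = (\<integral>\<^sup>+x. 1 \<partial>N)" by simp
    also have "\<dots> = emeasure (prodM \<mu> n) (space (prodM \<mu> n)) + 1"
      by (subst nnN) (auto simp: emeasure_space_1)
    finally show "emeasure N (space N) \<noteq> \<infinity>" using pm.emeasure_finite by simp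
  qed
  interpret N: finite_measure N by (rule finN)
  have cq_N [measurable]: "(\<lambda>x. cutoff M (q x)) \<in> borel_measurable N"
    unfolding measurable_cong_sets[OF setsN refl] by (rule cq_meas)
  have cq_abs: "\<bar>cutoff M t\<bar> \<le> M" for t using cutoff_bounds[OF M, of t] by simp
  have "integrable N (\<lambda>x. cutoff M (q x))"
    by (rule N.integrable_const_bound[of _ M]) (use cq_abs in auto)
  from cells_approx_integrable[OF finN setsN this \<epsilon>_pos]
  obtain l G where lG: "(\<integral>x. \<bar>cutoff M (q x) - G (cells l n x)\<bar> \<partial>N) < \<epsilon>" by blast
  \<comment> \<open>Clamping is nonexpansive and fixes the values of the clamped density, so the
    error does not grow; G' becomes positive, as the variational inequality asks.\<close>
  define G' where "G' c = cutoff M (G c)" for c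
  define u where "u x = \<bar>cutoff M (q x) - G' (cells l n x)\<bar>" for x
  have cellsN [measurable]: "cells l n \<in> measurable N (count_space (words l n))"
    unfolding measurable_cong_sets[OF setsN refl] by (rule cells_measurable)
  have G'_prod: "integrable (prodM \<mu> n) (\<lambda>x. G' (cells l n x))"
    by (rule integral_finite_range(1)[OF pm.finite_measure_axioms cells_measurable finite_words])
  have G_N: "integrable N (\<lambda>x. F (cells l n x))" for F :: "_ \<Rightarrow> real"
    by (rule integral_finite_range(1)[OF finN cellsN finite_words])
  have u_meas [measurable]: "u \<in> borel_measurable (prodM \<mu> n)"
    unfolding u_def[abs_def] using borel_measurable_integrable[OF G'_prod] by measurable
  have u0: "0 \<le> u x" for x unfolding u_def by simp
  have cqN_int: "integrable N (\<lambda>x. cutoff M (q x))" by fact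
  have uN_int: "integrable N u"
    unfolding u_def[abs_def] by (intro integrable_abs Bochner_Integration.integrable_diff cqN_int G_N)
  have "(\<integral>x. u x \<partial>N) \<le> (\<integral>x. \<bar>cutoff M (q x) - G (cells l n x)\<bar> \<partial>N)"
  proof (rule integral_mono[OF uN_int])
    show "integrable N (\<lambda>x. \<bar>cutoff M (q x) - G (cells l n x)\<bar>)"
      by (intro integrable_abs Bochner_Integration.integrable_diff cqN_int G_N)
    fix x
    show "u x \<le> \<bar>cutoff M (q x) - G (cells l n x)\<bar>"
      using cutoff_nonexpansive[of M "cutoff M (q x)" "G (cells l n x)"] unfolding u_def G'_def cutoff_id[OF M] .
  qed
  with lG have "(\<integral>x. u x \<partial>N) < \<epsilon>" by simp
  then have "(\<integral>\<^sup>+x. ennreal (u x) \<partial>N) \<le> ennreal \<epsilon>"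
    using nn_integral_eq_integral[OF uN_int] u0 by (simp add: ennreal_leI less_imp_le)
  then have sum_le: "(\<integral>\<^sup>+x. ennreal (u x) \<partial>prodM \<mu> n) + (\<integral>\<^sup>+\<omega>. ennreal (u (block n \<omega>)) \<partial>P) \<le> ennreal \<epsilon>"
    by (subst (asm) nnN) auto
  have "(\<integral>\<^sup>+x. ennreal (u x) \<partial>prodM \<mu> n) \<le> ennreal \<epsilon>" using sum_le by (rule order_trans[rotated]) simp
  then have u_prod: "(\<integral>x. u x \<partial>prodM \<mu> n) \<le> \<epsilon>"
    using \<epsilon>_pos by (subst integral_eq_nn_integral) (auto simp: u0 intro!: enn2real_leI)
  have ub_meas [measurable]: "(\<lambda>\<omega>. u (block n \<omega>)) \<in> borel_measurable P"
    by (rule measurable_compose[OF block_P u_meas])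
  have "(\<integral>\<^sup>+\<omega>. ennreal (u (block n \<omega>)) \<partial>P) \<le> ennreal \<epsilon>" using sum_le by (rule order_trans[rotated]) simp
  then have u_P: "(\<integral>\<omega>. u (block n \<omega>) \<partial>P) \<le> \<epsilon>"
    using \<epsilon>_pos by (subst integral_eq_nn_integral) (auto simp: u0 intro!: enn2real_leI)
  have cq_prod: "integrable (prodM \<mu> n) (\<lambda>x. cutoff M (q x))"
    by (rule pm.integrable_const_bound[of _ M]) (use cq_abs in auto)
  have G'_b: "1 / M \<le> G' c" "G' c \<le> M" "0 < G' c" for c unfolding G'_def by (rule cutoff_bounds[OF M])+
  have u_bd: "u x \<le> 2 * M" for x
    using cq_abs[of "q x"] cq_abs[of "G (cells l n x)"] unfolding u_def G'_def by linarith
  have u_prod_int: "integrable (prodM \<mu> n) u"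
    by (rule pm.integrable_const_bound[of _ "2 * M"]) (use u0 u_bd in auto)
  have u_P_int: "integrable P (\<lambda>\<omega>. u (block n \<omega>))"
    by (rule integrable_const_bound[of _ "2 * M"]) (use u0 u_bd in auto)
  have "(\<integral>x. G' (cells l n x) \<partial>prodM \<mu> n) \<le> (\<integral>x. cutoff M (q x) + u x \<partial>prodM \<mu> n)"
  proof (rule integral_mono[OF G'_prod Bochner_Integration.integrable_add[OF cq_prod u_prod_int]])
    show "G' (cells l n x) \<le> cutoff M (q x) + u x" for x unfolding u_def by linarith
  qed
  also have "\<dots> = (\<integral>x. cutoff M (q x) \<partial>prodM \<mu> n) + (\<integral>x. u x \<partial>prodM \<mu> n)"
    by (rule Bochner_Integration.integral_add[OF cq_prod u_prod_int])
  finally have A: "(\<integral>x. G' (cells l n x) \<partial>prodM \<mu> n) \<le> 1 + \<delta> / 4 + \<epsilon>"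
    using k(1) u_prod unfolding M_def[symmetric] by linarith
  have lncq_int: "integrable P (\<lambda>\<omega>. ln (cutoff M (q (block n \<omega>))))"
  proof (rule integrable_const_bound[of _ "ln M"])
    show "AE \<omega> in P. norm (ln (cutoff M (q (block n \<omega>)))) \<le> ln M"
    proof (rule AE_I2)
      fix \<omega>
      have "ln (1 / M) \<le> ln (cutoff M (q (block n \<omega>)))" "ln (cutoff M (q (block n \<omega>))) \<le> ln M"
        using cutoff_bounds[OF M, of "q (block n \<omega>)"] M by auto
      then show "norm (ln (cutoff M (q (block n \<omega>)))) \<le> ln M" using M by (simp add: ln_div)
    qed
    show "(\<lambda>\<omega>. ln (cutoff M (q (block n \<omega>)))) \<in> borel_measurable P" using q_block by measurable
  qed
  have lnG'_int: "integrable P (\<lambda>\<omega>. ln (G' (cells l n \<omega>)))" by (rule integrable_cells)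
  have "(\<integral>\<omega>. ln (cutoff M (q (block n \<omega>))) \<partial>P) \<le> (\<integral>\<omega>. ln (G' (cells l n \<omega>)) + M * u (block n \<omega>) \<partial>P)"
  proof (rule integral_mono[OF lncq_int])
    show "integrable P (\<lambda>\<omega>. ln (G' (cells l n \<omega>)) + M * u (block n \<omega>))" using lnG'_int u_P_int by auto
    fix \<omega>
    have "ln (cutoff M (q (block n \<omega>))) - ln (G' (cells l n \<omega>)) \<le> M * u (block n \<omega>)"
      unfolding u_def cells_block by (rule ln_diff_le[OF M cutoff_bounds(1)[OF M] G'_b(1)])
    then show "ln (cutoff M (q (block n \<omega>))) \<le> ln (G' (cells l n \<omega>)) + M * u (block n \<omega>)" by simp
  qed
  also have "\<dots> = (\<integral>\<omega>. ln (G' (cells l n \<omega>)) \<partial>P) + M * (\<integral>\<omega>. u (block n \<omega>) \<partial>P)"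
    using lnG'_int u_P_int by simp
  also have "\<dots> \<le> (\<integral>\<omega>. ln (G' (cells l n \<omega>)) \<partial>P) + M * \<epsilon>"
    using u_P M by (intro add_left_mono mult_left_mono) auto
  finally have B: "(\<integral>\<omega>. ln (q (block n \<omega>)) \<partial>P) - \<delta> / 4 - M * \<epsilon> \<le> (\<integral>\<omega>. ln (G' (cells l n \<omega>)) \<partial>P)"
    using k(2) unfolding M_def[symmetric] by linarith
  have "real_of_ereal (hmu \<mu> P n) = - (\<integral>\<omega>. ln (q (block n \<omega>)) \<partial>P)"
    unfolding f(3) q_def by simp
  then have "H l n + real n * \<kappa> l \<le> real_of_ereal (hmu \<mu> P n) + \<delta>"
    using quantized_variational[of G' l n, OF G'_b(3)] A B \<epsilon> \<delta> by linarith
  then show ?thesis by (rule exI)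
qed

end

subsection \<open>The supermultiplicative envelope\<close>

text \<open>For m \<ge> 1 this is 1/m - 1/(m+1): the partial sums telescope below 1, while
  \<open>- ln (wt m)\<close> grows only logarithmically.\<close>

definition wt :: "nat \<Rightarrow> real" where
  "wt m = 1 / (real m * (real m + 1))"

lemma wt_pos: "m \<ge> 1 \<Longrightarrow> 0 < wt m" and wt_nonneg: "0 \<le> wt m"
  unfolding wt_def by auto

lemma sum_wt: "(\<Sum>m\<in>{1..n}. wt m) \<le> 1"
proof -
  have "(\<Sum>m\<in>{1..n}. wt m) = 1 - 1 / (real n + 1)"
  proof (induction n)
    case (Suc n)
    have "wt (Suc n) = 1 / (real n + 1) - 1 / (real (Suc n) + 1)" by (simp add: wt_def field_simps)
    then show ?case using Suc by simp
  qed simp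
  then show ?thesis by simp
qed

lemma wt_tendsto: "(\<lambda>n. - ln (wt n) / real n) \<longlonglongrightarrow> 0"
proof (rule tendsto_sandwich)
  have b: "0 \<le> - ln (wt n) / real n \<and> - ln (wt n) / real n \<le> 2 * (ln (real n) / real n) + ln 2 / real n"
    if n: "n \<ge> 1" for n
  proof
    have eq: "- ln (wt n) / real n = (ln (real n) + ln (real n + 1)) / real n"
      using n by (simp add: wt_def ln_div ln_mult)
    show "0 \<le> - ln (wt n) / real n" unfolding eq using n by (intro divide_nonneg_nonneg add_nonneg_nonneg) auto
    have "ln (real n + 1) \<le> ln (2 * real n)" using n by (subst ln_le_cancel_iff) auto
    then have "ln (real n) + ln (real n + 1) \<le> 2 * ln (real n) + ln 2" using n by (simp add: ln_mult)
    then have "(ln (real n) + ln (real n + 1)) / real n \<le> (2 * ln (real n) + ln 2) / real n"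
      by (rule divide_right_mono) simp
    then show "- ln (wt n) / real n \<le> 2 * (ln (real n) / real n) + ln 2 / real n"
      unfolding eq by (simp add: add_divide_distrib)
  qed
  show "\<forall>\<^sub>F n in sequentially. 0 \<le> - ln (wt n) / real n"
    "\<forall>\<^sub>F n in sequentially. - ln (wt n) / real n \<le> 2 * (ln (real n) / real n) + ln 2 / real n"
    using eventually_ge_at_top[of 1] by (rule eventually_mono, use b in blast)+
  have "(\<lambda>n. 2 * (ln (real n) / real n) + ln 2 / real n) \<longlonglongrightarrow> 2 * 0 + 0"
    by (intro tendsto_intros lim_ln_over_n lim_const_over_n)
  then show "(\<lambda>n. 2 * (ln (real n) / real n) + ln 2 / real n) \<longlonglongrightarrow> 0" by simp
qed simp

lemma wt_half_tendsto: "(\<lambda>n. ln (wt n / 2) / real n) \<longlonglongrightarrow> 0"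
proof -
  have "(\<lambda>n. - (- ln (wt n) / real n) - ln 2 / real n) \<longlonglongrightarrow> - 0 - 0"
    by (intro tendsto_intros wt_tendsto lim_const_over_n)
  moreover have "\<forall>\<^sub>F n in sequentially. - (- ln (wt n) / real n) - ln 2 / real n = ln (wt n / 2) / real n"
    using eventually_ge_at_top[of 1]
  proof eventually_elim
    case (elim n)
    then show ?case using wt_pos[of n] by (simp add: ln_div diff_divide_distrib)
  qed
  ultimately show ?thesis by (auto intro: Lim_transform_eventually)
qed

text \<open>A subprobability density dominating \<open>q\<close> up to the weights \<^const>\<open>wt\<close> and, in addition, supermultiplicative along orbits up to these weights.\<close>

function envelope :: "(nat \<Rightarrow> (int \<Rightarrow> 'a) \<Rightarrow> real) \<Rightarrow> real \<Rightarrow> nat \<Rightarrow> (int \<Rightarrow> 'a) \<Rightarrow> real" where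
  "envelope q u n \<omega> = (if n = 0 then 1 else
     (\<Sum>m\<in>{1..<n}. wt m * envelope q u m \<omega> * envelope q u (n - m) ((shift ^^ m) \<omega>))
     + wt n * ((q n (block n \<omega>) + 1 / u ^ n) / 2))"
  by auto
termination by (relation "Wellfounded.measure (\<lambda>(q, u, n, \<omega>). n)") auto

declare envelope.simps [simp del]

lemma envelope_0 [simp]: "envelope q u 0 \<omega> = 1"
  by (simp add: envelope.simps)

lemma envelope_rec:
  "n \<ge> 1 \<Longrightarrow> envelope q u n \<omega> = (\<Sum>m\<in>{1..<n}. wt m * envelope q u m \<omega> * envelope q u (n - m) ((shift ^^ m) \<omega>))
     + wt n * ((q n (block n \<omega>) + 1 / u ^ n) / 2)"
  by (subst envelope.simps) simp

context process begin

text \<open>The law of one coordinate is a probability measure absolutely continuous with respect to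
  \<mu>, so \<mu> cannot vanish. This makes the uniform density \<open>1 / u ^ n\<close>
  meaningful.\<close>

lemma total_mass_pos: "0 < measure \<mu> (space \<mu>)"
proof (rule ccontr)
  assume "\<not> 0 < measure \<mu> (space \<mu>)"
  then have "emeasure \<mu> (space \<mu>) = 0"
    using measure_nonneg[of \<mu> "space \<mu>"] by (simp add: finite_measure.emeasure_eq_measure[OF fin] less_le)
  then have "AE \<omega> in P. block 1 \<omega> \<notin> space (prodM \<mu> 1)"
    by (intro AE_block) (auto simp: emeasure_space_prodM[OF fin])
  then have "AE \<omega> in P. False"
    by (rule AE_mp) (use measurable_space[OF block_P[of 1]] in \<open>auto intro!: AE_I2\<close>)
  then show False by simp
qed

end

section \<open>Lower bound for a family of subprobability densities\<close>

locale dominated_family = process \<mu> P for \<mu> :: "'a measure" and P +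
  fixes q :: "nat \<Rightarrow> (int \<Rightarrow> 'a) \<Rightarrow> real" and h :: real
  assumes q_measurable [measurable]: "\<And>n. q n \<in> borel_measurable (prodM \<mu> n)"
    and q_nonneg: "\<And>n x. 0 \<le> q n x"
    and q_mass: "\<And>n. (\<integral>\<^sup>+x. ennreal (q n x) \<partial>prodM \<mu> n) \<le> 1"
    and h_lim: "(\<lambda>n. hmu \<mu> P n / ereal (real n)) \<longlonglongrightarrow> ereal h"
begin

definition u :: real where "u = measure \<mu> (space \<mu>)"

lemma u_pos: "0 < u" unfolding u_def by (rule total_mass_pos)

abbreviation r :: "nat \<Rightarrow> (int \<Rightarrow> 'a) \<Rightarrow> real" where "r \<equiv> envelope q u"

lemma r_pos: "0 < r n \<omega>"
proof (induction n arbitrary: \<omega> rule: less_induct)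
  case (less n)
  show ?case
  proof (cases "n = 0")
    case False
    have "0 \<le> (\<Sum>m\<in>{1..<n}. wt m * r m \<omega> * r (n - m) ((shift ^^ m) \<omega>))"
      by (intro sum_nonneg mult_nonneg_nonneg wt_nonneg less_imp_le less) auto
    moreover have "0 < wt n * ((q n (block n \<omega>) + 1 / u ^ n) / 2)"
      using False u_pos q_nonneg by (intro mult_pos_pos wt_pos) (auto intro: add_nonneg_pos)
    moreover have "r n \<omega> = (\<Sum>m\<in>{1..<n}. wt m * r m \<omega> * r (n - m) ((shift ^^ m) \<omega>))
        + wt n * ((q n (block n \<omega>) + 1 / u ^ n) / 2)"
      using False by (intro envelope_rec) simp
    ultimately show ?thesis by (simp only: add_nonneg_pos)
  qed simp
qed

lemma r_nonneg: "0 \<le> r n \<omega>"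
  using r_pos by (rule less_imp_le)

text \<open>The envelope is evaluated at finite blocks when integrated and at two-sided sequences
  along orbits; this identifies the two uses.\<close>

lemma r_block: "r n (block n \<omega>) = r n \<omega>"
proof (induction n arbitrary: \<omega> rule: less_induct)
  case (less n)
  show ?case
  proof (cases "n = 0")
    case False
    have "r m (block n \<omega>) * r (n - m) ((shift ^^ m) (block n \<omega>)) = r m \<omega> * r (n - m) ((shift ^^ m) \<omega>)"
      if m: "m \<in> {1..<n}" for m
    proof -
      have "r m (block n \<omega>) = r m \<omega>"
        using less[of m "block n \<omega>"] less[of m \<omega>] m by (simp add: block_block)
      moreover have "r (n - m) ((shift ^^ m) (block n \<omega>)) = r (n - m) ((shift ^^ m) \<omega>)"
        using less[of "n - m" "(shift ^^ m) (block n \<omega>)"] less[of "n - m" "(shift ^^ m) \<omega>"] m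
        by (simp add: block_shift_block)
      ultimately show ?thesis by simp
    qed
    then have "(\<Sum>m\<in>{1..<n}. wt m * r m (block n \<omega>) * r (n - m) ((shift ^^ m) (block n \<omega>)))
        = (\<Sum>m\<in>{1..<n}. wt m * r m \<omega> * r (n - m) ((shift ^^ m) \<omega>))"
      by (intro sum.cong refl) (simp only: mult.assoc)
    moreover have "block n (block n \<omega>) = block n \<omega>" by (simp add: block_block)
    ultimately show ?thesis
      using False envelope_rec[of n q u \<omega>] envelope_rec[of n q u "block n \<omega>"] by (simp only: One_nat_def Suc_leI neq0_conv)
  qed simp
qed

lemma r_measurable [measurable]: "r n \<in> borel_measurable (prodM \<mu> n)"
proof (induction n rule: less_induct)
  case (less n)
  show ?case
  proof (cases "n = 0")
    case False
    have "(\<lambda>x. (\<Sum>m\<in>{1..<n}. wt m * r m (block m x) * r (n - m) (block (n - m) ((shift ^^ m) x)))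
        + wt n * ((q n (block n x) + 1 / u ^ n) / 2)) \<in> borel_measurable (prodM \<mu> n)"
    proof (intro borel_measurable_add borel_measurable_sum borel_measurable_times borel_measurable_const borel_measurable_divide)
      fix m assume m: "m \<in> {1..<n}"
      show "(\<lambda>x. r m (block m x)) \<in> borel_measurable (prodM \<mu> n)"
        using m by (intro measurable_compose[OF block_measurable_prodM less]) auto
      show "(\<lambda>x. r (n - m) (block (n - m) ((shift ^^ m) x))) \<in> borel_measurable (prodM \<mu> n)"
        using m by (intro measurable_compose[OF block_shift_measurable_prodM less]) auto
    qed (intro measurable_compose[OF block_measurable_prodM q_measurable], simp)
    then show ?thesis
      unfolding r_block using False by (subst measurable_cong[OF envelope_rec]) auto
  qed simp
qed

text \<open>Induction on n: the cut at m integrates to \<open>wt m\<close> times two smaller masses,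
  hence to at most \<open>wt m\<close>, and the last summand to at most \<open>wt n\<close>. The
  weights add up to at most 1.\<close>

lemma r_mass: "(\<integral>\<^sup>+x. ennreal (r n x) \<partial>prodM \<mu> n) \<le> 1"
proof (induction n rule: less_induct)
  case (less n)
  show ?case
  proof (cases "n = 0")
    case True
    then show ?thesis using emeasure_space_prodM[OF fin, of 0] by simp
  next
    case False
    \<comment> \<open>Each factor is written as a function of its own block, the form that
      \<open>nn_integral_prodM_split\<close> integrates.\<close>
    have conv: "ennreal (r n x) = (\<Sum>m\<in>{1..<n}. ennreal (wt m) * (ennreal (r m (block m x)) * ennreal (r (n - m) (block (n - m) ((shift ^^ m) x)))))
        + ennreal (wt n) * ((ennreal (q n x) + ennreal (1 / u ^ n)) * ennreal (1 / 2))"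
      if x: "x \<in> space (prodM \<mu> n)" for x
    proof -
      have "ennreal (r n x) = ennreal (\<Sum>m\<in>{1..<n}. wt m * (r m x * r (n - m) ((shift ^^ m) x)))
          + ennreal (wt n * ((q n x + 1 / u ^ n) * (1 / 2)))"
        using False x u_pos q_nonneg
        by (subst envelope_rec)
          (auto simp: block_id mult.assoc intro!: ennreal_plus sum_nonneg mult_nonneg_nonneg wt_nonneg r_nonneg add_nonneg_nonneg)
      also have "ennreal (\<Sum>m\<in>{1..<n}. wt m * (r m x * r (n - m) ((shift ^^ m) x)))
          = (\<Sum>m\<in>{1..<n}. ennreal (wt m) * (ennreal (r m x) * ennreal (r (n - m) ((shift ^^ m) x))))"
        by (subst sum_ennreal[symmetric])
          (auto simp: ennreal_mult wt_nonneg r_nonneg intro!: mult_nonneg_nonneg)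
      also have "ennreal (wt n * ((q n x + 1 / u ^ n) * (1 / 2))) = ennreal (wt n) * ((ennreal (q n x) + ennreal (1 / u ^ n)) * ennreal (1 / 2))"
      proof -
        have nn: "0 \<le> q n x" "0 \<le> 1 / u ^ n" using q_nonneg u_pos by auto
        then have "ennreal (wt n * ((q n x + 1 / u ^ n) * (1 / 2))) = ennreal (wt n) * ennreal ((q n x + 1 / u ^ n) * (1 / 2))"
          by (intro ennreal_mult wt_nonneg mult_nonneg_nonneg add_nonneg_nonneg) auto
        moreover have "ennreal ((q n x + 1 / u ^ n) * (1 / 2)) = ennreal (q n x + 1 / u ^ n) * ennreal (1 / 2)"
          using nn by (intro ennreal_mult add_nonneg_nonneg) auto
        moreover have "ennreal (q n x + 1 / u ^ n) = ennreal (q n x) + ennreal (1 / u ^ n)"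
          using nn by (rule ennreal_plus)
        ultimately show ?thesis by (simp only:)
      qed
      finally show ?thesis unfolding r_block .
    qed
    have "(\<integral>\<^sup>+x. ennreal (r n x) \<partial>prodM \<mu> n) =
        (\<integral>\<^sup>+x. (\<Sum>m\<in>{1..<n}. ennreal (wt m) * (ennreal (r m (block m x)) * ennreal (r (n - m) (block (n - m) ((shift ^^ m) x)))))
        + ennreal (wt n) * ((ennreal (q n x) + ennreal (1 / u ^ n)) * ennreal (1 / 2)) \<partial>prodM \<mu> n)"
      by (rule nn_integral_cong[OF conv])
    also have "\<dots> = (\<Sum>m\<in>{1..<n}. ennreal (wt m) * (\<integral>\<^sup>+x. ennreal (r m (block m x)) * ennreal (r (n - m) (block (n - m) ((shift ^^ m) x))) \<partial>prodM \<mu> n))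
        + ennreal (wt n) * (((\<integral>\<^sup>+x. ennreal (q n x) \<partial>prodM \<mu> n) + (\<integral>\<^sup>+x. ennreal (1 / u ^ n) \<partial>prodM \<mu> n)) * ennreal (1 / 2))"
    proof -
      have meas: "(\<lambda>x. ennreal (r m (block m x)) * ennreal (r (n - m) (block (n - m) ((shift ^^ m) x)))) \<in> borel_measurable (prodM \<mu> n)"
        if "m \<in> {1..<n}" for m
        using that
        by (intro borel_measurable_times_ennreal measurable_compose[OF _ measurable_ennreal]
            measurable_compose[OF block_measurable_prodM r_measurable]
            measurable_compose[OF block_shift_measurable_prodM r_measurable]) auto
      have meas': "(\<lambda>x. ennreal (wt m) * (ennreal (r m (block m x)) * ennreal (r (n - m) (block (n - m) ((shift ^^ m) x))))) \<in> borel_measurable (prodM \<mu> n)"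
        if "m \<in> {1..<n}" for m
        by (rule borel_measurable_times_ennreal[OF borel_measurable_const meas[OF that]])
      have "(\<integral>\<^sup>+x. (\<Sum>m\<in>{1..<n}. ennreal (wt m) * (ennreal (r m (block m x)) * ennreal (r (n - m) (block (n - m) ((shift ^^ m) x))))) \<partial>prodM \<mu> n)
          = (\<Sum>m\<in>{1..<n}. (\<integral>\<^sup>+x. ennreal (wt m) * (ennreal (r m (block m x)) * ennreal (r (n - m) (block (n - m) ((shift ^^ m) x)))) \<partial>prodM \<mu> n))"
        by (rule nn_integral_sum) (rule meas')
      also have "\<dots> = (\<Sum>m\<in>{1..<n}. ennreal (wt m) * (\<integral>\<^sup>+x. ennreal (r m (block m x)) * ennreal (r (n - m) (block (n - m) ((shift ^^ m) x))) \<partial>prodM \<mu> n))"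
        by (rule sum.cong[OF refl], rule nn_integral_cmult, rule meas)
      finally have 1: "(\<integral>\<^sup>+x. (\<Sum>m\<in>{1..<n}. ennreal (wt m) * (ennreal (r m (block m x)) * ennreal (r (n - m) (block (n - m) ((shift ^^ m) x))))) \<partial>prodM \<mu> n) = \<dots>" .
      have 2: "(\<integral>\<^sup>+x. ennreal (wt n) * ((ennreal (q n x) + ennreal (1 / u ^ n)) * ennreal (1 / 2)) \<partial>prodM \<mu> n)
          = ennreal (wt n) * (((\<integral>\<^sup>+x. ennreal (q n x) \<partial>prodM \<mu> n) + (\<integral>\<^sup>+x. ennreal (1 / u ^ n) \<partial>prodM \<mu> n)) * ennreal (1 / 2))"
        by (simp add: nn_integral_cmult nn_integral_multc nn_integral_add)
      show ?thesis
        unfolding 1[symmetric] 2[symmetric]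
        by (rule nn_integral_add) (intro borel_measurable_sum meas', simp, measurable)
    qed
    also have "\<dots> \<le> (\<Sum>m\<in>{1..<n}. ennreal (wt m) * 1) + ennreal (wt n) * 1"
    proof (intro add_mono sum_mono mult_left_mono)
      fix m assume m: "m \<in> {1..<n}"
      then have nm: "m + (n - m) = n" by simp
      have "(\<integral>\<^sup>+x. ennreal (r m (block m x)) * ennreal (r (n - m) (block (n - m) ((shift ^^ m) x))) \<partial>prodM \<mu> n)
          = (\<integral>\<^sup>+x. ennreal (r m x) \<partial>prodM \<mu> m) * (\<integral>\<^sup>+x. ennreal (r (n - m) x) \<partial>prodM \<mu> (n - m))"
        using nn_integral_prodM_split[OF fin, of "\<lambda>x. ennreal (r m x)" m "\<lambda>x. ennreal (r (n - m) x)" "n - m"]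
        unfolding nm by auto
      also have "\<dots> \<le> 1 * 1" using less m by (intro mult_mono) auto
      finally show "(\<integral>\<^sup>+x. ennreal (r m (block m x)) * ennreal (r (n - m) (block (n - m) ((shift ^^ m) x))) \<partial>prodM \<mu> n) \<le> 1" by simp
    next
      \<comment> \<open>The total mass of \<open>prodM \<mu> n\<close> is \<open>u ^ n\<close>, so
        the uniform density has mass exactly 1.\<close>
      have "(\<integral>\<^sup>+x. ennreal (1 / u ^ n) \<partial>prodM \<mu> n) = ennreal (1 / u ^ n) * ennreal (u ^ n)"
        using u_pos by (simp add: emeasure_space_prodM[OF fin] finite_measure.emeasure_eq_measure[OF fin] u_def ennreal_power)
      also have "\<dots> = 1" using u_pos by (simp add: ennreal_mult[symmetric])
      finally have "((\<integral>\<^sup>+x. ennreal (q n x) \<partial>prodM \<mu> n) + (\<integral>\<^sup>+x. ennreal (1 / u ^ n) \<partial>prodM \<mu> n)) * ennreal (1 / 2)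
          \<le> (1 + 1) * ennreal (1 / 2)"
        using q_mass[of n] by (intro mult_right_mono add_mono) auto
      also have "(1 + 1) * ennreal (1 / 2) = ennreal 2 * ennreal (1 / 2)" by simp
      also have "\<dots> = ennreal (2 * (1 / 2))" by (rule ennreal_mult[symmetric]) auto
      also have "\<dots> = 1" by simp
      finally show "((\<integral>\<^sup>+x. ennreal (q n x) \<partial>prodM \<mu> n) + (\<integral>\<^sup>+x. ennreal (1 / u ^ n) \<partial>prodM \<mu> n)) * ennreal (1 / 2) \<le> 1" .
    qed auto
    also have "\<dots> = ennreal (\<Sum>m\<in>{1..n}. wt m)"
    proof -
      have "{1..n} = insert n {1..<n}" using False by auto
      then show ?thesis by (simp add: sum_ennreal wt_nonneg ennreal_plus[symmetric] sum_nonneg add.commute del: ennreal_plus)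
    qed
    also have "\<dots> \<le> 1" using sum_wt[of n] by (simp add: ennreal_le_1)
    finally show ?thesis .
  qed
qed

lemma r_super: "m \<ge> 1 \<Longrightarrow> k \<ge> 1 \<Longrightarrow> wt m * r m \<omega> * r k ((shift ^^ m) \<omega>) \<le> r (m + k) \<omega>"
proof -
  assume mk: "m \<ge> 1" "k \<ge> 1"
  have "wt m * r m \<omega> * r (m + k - m) ((shift ^^ m) \<omega>)
      \<le> (\<Sum>i\<in>{1..<m + k}. wt i * r i \<omega> * r (m + k - i) ((shift ^^ i) \<omega>))"
    by (rule member_le_sum) (use mk in \<open>auto intro!: mult_nonneg_nonneg wt_nonneg r_nonneg\<close>)
  also have "\<dots> \<le> r (m + k) \<omega>"
    using mk u_pos q_nonneg by (subst envelope_rec[of "m + k"]) (auto intro!: mult_nonneg_nonneg wt_nonneg add_nonneg_nonneg)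
  finally show ?thesis by simp
qed

lemma r_lower: "n \<ge> 1 \<Longrightarrow> wt n * ((q n (block n \<omega>) + 1 / u ^ n) / 2) \<le> r n \<omega>"
  by (subst envelope_rec) (auto intro!: sum_nonneg mult_nonneg_nonneg wt_nonneg r_nonneg)

definition L :: "nat \<Rightarrow> (int \<Rightarrow> 'a) \<Rightarrow> real" where
  "L n \<omega> = - ln (r n \<omega>)"

lemma L_measurable [measurable]: "L n \<in> borel_measurable P"
proof -
  have "(\<lambda>\<omega>. - ln (r n (block n \<omega>))) \<in> borel_measurable P"
    by (intro borel_measurable_uminus borel_measurable_ln measurable_compose[OF block_P r_measurable])
  then show ?thesis unfolding L_def[abs_def] r_block .
qed

lemma L_subadditive: "m \<ge> 1 \<Longrightarrow> L (m + k) \<omega> \<le> L m \<omega> + L k ((shift ^^ m) \<omega>) + - ln (wt m)"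
proof (cases "k = 0")
  assume m: "m \<ge> 1"
  case True
  \<comment> \<open>For k = 0 there is no cut to use, but \<open>L 0\<close> is 0 and the penalty
    \<open>- ln (wt m)\<close> is nonnegative.\<close>
  have "1 \<le> real m * (real m + 1)" using m mult_mono[of 1 "real m" 1 "real m + 1"] by simp
  then have "wt m \<le> 1" unfolding wt_def by simp
  then have "ln (wt m) \<le> 0" using wt_pos[OF m] by simp
  then show ?thesis using True by (simp add: L_def)
next
  assume m: "m \<ge> 1"
  case False
  have "ln (wt m * r m \<omega> * r k ((shift ^^ m) \<omega>)) \<le> ln (r (m + k) \<omega>)"
    using r_super[of m k \<omega>] m False by (subst ln_le_cancel_iff) (auto intro!: mult_pos_pos wt_pos r_pos)
  also have "ln (wt m * r m \<omega> * r k ((shift ^^ m) \<omega>)) = ln (wt m) + ln (r m \<omega>) + ln (r k ((shift ^^ m) \<omega>))"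
    using wt_pos[OF m] r_pos[of m \<omega>] r_pos[of k "(shift ^^ m) \<omega>"] by (simp add: ln_mult)
  finally show ?thesis unfolding L_def by simp
qed

text \<open>Comes from the uniform half of the last summand. At n = 1 it is the price of a single
  letter; for general n it is the bound B of \<open>Gibbs_block\<close>.\<close>

lemma L_upper: "n \<ge> 1 \<Longrightarrow> L n \<omega> \<le> - ln (wt n * ((1 / u ^ n) / 2))"
proof -
  assume n: "n \<ge> 1"
  have "wt n * ((1 / u ^ n) / 2) \<le> wt n * ((q n (block n \<omega>) + 1 / u ^ n) / 2)"
    using q_nonneg by (intro mult_left_mono wt_nonneg) auto
  then have "wt n * ((1 / u ^ n) / 2) \<le> r n \<omega>" using r_lower[OF n, of \<omega>] by linarith
  moreover have "0 < wt n * ((1 / u ^ n) / 2)" using u_pos wt_pos[OF n] by (intro mult_pos_pos) auto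
  ultimately have "ln (wt n * ((1 / u ^ n) / 2)) \<le> ln (r n \<omega>)" using ln_le_cancel_iff[OF _ r_pos] by blast
  then show ?thesis unfolding L_def by linarith
qed

text \<open>The envelope dominates q up to the factor \<open>wt n / 2\<close>, whose logarithm is
  o(n). Where q vanishes the right side is \<infinity>.\<close>

lemma L_le_neglog: "n \<ge> 1 \<Longrightarrow> ereal (L n \<omega> + ln (wt n / 2)) \<le> neglog (ennreal (q n (block n \<omega>)))"
proof (cases "q n (block n \<omega>) = 0")
  assume n: "n \<ge> 1"
  case False
  then have pos: "q n (block n \<omega>) > 0" using q_nonneg by (simp add: less_le)
  have "wt n / 2 * q n (block n \<omega>) \<le> wt n * ((q n (block n \<omega>) + 1 / u ^ n) / 2)"
    using u_pos wt_nonneg[of n] by (simp add: distrib_left add_divide_distrib)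
  then have "wt n / 2 * q n (block n \<omega>) \<le> r n \<omega>" using r_lower[OF n, of \<omega>] by linarith
  moreover have "0 < wt n / 2 * q n (block n \<omega>)" using pos wt_pos[OF n] by (intro mult_pos_pos) auto
  ultimately have "ln (wt n / 2 * q n (block n \<omega>)) \<le> ln (r n \<omega>)"
    using ln_le_cancel_iff[OF _ r_pos] by blast
  moreover have "ln (wt n / 2 * q n (block n \<omega>)) = ln (wt n / 2) + ln (q n (block n \<omega>))"
    by (rule ln_mult_pos) (use pos wt_pos[OF n] in auto)
  ultimately have "ln (wt n / 2) + ln (q n (block n \<omega>)) \<le> ln (r n \<omega>)" by linarith
  then show ?thesis using pos unfolding neglog_def L_def by simp
qed (simp add: neglog_def)

text \<open>Convergence to a finite limit forces finite block entropies from some n on.\<close>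

lemma hmu_eventually:
  assumes "\<delta> > 0"
  shows "\<forall>\<^sub>F n in sequentially. \<bar>hmu \<mu> P n\<bar> \<noteq> \<infinity> \<and> real n * (h - \<delta>) \<le> real_of_ereal (hmu \<mu> P n)"
proof -
  have "\<forall>\<^sub>F n in sequentially. ereal (h - \<delta>) < hmu \<mu> P n / ereal (real n)"
    "\<forall>\<^sub>F n in sequentially. hmu \<mu> P n / ereal (real n) < ereal (h + \<delta>)"
    using order_tendstoD[OF h_lim] assms by auto
  then show ?thesis
    using eventually_gt_at_top[of 0]
  proof eventually_elim
    case (elim n)
    then show ?case by (cases "hmu \<mu> P n") (auto simp: field_simps)
  qed
qed

lemma L_mean:
  assumes "\<delta> > 0"
  shows "\<forall>\<^sub>F n in sequentially. integrable P (L n) \<and> real n * (h - \<delta>) \<le> (\<integral>\<omega>. L n \<omega> \<partial>P)"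
  using hmu_eventually[OF assms] eventually_ge_at_top[of 1]
proof eventually_elim
  case (elim n)
  have L: "(\<lambda>\<omega>. - ln (r n (block n \<omega>))) = L n" unfolding r_block L_def ..
  have low: "- ln (r n x) \<le> - ln (wt n * ((1 / u ^ n) / 2))" for x
    using L_upper[of n x] elim(2) unfolding L_def .
  have fin: "\<bar>hmu \<mu> P n\<bar> \<noteq> \<infinity>" using elim by simp
  note G = Gibbs_block[OF fin r_measurable r_pos r_mass low, unfolded L]
  have "real_of_ereal (hmu \<mu> P n) \<le> (\<integral>\<omega>. L n \<omega> \<partial>P)"
    using G(2) fin by (cases "hmu \<mu> P n") auto
  then show ?case using G(1) elim(1) by linarith
qed

lemma AE_lower:
  assumes "c < h"
  shows "AE \<omega> in P. \<forall>\<^sub>F n in sequentially. ereal (c * real n) \<le> neglog (ennreal (q n (block n \<omega>)))"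
proof -
  \<comment> \<open>The room between c and d absorbs the loss \<open>ln (wt n / 2)\<close>.\<close>
  define d where "d = (c + h) / 2"
  have d: "c < d" "d < h" using assms unfolding d_def by (auto simp: field_simps)
  have "AE \<omega> in P. \<forall>\<^sub>F n in sequentially. d * real n \<le> L n \<omega>"
  proof (rule ergodic_liminf_bound[where L = L and T = shift and b = "\<lambda>n. - ln (wt n)" and C = "- ln (wt 1 * ((1 / u ^ 1) / 2)) + - ln (wt 1)" and h = h])
    show "L 0 \<omega> = 0" for \<omega> by (simp add: L_def)
    show "L 1 \<omega> + - ln (wt 1) \<le> - ln (wt 1 * ((1 / u ^ 1) / 2)) + - ln (wt 1)" for \<omega>
      using L_upper[of 1 \<omega>] by linarith
  qed (rule prob_space_axioms shift_P shift_pres shift_erg L_measurable L_subadditive wt_tendsto L_mean d(2) | assumption)+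
  then show ?thesis
  proof eventually_elim
    case (elim \<omega>)
    have "\<forall>\<^sub>F n in sequentially. c - d < ln (wt n / 2) / real n"
      using d by (intro order_tendstoD(1)[OF wt_half_tendsto]) auto
    with elim eventually_ge_at_top[of 1] show ?case
    proof eventually_elim
      case (elim n)
      then have "(c - d) * real n \<le> ln (wt n / 2)" by (simp add: field_simps)
      then have "c * real n \<le> L n \<omega> + ln (wt n / 2)" using elim(1) by (simp add: algebra_simps)
      then have "ereal (c * real n) \<le> ereal (L n \<omega> + ln (wt n / 2))" by simp
      then show ?case using L_le_neglog[of n \<omega>] elim(2) by (blast intro: order_trans)
    qed
  qed
qed

text \<open>The bound on means comes from Gibbs' inequality at each large n, not from integrating
  the almost sure bound.\<close>

lemma expect_lower:
  assumes "c < h"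
  shows "\<forall>\<^sub>F n in sequentially. ereal (c * real n) \<le> ereal_expect P (\<lambda>\<omega>. neglog (ennreal (q n (block n \<omega>))))"
proof -
  define d where "d = (h - c) / 2"
  have d: "d > 0" "c = h - d - d" using assms unfolding d_def by (auto simp: field_simps)
  have "\<forall>\<^sub>F n in sequentially. - d < ln (wt n / 2) / real n"
    using d by (intro order_tendstoD(1)[OF wt_half_tendsto]) auto
  with L_mean[OF d(1)] eventually_ge_at_top[of 1] show ?thesis
  proof eventually_elim
    case (elim n)
    then have "- d * real n \<le> ln (wt n / 2)" by (simp add: field_simps)
    moreover have "c * real n = real n * (h - d) + - d * real n" by (subst d(2)) (simp add: algebra_simps)
    ultimately have "c * real n \<le> (\<integral>\<omega>. L n \<omega> \<partial>P) + ln (wt n / 2)" using elim(1) by linarith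
    also have "\<dots> = (\<integral>\<omega>. L n \<omega> + ln (wt n / 2) \<partial>P)" using elim(1) by (simp add: prob_space)
    finally have "ereal (c * real n) \<le> ereal_expect P (\<lambda>\<omega>. ereal (L n \<omega> + ln (wt n / 2)))"
      using elim(1) by (subst ereal_expect_real) auto
    also have "\<dots> \<le> ereal_expect P (\<lambda>\<omega>. neglog (ennreal (q n (block n \<omega>))))"
      by (intro ereal_expect_mono_AE AE_I2 L_le_neglog elim(2))
    finally show ?case .
  qed
qed

end

subsection \<open>The NPD density\<close>

lemma neglog_antimono: "a \<le> b \<Longrightarrow> neglog b \<le> neglog a"
proof (cases "a = 0 \<or> b = \<top>")
  assume ab: "a \<le> b"
  case True
  then show ?thesis by (auto simp: neglog_def)
next
  assume ab: "a \<le> b"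
  case False
  then have *: "a \<noteq> 0" "b \<noteq> \<top>" "a \<noteq> \<top>" "b \<noteq> 0" using ab by (auto simp: top_unique)
  then have "0 < enn2real a" by (simp add: enn2real_positive_iff zero_less_iff_neq_zero less_top)
  moreover have "enn2real a \<le> enn2real b" using ab * by (simp add: enn2real_mono less_top)
  ultimately show ?thesis using * by (simp add: neglog_def)
qed

text \<open>The case c = 0 gives \<infinity> on both sides; c \<le> 1 keeps c finite.\<close>

lemma neglog_weighted_quotient:
  assumes w: "0 < w" and m: "0 < m" and c: "c \<le> 1"
  shows "neglog (ennreal w * (c / ennreal m)) = ereal (- ln w + ln m) + neglog c"
proof (cases "c = 0")
  case False
  then obtain y where y: "c = ennreal y" "0 < y"
    using c by (cases c) (auto simp: top_unique less_le)
  have "ennreal w * (c / ennreal m) = ennreal w * ennreal (y / m)"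
    using m y by (simp add: divide_ennreal)
  also have "\<dots> = ennreal (w * (y / m))"
    using w m y by (intro ennreal_mult[symmetric]) auto
  finally have "ennreal w * (c / ennreal m) = ennreal (w * (y / m))" .
  moreover have "ln (w * (y / m)) = ln w + (ln y - ln m)"
    using w m y by (simp add: ln_mult ln_div)
  ultimately show ?thesis using w m y by (simp add: neglog_def)
qed (simp add: neglog_def)

lemma neglog_measurable [measurable]: "neglog \<in> borel_measurable borel"
  unfolding neglog_def[abs_def] by measurable

lemma ereal_between_rat:
  fixes a :: ereal
  shows "a < ereal x \<Longrightarrow> \<exists>c\<in>\<rat>. a < ereal c \<and> c < x" and "ereal x < a \<Longrightarrow> \<exists>c\<in>\<rat>. ereal c < a \<and> x < c"
proof -
  show "a < ereal x \<Longrightarrow> \<exists>c\<in>\<rat>. a < ereal c \<and> c < x"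
    using Rats_dense_in_real[of "x - 1" x] by (cases a) (auto dest: Rats_dense_in_real)
  show "ereal x < a \<Longrightarrow> \<exists>c\<in>\<rat>. ereal c < a \<and> x < c"
    using Rats_dense_in_real[of x "x + 1"] by (cases a) (auto dest: Rats_dense_in_real)
qed

lemma lower_divide: "ereal (c * real n) \<le> x \<Longrightarrow> n \<ge> 1 \<Longrightarrow> ereal c \<le> x / ereal (real n)"
  by (cases x) (auto simp: field_simps)

section \<open>NPD as a family of subprobability densities\<close>

locale npd_process = quantized_process \<mu> Ch P for \<mu> :: "'a measure" and Ch P +
  fixes R :: "nat \<Rightarrow> (int \<Rightarrow> 'a set) measure" and h :: real
  assumes univ: "\<And>l. universal_alphabet (Ch l) (R l)"
    and h_lim: "(\<lambda>n. hmu \<mu> P n / ereal (real n)) \<longlonglongrightarrow> ereal h"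
begin

lemma finite_mu: "finite_measure \<mu>"
  by (rule partitioned_space.fin[OF partitioned_space_axioms])

definition level_wt :: "nat \<Rightarrow> real" where
  "level_wt l = 1 / (real l + 1) - 1 / (real l + 2)"

lemma level_wt_pos: "0 < level_wt l"
  unfolding level_wt_def by (simp add: frac_less2)

lemma sum_level_wt: "(\<Sum>l<n. level_wt l) \<le> 1"
proof -
  have "(\<Sum>l<n. level_wt l) = 1 - 1 / (real n + 1)"
    by (induction n) (auto simp: level_wt_def add.commute)
  then show ?thesis by simp
qed

definition cell_dens :: "nat \<Rightarrow> nat \<Rightarrow> (int \<Rightarrow> 'a set) \<Rightarrow> ennreal" where
  "cell_dens l n c = cyl_prob (R l) n c / (\<Prod>i\<in>{1..int n}. emeasure \<mu> (c i))"

lemma npd_l_eq: "npd_l \<mu> Ch R l n \<omega> = cell_dens l n (cells l n \<omega>)"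
proof -
  have "cyl_prob (R l) n (\<lambda>i. cell Ch l (\<omega> i)) = cyl_prob (R l) n (cells l n \<omega>)"
    unfolding cyl_prob_def cells_def by (rule arg_cong[where f = "emeasure (R l)"]) auto
  moreover have "(\<Prod>i\<in>{1..int n}. emeasure \<mu> (cell Ch l (\<omega> i))) = (\<Prod>i\<in>{1..int n}. emeasure \<mu> (cells l n \<omega> i))"
    unfolding cells_def by (intro prod.cong) auto
  ultimately show ?thesis unfolding npd_l_def cell_dens_def by simp
qed

lemma npd_eq: "npd \<mu> Ch R n \<omega> = (\<Sum>l. ennreal (level_wt l) * cell_dens l n (cells l n \<omega>))"
  unfolding npd_def npd_l_eq level_wt_def ..

lemma npd_block: "npd \<mu> Ch R n (block n \<omega>) = npd \<mu> Ch R n \<omega>"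
  unfolding npd_eq by simp

lemma cell_dens_measurable [measurable]: "(\<lambda>x. cell_dens l n (cells l n x)) \<in> borel_measurable (prodM \<mu> n)"
  by (rule measurable_compose[OF cells_measurable]) simp

lemma npd_measurable [measurable]: "npd \<mu> Ch R n \<in> borel_measurable (prodM \<mu> n)"
proof -
  have "(\<lambda>\<omega>. \<Sum>l. ennreal (level_wt l) * cell_dens l n (cells l n \<omega>)) \<in> borel_measurable (prodM \<mu> n)" by measurable
  then show ?thesis unfolding npd_eq[symmetric] .
qed

lemma npd_measurable_P [measurable]: "npd \<mu> Ch R n \<in> borel_measurable P"
  using measurable_compose[OF block_P npd_measurable] unfolding npd_block .

lemma sets_R: "sets (R l) = sets (seq_space (count_space (Ch l)))" and prob_R: "prob_space (R l)"
  using univ unfolding universal_alphabet_def by auto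

lemma cylinder_sets: "{\<omega> \<in> space (R l). \<forall>i\<in>{1..int n}. \<omega> i = a i} \<in> sets (R l)"
proof -
  have "{\<omega> \<in> space (seq_space (count_space (Ch l))). \<forall>i\<in>{1..int n}. \<omega> i = a i} \<in> sets (seq_space (count_space (Ch l)))"
    unfolding seq_space_def by measurable
  then show ?thesis by (simp only: sets_R sets_eq_imp_space_eq[OF sets_R])
qed

lemma cyl_prob_le_1: "cyl_prob (R l) n c \<le> 1"
  unfolding cyl_prob_def by (rule prob_space.measure_le_1[OF prob_R])

lemma sum_cyl_prob: "(\<Sum>c\<in>words l n. cyl_prob (R l) n c) \<le> 1"
proof -
  have "disjoint_family_on (\<lambda>c. {\<omega> \<in> space (R l). \<forall>i\<in>{1..int n}. \<omega> i = c i}) (words l n)"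
    unfolding disjoint_family_on_def
  proof (intro ballI impI)
    fix c d assume c: "c \<in> words l n" "d \<in> words l n" "c \<noteq> d"
    then obtain i where "i \<in> {1..int n}" "c i \<noteq> d i"
      using extensionalityI[of c "{1..int n}" d] unfolding words_def PiE_def by blast
    then show "{\<omega> \<in> space (R l). \<forall>i\<in>{1..int n}. \<omega> i = c i} \<inter> {\<omega> \<in> space (R l). \<forall>i\<in>{1..int n}. \<omega> i = d i} = {}"
      by force
  qed
  then have "(\<Sum>c\<in>words l n. cyl_prob (R l) n c) = emeasure (R l) (\<Union>c\<in>words l n. {\<omega> \<in> space (R l). \<forall>i\<in>{1..int n}. \<omega> i = c i})"
    unfolding cyl_prob_def by (intro sum_emeasure finite_words) (use cylinder_sets in auto)
  also have "\<dots> \<le> 1" by (rule prob_space.measure_le_1[OF prob_R])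
  finally show ?thesis .
qed

text \<open>Mass can be lost: \<open>R l\<close> may charge words through \<mu>-null cells, and such
  words contribute 0 to the integral.\<close>

lemma cell_dens_mass: "(\<integral>\<^sup>+x. cell_dens l n (cells l n x) \<partial>prodM \<mu> n) \<le> 1"
proof -
  have "(\<integral>\<^sup>+x. cell_dens l n (cells l n x) \<partial>prodM \<mu> n) = (\<Sum>c\<in>words l n. cell_dens l n c * (\<Prod>i\<in>{1..int n}. emeasure \<mu> (c i)))"
    by (simp add: nn_integral_finite_range[OF cells_measurable finite_words] emeasure_cells)
  also have "\<dots> \<le> (\<Sum>c\<in>words l n. cyl_prob (R l) n c)"
    unfolding cell_dens_def by (subst mult.commute) (intro sum_mono ennreal_mult_divide_le)
  also have "\<dots> \<le> 1" by (rule sum_cyl_prob)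
  finally show ?thesis .
qed

lemma npd_mass: "(\<integral>\<^sup>+x. npd \<mu> Ch R n x \<partial>prodM \<mu> n) \<le> 1"
proof -
  have "(\<integral>\<^sup>+x. npd \<mu> Ch R n x \<partial>prodM \<mu> n) = (\<Sum>l. ennreal (level_wt l) * (\<integral>\<^sup>+x. cell_dens l n (cells l n x) \<partial>prodM \<mu> n))"
    unfolding npd_eq by (subst nn_integral_suminf) (auto simp: nn_integral_cmult)
  also have "\<dots> \<le> 1"
  proof (rule suminf_le_const[OF summableI])
    fix k
    have "(\<Sum>l<k. ennreal (level_wt l) * (\<integral>\<^sup>+x. cell_dens l n (cells l n x) \<partial>prodM \<mu> n)) \<le> (\<Sum>l<k. ennreal (level_wt l) * 1)"
      by (intro sum_mono mult_left_mono cell_dens_mass) simp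
    also have "\<dots> = ennreal (\<Sum>l<k. level_wt l)" using level_wt_pos by (simp add: less_imp_le)
    also have "\<dots> \<le> 1" using sum_level_wt[of k] by (simp add: ennreal_le_1)
    finally show "(\<Sum>l<k. ennreal (level_wt l) * (\<integral>\<^sup>+x. cell_dens l n (cells l n x) \<partial>prodM \<mu> n)) \<le> 1" .
  qed
  finally show ?thesis .
qed

text \<open>Infinite values become 0 here, which can only lower the mass; they are shown to have
  probability zero under P.\<close>

definition npd_real :: "nat \<Rightarrow> (int \<Rightarrow> 'a) \<Rightarrow> real" where
  "npd_real n x = enn2real (npd \<mu> Ch R n x)"

sublocale dom: dominated_family \<mu> P npd_real h
proof
  show "npd_real n \<in> borel_measurable (prodM \<mu> n)" for n unfolding npd_real_def[abs_def] by measurable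
  show "0 \<le> npd_real n x" for n x unfolding npd_real_def by simp
  have "(\<integral>\<^sup>+x. ennreal (npd_real n x) \<partial>prodM \<mu> n) \<le> (\<integral>\<^sup>+x. npd \<mu> Ch R n x \<partial>prodM \<mu> n)" for n
    unfolding npd_real_def by (intro nn_integral_mono) (simp add: ennreal_enn2real_if)
  then show "(\<integral>\<^sup>+x. ennreal (npd_real n x) \<partial>prodM \<mu> n) \<le> 1" for n
    using npd_mass order_trans by blast
  show "(\<lambda>n. hmu \<mu> P n / ereal (real n)) \<longlonglongrightarrow> ereal h" by (rule h_lim)
qed

text \<open>A finite integral makes the density finite almost everywhere for \<open>prodM\<close>,
  and absolute continuity transfers this to P.\<close>

lemma AE_npd_real: "AE \<omega> in P. \<forall>n. neglog (ennreal (npd_real n (block n \<omega>))) = neglog (npd \<mu> Ch R n \<omega>)"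
proof (subst AE_all_countable, rule allI)
  fix n
  have "(\<integral>\<^sup>+x. npd \<mu> Ch R n x \<partial>prodM \<mu> n) \<noteq> \<infinity>" using npd_mass[of n] by (auto simp: top_unique)
  then have "AE x in prodM \<mu> n. npd \<mu> Ch R n x \<noteq> \<infinity>" by (intro nn_integral_PInf_AE npd_measurable)
  then have "emeasure (prodM \<mu> n) {x \<in> space (prodM \<mu> n). npd \<mu> Ch R n x = \<infinity>} = 0"
    by (subst (asm) AE_iff_measurable[OF _ refl]) auto
  then have "AE \<omega> in P. block n \<omega> \<notin> {x \<in> space (prodM \<mu> n). npd \<mu> Ch R n x = \<infinity>}"
    by (intro AE_block) measurable
  then show "AE \<omega> in P. neglog (ennreal (npd_real n (block n \<omega>))) = neglog (npd \<mu> Ch R n \<omega>)"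
  proof (rule AE_mp, intro AE_I2 impI)
    fix \<omega> assume "\<omega> \<in> space P" "block n \<omega> \<notin> {x \<in> space (prodM \<mu> n). npd \<mu> Ch R n x = \<infinity>}"
    then have "npd \<mu> Ch R n \<omega> \<noteq> \<infinity>" using measurable_space[OF block_P[of n]] by (auto simp: npd_block)
    then show "neglog (ennreal (npd_real n (block n \<omega>))) = neglog (npd \<mu> Ch R n \<omega>)"
      unfolding npd_real_def npd_block by (simp add: less_top)
  qed
qed

section \<open>Upper bounds through a fixed quantization level\<close>

definition rate :: "nat \<Rightarrow> real" where
  "rate l = shannon_rate (Ch l) (Q l) + \<kappa> l"

text \<open>First n is chosen so that the block entropy per letter is close to h, then l so that
  this n-block is well quantized; Fekete's bound carries the n-block value over to the rate.\<close>

lemma rate_le: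
  assumes "h < c"
  shows "\<exists>l. rate l < c"
proof -
  \<comment> \<open>One third is spent on the choice of n, one on the choice of l, and the last
    keeps the inequality strict.\<close>
  define d where "d = (c - h) / 3"
  have d: "d > 0" "h + d + d < c" using assms unfolding d_def by (auto simp: field_simps)
  have "\<forall>\<^sub>F n in sequentially. hmu \<mu> P n / ereal (real n) < ereal (h + d)"
    using order_tendstoD(2)[OF h_lim, of "ereal (h + d)"] d by simp
  then have "\<forall>\<^sub>F n in sequentially. n \<ge> 1 \<and> \<bar>hmu \<mu> P n\<bar> \<noteq> \<infinity> \<and> real_of_ereal (hmu \<mu> P n) \<le> real n * (h + d)"
    using dom.hmu_eventually[OF d(1)] eventually_ge_at_top[of 1]
  proof eventually_elim
    case (elim n)
    then show ?case by (cases "hmu \<mu> P n") (auto simp: field_simps)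
  qed
  then obtain n where n: "n \<ge> 1" "\<bar>hmu \<mu> P n\<bar> \<noteq> \<infinity>" "real_of_ereal (hmu \<mu> P n) \<le> real n * (h + d)"
    unfolding eventually_sequentially by (meson order_refl)
  obtain l where l: "H l n + real n * \<kappa> l \<le> real_of_ereal (hmu \<mu> P n) + d"
    using quantization[OF n(2) d(1)] by blast
  have "real n * rate l \<le> H l n + real n * \<kappa> l"
  proof -
    have "real n * shannon_rate (Ch l) (Q l) \<le> H l n"
      using shannon_rate_le[OF n(1), of l] n(1) by (simp add: pos_le_divide_eq mult.commute)
    then show ?thesis unfolding rate_def by (simp add: distrib_left)
  qed
  also have "\<dots> \<le> real n * (h + d) + real n * d"
  proof -
    have "d \<le> real n * d" using n(1) d(1) by simp
    then show ?thesis using l n(3) by linarith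
  qed
  finally have "real n * rate l \<le> real n * (h + d + d)" by (simp only: distrib_left)
  then have "rate l \<le> h + d + d" using n(1) by simp
  then show ?thesis using d by (intro exI[of _ l]) simp
qed

text \<open>One summand of the mixture is kept. Its weight does not depend on n and disappears after
  division by n.\<close>

lemma AE_upper_pointwise:
  "AE \<omega> in P. \<forall>n. neglog (npd \<mu> Ch R n \<omega>)
      \<le> ereal (- ln (level_wt l) + (\<Sum>i\<in>{1..int n}. logm l (\<omega> i))) + neglog (cyl_prob (R l) n (code l \<omega>))"
proof (subst AE_all_countable, rule allI)
  fix n
  show "AE \<omega> in P. neglog (npd \<mu> Ch R n \<omega>)
      \<le> ereal (- ln (level_wt l) + (\<Sum>i\<in>{1..int n}. logm l (\<omega> i))) + neglog (cyl_prob (R l) n (code l \<omega>))"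
    using AE_mass[of n l]
  proof eventually_elim
    case (elim \<omega>)
    have "ennreal (level_wt l) * npd_l \<mu> Ch R l n \<omega> \<le> npd \<mu> Ch R n \<omega>"
      unfolding npd_def level_wt_def using sum_le_suminf[OF summableI, of "{l}" "\<lambda>l. ennreal (1 / (real l + 1) - 1 / (real l + 2)) * npd_l \<mu> Ch R l n \<omega>"]
      by simp
    then have "neglog (npd \<mu> Ch R n \<omega>) \<le> neglog (ennreal (level_wt l) * npd_l \<mu> Ch R l n \<omega>)" by (rule neglog_antimono)
    also have "npd_l \<mu> Ch R l n \<omega> = cyl_prob (R l) n (code l \<omega>) / ennreal (mass n (cells l n \<omega>))"
    proof -
      have "(\<Prod>i\<in>{1..int n}. emeasure \<mu> (cell Ch l (\<omega> i))) = ennreal (mass n (cells l n \<omega>))"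
        unfolding mass_def cells_def
        by (simp add: finite_measure.emeasure_eq_measure[OF finite_mu] prod_ennreal)
      then show ?thesis unfolding npd_l_def code_def by simp
    qed
    also have "neglog (ennreal (level_wt l) * (cyl_prob (R l) n (code l \<omega>) / ennreal (mass n (cells l n \<omega>))))
        = ereal (- ln (level_wt l) + ln (mass n (cells l n \<omega>))) + neglog (cyl_prob (R l) n (code l \<omega>))"
      using elim by (intro neglog_weighted_quotient level_wt_pos cyl_prob_le_1) simp
    finally show ?case using elim by simp
  qed
qed

lemma universal_Q: "universal_conv (Q l) (\<lambda>n \<omega>. neglog (cyl_prob (R l) n \<omega>)) (shannon_rate (Ch l) (Q l))"
  using univ[of l] stationary_ergodic_Q[of l] unfolding universal_alphabet_def by blast

lemma AE_code: "AE \<omega> in P. (\<lambda>n. neglog (cyl_prob (R l) n (code l \<omega>)) / ereal (real n)) \<longlonglongrightarrow> ereal (shannon_rate (Ch l) (Q l))"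
proof -
  have "AE \<omega> in Q l. (\<lambda>n. neglog (cyl_prob (R l) n \<omega>) / ereal (real n)) \<longlonglongrightarrow> ereal (shannon_rate (Ch l) (Q l))"
    using universal_Q unfolding universal_conv_def by simp
  then show ?thesis unfolding Q_def by (rule AE_distrD[OF code_measurable])
qed

text \<open>The cylinder probability reads only the letters at 1..n, which range over a finite set
  of words.\<close>

lemma cyl_prob_measurable [measurable]: "(\<lambda>a. cyl_prob (R l) n a) \<in> borel_measurable (seq_space (count_space (Ch l)))"
proof -
  have "(\<lambda>a. restrict a {1..int n}) \<in> measurable (seq_space (count_space (Ch l))) (PiM {1..int n} (\<lambda>_. count_space (Ch l)))"
    unfolding seq_space_def by (rule measurable_restrict_subset) auto
  moreover have "PiM {1..int n} (\<lambda>_. count_space (Ch l)) = count_space (words l n)"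
    unfolding words_def by (rule count_space_PiM_finite) (auto intro: countable_finite Ch_finite)
  ultimately have "(\<lambda>a. restrict a {1..int n}) \<in> measurable (seq_space (count_space (Ch l))) (count_space (words l n))"
    by (simp only:)
  moreover have "cyl_prob (R l) n \<in> borel_measurable (count_space (words l n))" by simp
  ultimately have "(\<lambda>a. cyl_prob (R l) n (restrict a {1..int n})) \<in> borel_measurable (seq_space (count_space (Ch l)))"
    by (rule measurable_compose)
  moreover have "cyl_prob (R l) n (restrict a {1..int n}) = cyl_prob (R l) n a" for a
    unfolding cyl_prob_def by (rule arg_cong[where f = "emeasure (R l)"]) auto
  ultimately show ?thesis by simp
qed

lemma expect_code: "(\<lambda>n. ereal_expect P (\<lambda>\<omega>. neglog (cyl_prob (R l) n (code l \<omega>))) / ereal (real n)) \<longlonglongrightarrow> ereal (shannon_rate (Ch l) (Q l))"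
proof -
  have "ereal_expect (Q l) (\<lambda>\<omega>. neglog (cyl_prob (R l) n \<omega>)) = ereal_expect P (\<lambda>\<omega>. neglog (cyl_prob (R l) n (code l \<omega>)))" for n
    unfolding Q_def by (rule ereal_expect_distr[OF code_measurable]) measurable
  then show ?thesis using universal_Q[of l] unfolding universal_conv_def by simp
qed

lemma AE_upper:
  assumes "h < c"
  shows "AE \<omega> in P. \<forall>\<^sub>F n in sequentially. neglog (npd \<mu> Ch R n \<omega>) / ereal (real n) < ereal c"
proof -
  obtain l where l: "rate l < c" using rate_le[OF assms] by blast
  show ?thesis
    using AE_upper_pointwise[of l] AE_code[of l] Birkhoff_logm[of l]
  proof eventually_elim
    case (elim \<omega>)
    define A where "A n = - ln (level_wt l) + (\<Sum>i\<in>{1..int n}. logm l (\<omega> i))" for n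
    have "(\<lambda>n. - ln (level_wt l) / real n + (\<Sum>i\<in>{1..int n}. logm l (\<omega> i)) / real n) \<longlonglongrightarrow> 0 + \<kappa> l"
      by (intro tendsto_add elim(3) lim_const_over_n)
    then have "(\<lambda>n. A n / real n) \<longlonglongrightarrow> \<kappa> l" unfolding A_def by (simp add: add_divide_distrib diff_divide_distrib)
    then have "(\<lambda>n. ereal (A n / real n) + neglog (cyl_prob (R l) n (code l \<omega>)) / ereal (real n))
        \<longlonglongrightarrow> ereal (\<kappa> l) + ereal (shannon_rate (Ch l) (Q l))"
      by (intro tendsto_add_ereal elim(2)) auto
    then have "\<forall>\<^sub>F n in sequentially. ereal (A n / real n) + neglog (cyl_prob (R l) n (code l \<omega>)) / ereal (real n) < ereal c"
      using l by (intro order_tendstoD(2)) (auto simp: rate_def)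
    then show ?case
      using eventually_ge_at_top[of 1]
    proof eventually_elim
      case (elim n)
      have "neglog (npd \<mu> Ch R n \<omega>) / ereal (real n) \<le> (ereal (A n) + neglog (cyl_prob (R l) n (code l \<omega>))) / ereal (real n)"
        using \<open>\<forall>n. neglog (npd \<mu> Ch R n \<omega>) \<le> _\<close> elim(2) unfolding A_def by (intro ereal_divide_right_mono) auto
      also have "\<dots> = ereal (A n / real n) + neglog (cyl_prob (R l) n (code l \<omega>)) / ereal (real n)"
        using elim(2) by (cases "neglog (cyl_prob (R l) n (code l \<omega>))") (auto simp: add_divide_distrib)
      finally show ?case using elim(1) by simp
    qed
  qed
qed

lemma expect_upper:
  assumes "h < c"
  shows "\<forall>\<^sub>F n in sequentially. ereal_expect P (\<lambda>\<omega>. neglog (npd \<mu> Ch R n \<omega>)) / ereal (real n) < ereal c"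
proof -
  obtain l where l: "rate l < c" using rate_le[OF assms] by blast
  define d where "d = (c - rate l) / 2"
  have d: "d > 0" "rate l + d + d = c" using l unfolding d_def by auto
  define s where "s = shannon_rate (Ch l) (Q l)"
  define e where "e n = ereal_expect P (\<lambda>\<omega>. neglog (cyl_prob (R l) n (code l \<omega>)))" for n
  have "\<forall>\<^sub>F n in sequentially. ereal (s - d) < e n / ereal (real n)" "\<forall>\<^sub>F n in sequentially. e n / ereal (real n) < ereal (s + d)"
    using order_tendstoD[OF expect_code[of l]] d unfolding e_def s_def by auto
  moreover have "\<forall>\<^sub>F n in sequentially. - ln (level_wt l) / real n < d"
    by (rule order_tendstoD(2)[OF lim_const_over_n d(1)])
  ultimately show ?thesis
    using eventually_ge_at_top[of 1]
  proof eventually_elim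
    case (elim n)
    \<comment> \<open>Convergence to a finite rate makes the expected code length finite for large
      n, so it can be added to the integrals of \<open>logm\<close>.\<close>
    have fin: "\<bar>e n\<bar> \<noteq> \<infinity>" using elim by (cases "e n") auto
    have [measurable]: "(\<lambda>\<omega>. neglog (cyl_prob (R l) n (code l \<omega>))) \<in> borel_measurable P"
      by (rule measurable_compose[OF code_measurable]) measurable
    define Z where "Z \<omega> = real_of_ereal (neglog (cyl_prob (R l) n (code l \<omega>)))" for \<omega>
    have Z: "integrable P Z" "AE \<omega> in P. neglog (cyl_prob (R l) n (code l \<omega>)) = ereal (Z \<omega>)" "e n = ereal (\<integral>\<omega>. Z \<omega> \<partial>P)"
      using ereal_expect_finite[of "\<lambda>\<omega>. neglog (cyl_prob (R l) n (code l \<omega>))" P] fin unfolding e_def Z_def by auto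
    define S where "S \<omega> = (\<Sum>i\<in>{1..int n}. logm l (\<omega> i))" for \<omega>
    have S: "integrable P S" unfolding S_def[abs_def] by (intro Bochner_Integration.integrable_sum integrable_logm)
    have S_int: "(\<integral>\<omega>. S \<omega> \<partial>P) = real n * \<kappa> l" unfolding S_def by (rule integral_sum_logm)
    have "ereal_expect P (\<lambda>\<omega>. neglog (npd \<mu> Ch R n \<omega>)) \<le> ereal_expect P (\<lambda>\<omega>. ereal (- ln (level_wt l) + S \<omega> + Z \<omega>))"
    proof (rule ereal_expect_mono_AE)
      show "AE \<omega> in P. neglog (npd \<mu> Ch R n \<omega>) \<le> ereal (- ln (level_wt l) + S \<omega> + Z \<omega>)"
        using AE_upper_pointwise[of l] Z(2)
      proof eventually_elim
        case (elim \<omega>)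
        have "neglog (npd \<mu> Ch R n \<omega>) \<le> ereal (- ln (level_wt l) + S \<omega>) + neglog (cyl_prob (R l) n (code l \<omega>))"
          using elim(1) unfolding S_def by blast
        then show ?case unfolding elim(2) by simp
      qed
    qed
    also have "\<dots> = ereal (- ln (level_wt l) + real n * \<kappa> l + (\<integral>\<omega>. Z \<omega> \<partial>P))"
      using S Z(1) by (subst ereal_expect_real) (auto simp: prob_space S_int)
    finally have "ereal_expect P (\<lambda>\<omega>. neglog (npd \<mu> Ch R n \<omega>)) / ereal (real n)
        \<le> ereal (- ln (level_wt l) + real n * \<kappa> l + (\<integral>\<omega>. Z \<omega> \<partial>P)) / ereal (real n)"
      using elim(4) by (intro ereal_divide_right_mono) auto
    also have "\<dots> = ereal (- ln (level_wt l) / real n + \<kappa> l + (\<integral>\<omega>. Z \<omega> \<partial>P) / real n)"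
      using elim(4) by (simp add: add_divide_distrib diff_divide_distrib)
    also have "\<dots> < ereal c"
    proof -
      have "(\<integral>\<omega>. Z \<omega> \<partial>P) / real n < s + d" using elim(2,4) unfolding Z(3) by simp
      then show ?thesis using elim(3) d(2) unfolding rate_def s_def by simp
    qed
    finally show ?case .
  qed
qed

lemma universal_npd: "universal_conv P (\<lambda>n \<omega>. neglog (npd \<mu> Ch R n \<omega>)) h"
proof (rule universal_convI[OF prob_space_axioms])
  show "(\<lambda>\<omega>. neglog (npd \<mu> Ch R n \<omega>)) \<in> borel_measurable P" for n by measurable
next
  \<comment> \<open>As in Birkhoff's theorem, rational thresholds leave countably many null
    sets.\<close>
  have "AE \<omega> in P. \<forall>c\<in>\<rat>. c < h \<longrightarrow> (\<forall>\<^sub>F n in sequentially. ereal (c * real n) \<le> neglog (ennreal (npd_real n (block n \<omega>))))"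
    using dom.AE_lower by (subst AE_ball_countable[OF countable_rat]) simp
  moreover have "AE \<omega> in P. \<forall>c\<in>\<rat>. h < c \<longrightarrow> (\<forall>\<^sub>F n in sequentially. neglog (npd \<mu> Ch R n \<omega>) / ereal (real n) < ereal c)"
    using AE_upper by (subst AE_ball_countable[OF countable_rat]) simp
  ultimately show "AE \<omega> in P. (\<lambda>n. neglog (npd \<mu> Ch R n \<omega>) / ereal (real n)) \<longlonglongrightarrow> ereal h"
    using AE_npd_real
  proof eventually_elim
    case (elim \<omega>)
    show ?case
    proof (rule order_tendstoI)
      fix a assume "a < ereal h"
      then obtain c where c: "c \<in> \<rat>" "a < ereal c" "c < h" using ereal_between_rat(1) by blast
      then have "\<forall>\<^sub>F n in sequentially. ereal (c * real n) \<le> neglog (npd \<mu> Ch R n \<omega>)" using elim(1,3) by simp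
      then show "\<forall>\<^sub>F n in sequentially. a < neglog (npd \<mu> Ch R n \<omega>) / ereal (real n)"
        using eventually_ge_at_top[of 1]
        by eventually_elim (use c(2) lower_divide in \<open>blast intro: less_le_trans\<close>)
    next
      fix a assume "ereal h < a"
      then obtain c where c: "c \<in> \<rat>" "ereal c < a" "h < c" using ereal_between_rat(2) by blast
      then have "\<forall>\<^sub>F n in sequentially. neglog (npd \<mu> Ch R n \<omega>) / ereal (real n) < ereal c" using elim(2) by blast
      then show "\<forall>\<^sub>F n in sequentially. neglog (npd \<mu> Ch R n \<omega>) / ereal (real n) < a"
        by eventually_elim (use c(2) in \<open>blast intro: less_trans\<close>)
    qed
  qed
next
  have eq: "ereal_expect P (\<lambda>\<omega>. neglog (ennreal (npd_real n (block n \<omega>)))) = ereal_expect P (\<lambda>\<omega>. neglog (npd \<mu> Ch R n \<omega>))" for n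
  proof (rule ereal_expect_cong_AE)
    show "AE \<omega> in P. neglog (ennreal (npd_real n (block n \<omega>))) = neglog (npd \<mu> Ch R n \<omega>)"
      using AE_npd_real by eventually_elim (rule spec)
  qed
  show "(\<lambda>n. ereal_expect P (\<lambda>\<omega>. neglog (npd \<mu> Ch R n \<omega>)) / ereal (real n)) \<longlonglongrightarrow> ereal h"
  proof (rule order_tendstoI)
    fix a assume "a < ereal h"
    then obtain c where c: "c \<in> \<rat>" "a < ereal c" "c < h" using ereal_between_rat(1) by blast
    have "\<forall>\<^sub>F n in sequentially. ereal (c * real n) \<le> ereal_expect P (\<lambda>\<omega>. neglog (npd \<mu> Ch R n \<omega>))"
      using dom.expect_lower[OF c(3)] unfolding eq .
    then show "\<forall>\<^sub>F n in sequentially. a < ereal_expect P (\<lambda>\<omega>. neglog (npd \<mu> Ch R n \<omega>)) / ereal (real n)"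
      using eventually_ge_at_top[of 1]
      by eventually_elim (use c(2) lower_divide in \<open>blast intro: less_le_trans\<close>)
  next
    fix a assume "ereal h < a"
    then obtain c where c: "c \<in> \<rat>" "ereal c < a" "h < c" using ereal_between_rat(2) by blast
    show "\<forall>\<^sub>F n in sequentially. ereal_expect P (\<lambda>\<omega>. neglog (npd \<mu> Ch R n \<omega>)) / ereal (real n) < a"
      using expect_upper[OF c(3)] by eventually_elim (use c(2) in \<open>blast intro: less_trans\<close>)
  qed
qed

end

theorem mainTheorem4:
  fixes \<mu> :: "'a measure" and Ch :: "nat \<Rightarrow> 'a set set"
    and R :: "nat \<Rightarrow> (int \<Rightarrow> 'a set) measure"
  assumes "finite_measure \<mu>"
    and "\<exists>G. countable G \<and> sets \<mu> = sigma_sets (space \<mu>) G"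
    and "partition_filtration \<mu> Ch"
    and "\<forall>l. universal_alphabet (Ch l) (R l)"
  shows "universal_wrt \<mu> (npd \<mu> Ch R)"
  unfolding universal_wrt_def
proof (intro allI impI)
  fix P and h :: real
  assume P: "in_E_base \<mu> P \<and> (\<lambda>n. hmu \<mu> P n / ereal (real n)) \<longlonglongrightarrow> ereal h"
  interpret npd_process \<mu> Ch P R h
    by (intro npd_process.intro quantized_process.intro partitioned_space.intro process.intro npd_process_axioms.intro)
      (use assms(1,3) assms(4)[rule_format] P in simp_all)
  show "universal_conv P (\<lambda>n \<omega>. neglog (npd \<mu> Ch R n \<omega>)) h"
    by (rule universal_npd)
qed

end
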